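(* Let $\boldsymbol\mu=(\mu_t)_{t\in[0,T]}\in C([0,T],\mathcal P(\mathbb R^d))$ satisfy the following two conditions. (i) There exists a Borel map $v:[0,T]\times\mathbb R^d\to\mathbb R^d$ with $\int_0^T\int_{\mathbb R^d}|v_t(x)|\,d\mu_t(x)\,dt<+\infty$ such that $\partial_t\mu_t+\operatorname{div}(v_t\mu_t)=0$ both in the classic sense and in duality with generalized cylinder functions, the latter meaning that for every $\hat F\in\operatorname{GC}^1_c(\mathcal P(\mathbb R^d))$ $$\frac{d}{dt}\hat F(\mu_t)=\int_{\mathbb R^d}\nabla_W\hat F(x,\mu_t)\cdot v_t(x)\,d\mu_t(x)\quad\text{in the sense of distributions on }(0,T).$$ (ii) There exists $I_{\boldsymbol\mu}\subset[0,T]$ of full Lebesgue measure such that $\mu_t\in\mathcal P^{\mathrm{pa}}(\mathbb R^d)$ for all $t\in I_{\boldsymbol\mu}$. Then there exists $\lambda\in\mathcal P^{\mathrm{pa}}(C([0,T],\mathbb R^d))$ such that $(\mathrm e_t)_\sharp\lambda=\mu_t$ for all $t\in[0,T]$ and which is concentrated on curves $\gamma\in AC([0,T],\mathbb R^d)$ solving $\dot\gamma(t)=v_t(\gamma(t))$ for a.e. $t\in[0,T]$. In particular one can take $I_{\boldsymbol\mu}=[0,T]$, that is, $\mu_t\in\mathcal P^{\mathrm{pa}}(\mathbb R^d)$ for all $t\in[0,T]$.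
   Context: $\mathcal P(\mathbb R^d)$ has the narrow topology and $C([0,T],\mathcal P(\mathbb R^d))$ is the space of narrowly continuous curves. $\mathrm e_t(\gamma)=\gamma(t)$. For a Polish space $X$, $\mathcal P^{\mathrm{pa}}(X)$ is the set of measures $\sum_{i\in\mathbb N}a_i\delta_{x_i}$ with $x_i\in X$ pairwise distinct, $a_i\in[0,1]$ non-increasing, $\sum_ia_i=1$. The equation $\partial_t\mu_t+\operatorname{div}(v_t\mu_t)=0$ in the classic sense means: for all $\phi\in C^1_c(\mathbb R^d)$, $\frac{d}{dt}\int\phi\,d\mu_t=\int\nabla\phi\cdot v_t\,d\mu_t$ in the sense of distributions on $(0,T)$. Generalized cylinder functions. Write $\mu[x]:=\mu(\{x\})$. For $\hat\phi\in C^1_c(\mathbb R^d\times(0,1])$ (extended by $0$ at second variable $0$) let $\hat L_{\hat\phi}(\mu)=\int_{\mathbb R^d}\hat\phi(x,\mu[x])\,d\mu(x)$. $\operatorname{GC}^1_c(\mathcal P(\mathbb R^d))$ is the set of functions $\hat F(\mu)=\Psi(\hat L_{\hat\phi_1}(\mu),\dots,\hat L_{\hat\phi_k}(\mu))$ with $k\in\mathbb N$, $\Psi\in C^1(\mathbb R^k)$, $\hat\phi_i\in C^1_c(\mathbb R^d\times(0,1])$; its Wasserstein differential is $\nabla_W\hat F(x,\mu)=\sum_{i=1}^k\partial_i\Psi(\hat L_{\hat\phi_1}(\mu),\dots,\hat L_{\hat\phi_k}(\mu))\,\nabla_x\hat\phi_i(x,\mu[x])$. *)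

theory Defs
  imports "HOL-Probability.Probability"
begin

subsection \<open>Probability measures, narrow topology, purely atomic measures\<close>

definition narrow_topology :: "('a::metric_space) measure topology" where
  "narrow_topology = topology_generated_by
     {{M \<in> space (prob_algebra borel). (\<integral>x. apply_bcontfun \<phi> x \<partial>M) \<in> U} | (\<phi> :: 'a \<Rightarrow>\<^sub>C real) U. open U}"

lemma topspace_narrow_topology [simp]:
  "topspace (narrow_topology :: ('a::metric_space) measure topology) = space (prob_algebra borel)"
  unfolding narrow_topology_def topology_generated_by_topspace by (auto intro: open_UNIV)

lemma continuous_map_narrow_topology_iff:
  fixes \<mu> :: "'b \<Rightarrow> ('a::metric_space) measure"
  shows "continuous_map X narrow_topology \<mu> \<longleftrightarrow>
     (\<forall>t\<in>topspace X. \<mu> t \<in> space (prob_algebra borel)) \<and>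
     (\<forall>\<phi> :: 'a \<Rightarrow>\<^sub>C real. continuous_map X euclideanreal (\<lambda>t. \<integral>x. apply_bcontfun \<phi> x \<partial>\<mu> t))"
    (is "?L \<longleftrightarrow> ?P \<and> ?C")
proof
  assume L: ?L
  then have P: ?P
    by (auto simp: continuous_map_def)
  moreover have ?C
  proof (intro allI)
    fix \<phi> :: "'a \<Rightarrow>\<^sub>C real"
    have "openin X {t \<in> topspace X. (\<integral>x. apply_bcontfun \<phi> x \<partial>\<mu> t) \<in> U}" if "open U" for U
    proof -
      let ?V = "{M \<in> space (prob_algebra borel). (\<integral>x. apply_bcontfun \<phi> x \<partial>M) \<in> U}"
      have "openin narrow_topology ?V"
        unfolding narrow_topology_def by (rule topology_generated_by_Basis) (use that in blast)
      with L have "openin X {t \<in> topspace X. \<mu> t \<in> ?V}"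
        by (rule openin_continuous_map_preimage)
      moreover have "{t \<in> topspace X. \<mu> t \<in> ?V} = {t \<in> topspace X. (\<integral>x. apply_bcontfun \<phi> x \<partial>\<mu> t) \<in> U}"
        using P by auto
      ultimately show ?thesis by simp
    qed
    then show "continuous_map X euclideanreal (\<lambda>t. \<integral>x. apply_bcontfun \<phi> x \<partial>\<mu> t)"
      by (auto simp: continuous_map_def)
  qed
  ultimately show "?P \<and> ?C" ..
next
  assume R: "?P \<and> ?C"
  show ?L
    unfolding narrow_topology_def
  proof (rule continuous_on_generated_topo)
    fix V
    assume "V \<in> {{M \<in> space (prob_algebra borel). (\<integral>x. apply_bcontfun \<phi> x \<partial>M) \<in> U} | (\<phi> :: 'a \<Rightarrow>\<^sub>C real) U. open U}"
    then obtain \<phi> :: "'a \<Rightarrow>\<^sub>C real" and U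
      where V: "V = {M \<in> space (prob_algebra borel). (\<integral>x. apply_bcontfun \<phi> x \<partial>M) \<in> U}" and U: "open U"
      by blast
    have "openin X {t \<in> topspace X. (\<integral>x. apply_bcontfun \<phi> x \<partial>\<mu> t) \<in> U}"
      using R U by (intro openin_continuous_map_preimage[of X euclideanreal]) auto
    moreover have "\<mu> -` V \<inter> topspace X = {t \<in> topspace X. (\<integral>x. apply_bcontfun \<phi> x \<partial>\<mu> t) \<in> U}"
      using R V by auto
    ultimately show "openin X (\<mu> -` V \<inter> topspace X)" by simp
  next
    have "\<mu> ` topspace X \<subseteq> topspace narrow_topology"
      using R by auto
    then show "\<mu> ` topspace X \<subseteq>
        \<Union> {{M \<in> space (prob_algebra borel). (\<integral>x. apply_bcontfun \<phi> x \<partial>M) \<in> U} | (\<phi> :: 'a \<Rightarrow>\<^sub>C real) U. open U}"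
      by (simp add: narrow_topology_def topology_generated_by_topspace)
  qed
qed

definition borel_of :: "'a topology \<Rightarrow> 'a measure" where
  "borel_of X = sigma (topspace X) {U. openin X U}"

lemma borel_of_euclidean: "borel_of euclidean = borel"
  by (simp add: borel_of_def borel_def)

definition Ppa :: "'a topology \<Rightarrow> 'a measure set" where
  "Ppa X = {M. sets M = sets (borel_of X) \<and>
     (\<exists>(a :: nat \<Rightarrow> real) x. inj x \<and> range x \<subseteq> topspace X \<and>
        (\<forall>i. 0 \<le> a i \<and> a i \<le> 1) \<and> decseq a \<and> a sums 1 \<and>
        (\<forall>A \<in> sets M. emeasure M A = (\<Sum>i. ennreal (a i) * emeasure (return (borel_of X) (x i)) A)))}"


subsection \<open>Curves\<close>

text \<open>The space of continuous curves on the interval from \<open>0\<close> to \<open>T\<close> with the uniform topology;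
  its points are functions on \<^typ>\<open>real\<close> that are \<^const>\<open>undefined\<close> outside the interval.\<close>

definition curve_space :: "real \<Rightarrow> (real \<Rightarrow> 'a::metric_space) topology" where
  "curve_space T = mtopology_of (cfunspace (top_of_set {0..T}) euclidean_metric)"

definition AC :: "real \<Rightarrow> (real \<Rightarrow> 'a::metric_space) set" where
  "AC T = {\<gamma>. \<forall>\<epsilon>>0. \<exists>\<delta>>0. \<forall>(n::nat) a b.
     (\<forall>i<n. 0 \<le> a i \<and> a i \<le> b i \<and> b i \<le> T) \<longrightarrow>
     disjoint_family_on (\<lambda>i. {a i<..<b i}) {..<n} \<longrightarrow>
     (\<Sum>i<n. b i - a i) < \<delta> \<longrightarrow> (\<Sum>i<n. dist (\<gamma> (a i)) (\<gamma> (b i))) < \<epsilon>}"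


subsection \<open>Continuously differentiable functions\<close>

definition grad :: "('a::real_inner \<Rightarrow> real) \<Rightarrow> 'a \<Rightarrow> 'a" where
  "grad f x = (THE D. GDERIV f x :> D)"

lemma grad_eqI:
  assumes "GDERIV f x :> D"
  shows "grad f x = D"
  unfolding grad_def
proof (rule the_equality[of _ D])
  fix E assume "GDERIV f x :> E"
  with assms have "(\<lambda>h. inner h D) = (\<lambda>h. inner h E)"
    unfolding gderiv_def by (rule has_derivative_unique)
  then show "E = D"
    using vector_eq_ldot[of D E] by (auto simp: fun_eq_iff)
qed (fact assms)

text \<open>On a set with boundary, differentiability at boundary points is relative to the set.\<close>

definition C1_on :: "'a::euclidean_space set \<Rightarrow> ('a \<Rightarrow> real) \<Rightarrow> bool" where
  "C1_on S f \<longleftrightarrow> (\<exists>D. continuous_on S D \<and>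
     (\<forall>p\<in>S. (f has_derivative (\<lambda>h. inner h (D p))) (at p within S)))"

text \<open>Continuously differentiable functions on \<open>S\<close> whose support is compact and contained in
  \<open>S\<close>, extended by zero to the whole space.\<close>

definition C1c :: "'a::euclidean_space set \<Rightarrow> ('a \<Rightarrow> real) set" where
  "C1c S = {f. C1_on S f \<and> compact (closure {p. f p \<noteq> 0}) \<and> closure {p. f p \<noteq> 0} \<subseteq> S}"

text \<open>For varying \<open>k\<close>, the space \<open>\<real>\<^sup>k\<close> is \<^const>\<open>Euclidean_space\<close>: sequences vanishing
  from index \<open>k\<close> on.\<close>

definition partial :: "nat \<Rightarrow> ((nat \<Rightarrow> real) \<Rightarrow> real) \<Rightarrow> (nat \<Rightarrow> real) \<Rightarrow> real" where
  "partial i \<Psi> y = deriv (\<lambda>s. \<Psi> (y(i := s))) (y i)"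

definition C1_Rk :: "nat \<Rightarrow> ((nat \<Rightarrow> real) \<Rightarrow> real) \<Rightarrow> bool" where
  "C1_Rk k \<Psi> \<longleftrightarrow> continuous_map (Euclidean_space k) euclideanreal \<Psi> \<and>
     (\<forall>i<k. (\<forall>y \<in> topspace (Euclidean_space k). (\<lambda>s. \<Psi> (y(i := s))) differentiable (at (y i))) \<and>
            continuous_map (Euclidean_space k) euclideanreal (partial i \<Psi>))"


subsection \<open>Derivatives in the sense of distributions\<close>

definition test_functions :: "real \<Rightarrow> (real \<Rightarrow> real) set" where
  "test_functions T = {\<eta>. (\<forall>n t. (deriv ^^ n) \<eta> differentiable (at t)) \<and>
     compact (closure {t. \<eta> t \<noteq> 0}) \<and> closure {t. \<eta> t \<noteq> 0} \<subseteq> {0<..<T}}"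

definition has_distr_deriv :: "real \<Rightarrow> (real \<Rightarrow> real) \<Rightarrow> (real \<Rightarrow> real) \<Rightarrow> bool" where
  "has_distr_deriv T f g \<longleftrightarrow>
     (\<forall>K. compact K \<longrightarrow> K \<subseteq> {0<..<T} \<longrightarrow> set_integrable lborel K f \<and> set_integrable lborel K g) \<and>
     (\<forall>\<eta> \<in> test_functions T.
        (LINT t:{0<..<T}|lborel. f t * deriv \<eta> t) = - (LINT t:{0<..<T}|lborel. g t * \<eta> t))"


subsection \<open>Generalized cylinder functions\<close>

text \<open>Membership of \<open>\<phi>\<close> in \<open>C1c (UNIV \<times> {0<..1})\<close> makes \<open>\<phi> (x, 0) = 0\<close>.\<close>

definition Lhat :: "('a::euclidean_space \<times> real \<Rightarrow> real) \<Rightarrow> 'a measure \<Rightarrow> real" where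
  "Lhat \<phi> M = (\<integral>x. \<phi> (x, measure M {x}) \<partial>M)"

definition Lhat_vec :: "nat \<Rightarrow> (nat \<Rightarrow> 'a::euclidean_space \<times> real \<Rightarrow> real) \<Rightarrow> 'a measure \<Rightarrow> nat \<Rightarrow> real" where
  "Lhat_vec k \<phi> M = (\<lambda>i. if i < k then Lhat (\<phi> i) M else 0)"

text \<open>Generalized cylinder functions are given through their representations
  \<open>(k, \<Psi>, \<phi>)\<close>, in terms of which the Wasserstein differential is defined.\<close>

definition GC1c_rep ::
  "nat \<Rightarrow> ((nat \<Rightarrow> real) \<Rightarrow> real) \<Rightarrow> (nat \<Rightarrow> 'a::euclidean_space \<times> real \<Rightarrow> real) \<Rightarrow> bool" where
  "GC1c_rep k \<Psi> \<phi> \<longleftrightarrow> C1_Rk k \<Psi> \<and> (\<forall>i<k. \<phi> i \<in> C1c (UNIV \<times> {0<..1}))"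

definition GC_fun ::
  "nat \<Rightarrow> ((nat \<Rightarrow> real) \<Rightarrow> real) \<Rightarrow> (nat \<Rightarrow> 'a::euclidean_space \<times> real \<Rightarrow> real) \<Rightarrow> 'a measure \<Rightarrow> real" where
  "GC_fun k \<Psi> \<phi> M = \<Psi> (Lhat_vec k \<phi> M)"

definition GC_gradW ::
  "nat \<Rightarrow> ((nat \<Rightarrow> real) \<Rightarrow> real) \<Rightarrow> (nat \<Rightarrow> 'a::euclidean_space \<times> real \<Rightarrow> real) \<Rightarrow> 'a \<Rightarrow> 'a measure \<Rightarrow> 'a" where
  "GC_gradW k \<Psi> \<phi> x M =
     (\<Sum>i<k. partial i \<Psi> (Lhat_vec k \<phi> M) *\<^sub>R grad (\<lambda>y. \<phi> i (y, measure M {x})) x)"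


subsection \<open>The continuity equation\<close>

definition CE_classic ::
  "real \<Rightarrow> (real \<Rightarrow> 'a::euclidean_space measure) \<Rightarrow> (real \<Rightarrow> 'a \<Rightarrow> 'a) \<Rightarrow> bool" where
  "CE_classic T \<mu> v \<longleftrightarrow> (\<forall>\<phi> \<in> C1c UNIV.
     has_distr_deriv T (\<lambda>t. \<integral>x. \<phi> x \<partial>\<mu> t) (\<lambda>t. \<integral>x. grad \<phi> x \<bullet> v t x \<partial>\<mu> t))"

definition CE_GC ::
  "real \<Rightarrow> (real \<Rightarrow> 'a::euclidean_space measure) \<Rightarrow> (real \<Rightarrow> 'a \<Rightarrow> 'a) \<Rightarrow> bool" where
  "CE_GC T \<mu> v \<longleftrightarrow> (\<forall>k \<Psi> \<phi>. GC1c_rep k \<Psi> \<phi> \<longrightarrow>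
     has_distr_deriv T (\<lambda>t. GC_fun k \<Psi> \<phi> (\<mu> t)) (\<lambda>t. \<integral>x. GC_gradW k \<Psi> \<phi> x (\<mu> t) \<bullet> v t x \<partial>\<mu> t))"

end

theory Submission
  imports Defs "HOL-Computational_Algebra.Polynomial"
begin

text \<open>
  Take a generalized cylinder function with \<open>k = 1\<close>, \<open>\<Psi> = id\<close> and
  \<open>\<phi> (x, m) = f x * \<zeta> m\<close>. Duality with it says that the image of \<open>\<mu> t\<close> under
  \<open>x \<mapsto> (x, measure (\<mu> t) {x})\<close> solves a continuity equation whose velocity is \<open>v t\<close> in the
  space variable and \<open>0\<close> in the mass variable: atoms move with \<open>v\<close> and keep their masses. Only
  finitely many atoms have mass at least \<open>\<epsilon>\<close>, so a bump \<open>\<zeta>\<close> can be chosen that is \<open>1\<close> at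
  one given mass \<open>a\<close> and \<open>0\<close> at all other masses that occur. What remains of \<open>\<mu> t\<close> is then
  the finite set \<open>level a t\<close> of its atoms of mass \<open>a\<close>.

  Letting \<open>f\<close> tend to \<open>1\<close> shows that the number of atoms of mass \<open>a\<close> is the same at almost
  all times (\<open>card_level_constant\<close>). For other \<open>f\<close> one obtains the transport identity
  \<open>(\<Sum>x\<in>level a t. f x) - (\<Sum>x\<in>level a s. f x)
     = (LINT r:{s..t}|lborel. \<Sum>x\<in>level a r. grad f x \<bullet> v r x)\<close>
  for almost all \<open>s < t\<close>, where one null set serves countably many \<open>f\<close>
  (\<open>distr_deriv_integral\<close>, \<open>good_exists\<close>, \<open>level_particle_system\<close>).

  A representation by an arbitrary measure on curves would not be enough: atoms of equal mass may
  meet at exceptional times, and there a measure on curves may split each of them in any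
  proportion. So the curves are chosen one by one. With \<open>f\<close> a smooth indicator of a
  neighbourhood of some of the points at time \<open>s\<close>, the transport identity is Hall's condition
  for a bijection of \<open>level a s\<close> with \<open>level a t\<close> that displaces no point by more than a
  constant times the integral of the total speed from \<open>s\<close> to \<open>t\<close> (\<open>matching\<close>). This bound is additive in
  time, so finitely many times can be matched consistently, and by compactness all good times
  simultaneously (\<open>compatible_enumerations\<close>); the resulting curves extend to absolutely
  continuous curves on the whole interval (\<open>curves_exist\<close>). At a good time the points are
  pairwise distinct, so the transport identity for a coordinate function cut off near one of them
  says that its derivative is \<open>v\<close> (\<open>curves_velocity\<close>).

  Finally fix a good time \<open>t\<^sub>0\<close>. The enumeration of the atoms of \<open>\<mu> t\<^sub>0\<close> by decreasing mass
  also enumerates the curves through them, which gives the measure on curves. Its marginals are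
  \<open>\<mu> t\<close> at the good times, which are dense, hence at all times by narrow continuity. Curves may
  coincide at an exceptional time; \<open>countably_supported_in_Ppa\<close> merges and sorts the atoms there.
\<close>

section \<open>Averages and indefinite integrals\<close>

lemma integrable_imp_set_integrable:
  fixes g :: "real \<Rightarrow> real"
  assumes "integrable lborel g" "A \<in> sets borel"
  shows "set_integrable lborel A g"
  unfolding set_integrable_def using integrable_mult_indicator[of A lborel g] assms by simp

lemma set_integral_atMost_diff:
  fixes g :: "real \<Rightarrow> real"
  assumes "integrable lborel g" "s \<le> t"
  shows "(LINT y:{..t}|lborel. g y) - (LINT y:{..s}|lborel. g y) = (LINT y:{s..t}|lborel. g y)"
proof -
  have si: "set_integrable lborel A g" if "A \<in> sets borel" for A
    using assms(1) that by (rule integrable_imp_set_integrable)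
  have "{..t} = {..s} \<union> {s<..t}" using assms(2) by auto
  moreover have "(LINT y:{..s} \<union> {s<..t}|lborel. g y) = (LINT y:{..s}|lborel. g y) + (LINT y:{s<..t}|lborel. g y)"
    by (rule set_integral_Un) (auto intro!: si)
  ultimately have "(LINT y:{..t}|lborel. g y) = (LINT y:{..s}|lborel. g y) + (LINT y:{s<..t}|lborel. g y)"
    by simp
  moreover have "(LINT y:{s<..t}|lborel. g y) = (LINT y:{s..t}|lborel. g y)"
  proof (rule set_integral_cong_set[symmetric])
    show "AE x in lborel. (x \<in> {s<..t}) = (x \<in> {s..t})"
      using AE_lborel_singleton[of s] by eventually_elim auto
    show "set_borel_measurable lborel {s<..t} g" "set_borel_measurable lborel {s..t} g"
      using si[of "{s<..t}"] si[of "{s..t}"]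
      by (auto simp: set_integrable_def set_borel_measurable_def)
  qed
  ultimately show ?thesis by simp
qed

text \<open>Lebesgue differentiation along boxes with a fixed lower corner: in dimension one these are the
  intervals to the right of a point.\<close>

lemma right_averages_tendsto:
  fixes g :: "real \<Rightarrow> real"
  assumes "integrable lborel g"
  shows "AE t in lborel. ((\<lambda>h. (LINT y:{t..t+h}|lborel. g y) / h) \<longlongrightarrow> g t) (at_right 0)"
proof -
  have si: "set_integrable lborel A g" if "A \<in> sets borel" for A
    using assms that by (rule integrable_imp_set_integrable)
  have "g integrable_on cbox a b" for a b
    using set_borel_integral_eq_integral(1)[OF si] by auto
  then obtain N where N: "negligible N" and
     *: "\<And>x e. \<lbrakk>x \<notin> N; 0 < e\<rbrakk> \<Longrightarrow> \<exists>d>0. \<forall>h. 0 < h \<and> h < d \<longrightarrow>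
           norm (integral (cbox x (x + h *\<^sub>R One)) g /\<^sub>R h ^ DIM(real) - g x) < e"
    using integrable_ccontinuous_explicit by blast
  have "AE t in lebesgue. t \<notin> N"
    using N by (intro AE_not_in) (simp add: negligible_iff_null_sets)
  then have "AE t in lborel. t \<notin> N"
    by (simp add: AE_completion_iff)
  then show ?thesis
  proof eventually_elim
    case (elim t)
    have "\<exists>d>0. \<forall>h>0. h < d \<longrightarrow> dist ((LINT y:{t..t+h}|lborel. g y) / h) (g t) < e" if "e > 0" for e
    proof -
      obtain d where "d > 0" and d: "\<And>h. 0 < h \<Longrightarrow> h < d \<Longrightarrow>
           norm (integral (cbox t (t + h *\<^sub>R One)) g /\<^sub>R h ^ DIM(real) - g t) < e"
        using *[OF elim \<open>e > 0\<close>] by blast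
      have "(LINT y:{t..t+h}|lborel. g y) = integral {t..t+h} g" for h
        using set_borel_integral_eq_integral(2)[OF si] by auto
      then show ?thesis
        using d \<open>d > 0\<close> by (auto intro!: exI[of _ d] simp: dist_real_def field_simps)
    qed
    then show ?case
      by (auto simp: tendsto_iff eventually_at_right_field)
  qed
qed

text \<open>The left difference quotient is a right average of the reflected function.\<close>

lemma indefinite_integral_has_derivative_AE:
  fixes g :: "real \<Rightarrow> real"
  assumes "integrable lborel g"
  shows "AE t in lborel. ((\<lambda>x. LINT y:{..x}|lborel. g y) has_real_derivative g t) (at t)"
proof -
  define U where "U x = (LINT y:{..x}|lborel. g y)" for x
  have refl: "integrable lborel (\<lambda>x. g (- x))"
    using lborel_integrable_real_affine[OF assms, of "-1" 0] by simp
  have refl_AE: "AE t in lborel. P (- t)" if "AE t in lborel. P t" for P :: "real \<Rightarrow> bool"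
  proof -
    have d: "distr lborel borel uminus = (lborel :: real measure)" 
      by (simp add: lborel_distr_uminus)
    from that have "AE t in distr lborel borel uminus. P t"
      by (subst d)
    then show ?thesis
      by (rule AE_distrD[rotated]) simp
  qed
  have AE2: "AE t in lborel. ((\<lambda>h. (LINT y:{- t..- t+h}|lborel. g (- y)) / h) \<longlongrightarrow> g (- (- t))) (at_right 0)"
    using refl_AE[OF right_averages_tendsto[OF refl]] by simp
  have shift: "(LINT y:{- t..- t+h}|lborel. g (- y)) = (LINT y:{t - h..t}|lborel. g y)" for t h
  proof -
    have "(LINT y:{t - h..t}|lborel. g y) = (LINT y|lborel. indicator {t - h..t} (- y) *\<^sub>R g (- y))"
      unfolding set_lebesgue_integral_def
      by (subst lborel_integral_real_affine[where t=0 and c="-1"]) auto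
    also have "\<dots> = (LINT y:{- t..- t+h}|lborel. g (- y))"
      unfolding set_lebesgue_integral_def
      by (intro Bochner_Integration.integral_cong) (auto simp: indicator_def)
    finally show ?thesis by simp
  qed
  have "AE t in lborel. (U has_real_derivative g t) (at t)"
    using right_averages_tendsto[OF assms] AE2
  proof eventually_elim
    case (elim t)
    have "((\<lambda>h. (U (t + h) - U t) / h) \<longlongrightarrow> g t) (at_right 0)"
    proof (rule Lim_transform_eventually[OF elim(1)])
      show "\<forall>\<^sub>F h in at_right 0. (LINT y:{t..t+h}|lborel. g y) / h = (U (t + h) - U t) / h"
        unfolding U_def using set_integral_atMost_diff[OF assms]
        by (auto simp: eventually_at_right_field intro!: exI[of _ 1])
    qed
    moreover have "((\<lambda>h. (U (t + h) - U t) / h) \<longlongrightarrow> g t) (at_left 0)"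
      unfolding filterlim_at_left_to_right
    proof simp
      show "((\<lambda>x. - ((U (t - x) - U t) / x)) \<longlongrightarrow> g t) (at_right 0)"
      proof (rule Lim_transform_eventually[OF elim(2)[simplified]])
        show "\<forall>\<^sub>F h in at_right 0. (LINT y:{- t..h - t}|lborel. g (- y)) / h = - ((U (t - h) - U t) / h)"
        proof (rule eventually_at_rightI[of 0 1])
          fix h :: real assume h: "h \<in> {0<..<1}"
          then have "U t - U (t - h) = (LINT y:{t - h..t}|lborel. g y)"
            unfolding U_def using set_integral_atMost_diff[OF assms, of "t - h" t] by simp
          then show "(LINT y:{- t..h - t}|lborel. g (- y)) / h = - ((U (t - h) - U t) / h)"
            using shift[of t h] by (simp add: minus_divide_left)
        qed simp
      qed
    qed
    ultimately show ?case
      by (simp add: DERIV_def filterlim_split_at)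
  qed
  then show ?thesis by (simp add: U_def[abs_def])
qed

section \<open>Smooth bumps and the lemma of du Bois-Reymond\<close>

text \<open>The family \<open>P (1 / x) * exp (- 1 / x)\<close> is closed under differentiation, which gives the
  smoothness of \<open>exp (- 1 / x)\<close> without computing higher derivatives.\<close>

definition flat_exp :: "real poly \<Rightarrow> real \<Rightarrow> real" where
  "flat_exp p x = (if x > 0 then poly p (1 / x) * exp (- (1 / x)) else 0)"

lemma poly_times_exp_tendsto_0:
  fixes p :: "real poly"
  shows "((\<lambda>y. poly p y * exp (- y)) \<longlongrightarrow> 0) at_top"
proof -
  have "((\<lambda>y. \<Sum>i\<le>degree p. coeff p i * (y ^ i / exp y)) \<longlongrightarrow> (\<Sum>i\<le>degree p. coeff p i * 0)) at_top"
    by (intro tendsto_intros tendsto_power_div_exp_0)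
  then show ?thesis
    by (simp add: poly_altdef sum_distrib_right exp_minus divide_inverse mult.assoc)
qed

lemma flat_exp_has_derivative:
  "(flat_exp p has_real_derivative flat_exp ([:0, 0, 1:] * (p - pderiv p)) x) (at x)"
proof -
  consider "x > 0" | "x = 0" | "x < 0" by linarith
  then show ?thesis
  proof cases
    case 1
    have "((\<lambda>x. poly p (1 / x) * exp (- (1 / x))) has_real_derivative
        flat_exp ([:0, 0, 1:] * (p - pderiv p)) x) (at x)"
      using 1 by (auto intro!: derivative_eq_intros simp: flat_exp_def field_simps power2_eq_square)
    then show ?thesis
      by (rule has_field_derivative_transform_within_open[where S="{0<..}"])
         (use 1 in \<open>auto simp: flat_exp_def\<close>)
  next
    case 2
    have "((\<lambda>h. poly (pCons 0 p) (inverse h) * exp (- inverse h)) \<longlongrightarrow> 0) (at_right 0)"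
      by (rule filterlim_compose[OF poly_times_exp_tendsto_0 filterlim_inverse_at_top_right])
    then have "((\<lambda>h. (flat_exp p (x + h) - flat_exp p x) / h) \<longlongrightarrow> 0) (at_right 0)"
      by (rule Lim_transform_eventually)
         (auto simp: 2 flat_exp_def eventually_at_right_field field_simps intro!: exI[of _ 1])
    moreover have "((\<lambda>h. (flat_exp p (x + h) - flat_exp p x) / h) \<longlongrightarrow> 0) (at_left 0)"
      by (rule Lim_transform_eventually[OF tendsto_const])
         (auto simp: 2 flat_exp_def eventually_at_left_field intro!: exI[of _ "-1"])
    ultimately show ?thesis
      by (simp add: DERIV_def filterlim_split_at 2 flat_exp_def)
  next
    case 3
    have "((\<lambda>x. 0) has_real_derivative flat_exp ([:0, 0, 1:] * (p - pderiv p)) x) (at x)"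
      using 3 by (auto simp: flat_exp_def)
    then show ?thesis
      by (rule has_field_derivative_transform_within_open[where S="{..<0}"])
         (use 3 in \<open>auto simp: flat_exp_def\<close>)
  qed
qed

text \<open>A set of functions, closed under differentiation, that contains the bumps used below. By
  \<open>iterated_deriv_differentiable\<close>, closure under differentiation is all that smoothness needs.\<close>

inductive_set flat_bumps :: "(real \<Rightarrow> real) set" where
  prod: "(\<lambda>x. flat_exp p (c * (x - s)) * flat_exp q (c * (t - x))) \<in> flat_bumps"
| add: "f \<in> flat_bumps \<Longrightarrow> g \<in> flat_bumps \<Longrightarrow> (\<lambda>x. f x + g x) \<in> flat_bumps"
| scale: "f \<in> flat_bumps \<Longrightarrow> (\<lambda>x. k * f x) \<in> flat_bumps"

lemma flat_bumps_derivative: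
  assumes "f \<in> flat_bumps"
  shows "\<exists>g\<in>flat_bumps. \<forall>x. (f has_real_derivative g x) (at x)"
  using assms
proof induction
  case (prod p c s q t)
  define d where "d = (\<lambda>p :: real poly. [:0, 0, 1:] * (p - pderiv p))"
  let ?g = "\<lambda>x. c * (flat_exp (d p) (c * (x - s)) * flat_exp q (c * (t - x)))
    + (- c) * (flat_exp p (c * (x - s)) * flat_exp (d q) (c * (t - x)))"
  have D: "(flat_exp p has_real_derivative flat_exp (d p) x) (at x)" for p x
    unfolding d_def by (rule flat_exp_has_derivative)
  show ?case
  proof (intro bexI allI)
    show "?g \<in> flat_bumps" by (intro flat_bumps.intros)
    show "((\<lambda>x. flat_exp p (c * (x - s)) * flat_exp q (c * (t - x))) has_real_derivative ?g x) (at x)" for x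
      by (rule derivative_eq_intros DERIV_chain2[OF D] refl)+ (simp add: algebra_simps)
  qed
next
  case (add f g)
  then obtain f' g' where "f' \<in> flat_bumps" "\<forall>x. (f has_real_derivative f' x) (at x)"
     "g' \<in> flat_bumps" "\<forall>x. (g has_real_derivative g' x) (at x)"
    by blast
  then show ?case
    by (intro bexI[of _ "\<lambda>x. f' x + g' x"] allI DERIV_add flat_bumps.add) auto
next
  case (scale f k)
  then obtain f' where "f' \<in> flat_bumps" "\<forall>x. (f has_real_derivative f' x) (at x)"
    by blast
  then show ?case
    by (intro bexI[of _ "\<lambda>x. k * f' x"] allI DERIV_cmult flat_bumps.scale) auto
qed

lemma iterated_deriv_differentiable:
  assumes S: "\<And>f. f \<in> S \<Longrightarrow> \<exists>g\<in>S. \<forall>x. (f has_real_derivative g x) (at x)" and "f \<in> S"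
  shows "(deriv ^^ n) f differentiable (at x)"
proof -
  have *: "deriv f \<in> S" if fS: "f \<in> S" for f
  proof -
    obtain g where "g \<in> S" "\<forall>x. (f has_real_derivative g x) (at x)" using S[OF fS] by blast
    then have "deriv f = g" by (auto simp: fun_eq_iff intro: DERIV_imp_deriv)
    with \<open>g \<in> S\<close> show ?thesis by simp
  qed
  have "(deriv ^^ n) f \<in> S"
    by (induction n) (auto simp: \<open>f \<in> S\<close> *)
  then show ?thesis
    using S real_differentiable_def by blast
qed

text \<open>As \<open>n\<close> grows, these smooth bumps increase to the indicator of the open interval from \<open>a\<close> to
  \<open>b\<close>; their supports stay in the closed interval.\<close>

definition flat_bump :: "nat \<Rightarrow> real \<Rightarrow> real \<Rightarrow> real \<Rightarrow> real" where
  "flat_bump n a b x = flat_exp 1 (real (Suc n) * (x - a)) * flat_exp 1 (real (Suc n) * (b - x))"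

lemma flat_bump_in_flat_bumps: "flat_bump n a b \<in> flat_bumps"
  unfolding flat_bump_def[abs_def] by (rule flat_bumps.prod)

lemma flat_bump_continuous: "continuous_on UNIV (flat_bump n a b)"
  using flat_bumps_derivative[OF flat_bump_in_flat_bumps]
  by (meson DERIV_continuous_on has_field_derivative_at_within)

lemma flat_bump_measurable [measurable]: "flat_bump n a b \<in> borel_measurable borel"
  using flat_bump_continuous by (rule borel_measurable_continuous_onI)

lemma flat_exp_one_bounds: "0 \<le> flat_exp 1 x" "flat_exp 1 x \<le> 1"
  by (auto simp: flat_exp_def)

lemma flat_bump_nonneg: "0 \<le> flat_bump n a b x"
  and flat_bump_le_1: "flat_bump n a b x \<le> 1"
  unfolding flat_bump_def by (auto intro!: mult_le_one mult_nonneg_nonneg simp: flat_exp_one_bounds)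

lemma flat_bump_outside: "x \<notin> {a<..<b} \<Longrightarrow> flat_bump n a b x = 0"
  by (auto simp: flat_bump_def flat_exp_def zero_less_mult_iff)

lemma flat_bump_tendsto: "(\<lambda>n. flat_bump n a b x) \<longlonglongrightarrow> indicator {a<..<b} x"
proof (cases "x \<in> {a<..<b}")
  case True
  have "(\<lambda>n. flat_exp 1 (real (Suc n) * y)) \<longlonglongrightarrow> 1" if y: "y > 0" for y
  proof -
    have "(\<lambda>n. exp (- (1 / y * (1 / real (Suc n))))) \<longlonglongrightarrow> exp (- (1 / y * 0))"
      by (intro tendsto_intros LIMSEQ_inverse_real_of_nat[unfolded inverse_eq_divide])
    then show ?thesis using y by (simp add: flat_exp_def mult.commute)
  qed
  from tendsto_mult[OF this this, of "x - a" "b - x"] True show ?thesis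
    by (simp add: flat_bump_def)
qed (simp add: flat_bump_outside)

lemma flat_bump_integral_tendsto:
  fixes w :: "real \<Rightarrow> real"
  assumes w: "integrable lborel w"
  shows "(\<lambda>n. LINT x|lborel. w x * flat_bump n a b x) \<longlonglongrightarrow> (LINT x:{a..b}|lborel. w x)"
proof -
  have [measurable]: "w \<in> borel_measurable borel" using w by auto
  have "(\<lambda>n. LINT x|lborel. w x * flat_bump n a b x) \<longlonglongrightarrow> (LINT x|lborel. w x * indicator {a..b} x)"
  proof (rule integral_dominated_convergence[where w="\<lambda>x. norm (w x)"])
    show "AE x in lborel. (\<lambda>n. w x * flat_bump n a b x) \<longlonglongrightarrow> w x * indicator {a..b} x"
      using AE_lborel_singleton[of a] AE_lborel_singleton[of b]
    proof eventually_elim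
      case (elim x)
      then have "indicator {a..b} x = (indicator {a<..<b} x :: real)" by (auto simp: indicator_def)
      then show ?case by (auto intro!: tendsto_mult flat_bump_tendsto)
    qed
    show "AE x in lborel. norm (w x * flat_bump n a b x) \<le> norm (w x)" for n
      by (auto simp: abs_mult abs_of_nonneg flat_bump_nonneg intro!: mult_left_le flat_bump_le_1)
  qed (use w in auto)
  then show ?thesis by (simp add: set_lebesgue_integral_def mult.commute)
qed

lemma flat_bump_integrable: "integrable lborel (flat_bump n a b)"
proof (rule Bochner_Integration.integrable_bound[where f="indicator {a..b} :: real \<Rightarrow> real"])
  show "AE x in lborel. norm (flat_bump n a b x) \<le> norm (indicator {a..b} x :: real)"
  proof (rule AE_I2)
    fix x show "norm (flat_bump n a b x) \<le> norm (indicator {a..b} x :: real)"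
      using flat_bump_outside[of x a b n] flat_bump_nonneg[of n a b x] flat_bump_le_1[of n a b x]
      by (cases "x \<in> {a..b}") auto
  qed
qed (auto intro!: integrable_real_indicator simp: emeasure_lborel_Icc_eq)

lemma flat_bump_mass_tendsto:
  assumes "a \<le> b"
  shows "(\<lambda>n. LINT x|lborel. flat_bump n a b x) \<longlonglongrightarrow> b - a"
proof -
  have eq: "indicator {a..b} x * flat_bump n a b x = flat_bump n a b x" for n x
    using flat_bump_outside[of x a b n] by (cases "x \<in> {a..b}") auto
  have "(\<lambda>n. LINT x|lborel. indicator {a..b} x * flat_bump n a b x) \<longlonglongrightarrow> (LINT x:{a..b}|lborel. indicator {a..b} x)"
    by (rule flat_bump_integral_tendsto) (auto intro!: integrable_real_indicator simp: emeasure_lborel_Icc_eq)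
  moreover have "(LINT x:{a..b}|lborel. indicator {a..b} x) = (b - a :: real)"
    using assms by (simp add: set_lebesgue_integral_def flip: indicator_inter_arith)
  ultimately show ?thesis by (simp only: eq)
qed

lemma flat_bump_mass_pos:
  assumes "a < b"
  shows "0 < (LINT x|lborel. flat_bump n a b x)"
proof -
  have "(LINT x|lborel. flat_bump n a b x) \<noteq> 0"
  proof
    assume "(LINT x|lborel. flat_bump n a b x) = 0"
    then have "AE x in lborel. flat_bump n a b x = 0"
      using integral_nonneg_eq_0_iff_AE[OF flat_bump_integrable] by (auto simp: flat_bump_nonneg)
    then have "AE x in lborel. x \<notin> {a<..<b}"
      by eventually_elim (auto simp: flat_bump_def flat_exp_def)
    then have "{a<..<b} \<in> null_sets lborel"
      by (subst AE_iff_null_sets) auto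
    then show False using assms by (auto simp: null_sets_def)
  qed
  moreover have "0 \<le> (LINT x|lborel. flat_bump n a b x)"
    by (intro Bochner_Integration.integral_nonneg flat_bump_nonneg)
  ultimately show ?thesis by simp
qed

lemma smooth_step:
  assumes "a < b"
  obtains \<theta> where "\<And>x. (\<theta> has_real_derivative flat_bump n a b x / (LINT x|lborel. flat_bump n a b x)) (at x)"
    "\<And>x. x \<le> a \<Longrightarrow> \<theta> x = 0" "\<And>x. b \<le> x \<Longrightarrow> \<theta> x = 1" "\<And>x. 0 \<le> \<theta> x" "\<And>x. \<theta> x \<le> 1"
proof -
  let ?f = "flat_bump n a b"
  define J where "J = (LINT x|lborel. ?f x)"
  have J: "J > 0" unfolding J_def by (rule flat_bump_mass_pos[OF assms])
  have cont: "isCont ?f x" for x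
    using flat_bump_continuous by (simp add: continuous_on_eq_continuous_at)
  obtain F where F: "\<And>x. (F has_vector_derivative ?f x) (at x)"
    using einterval_antiderivative[of "-\<infinity>" "\<infinity>" ?f] cont by auto
  then have DF: "(F has_real_derivative ?f x) (at x)" for x
    by (simp add: has_real_derivative_iff_has_vector_derivative)
  have const: "F x = F y" if "x < y" "y \<le> a \<or> b \<le> x" for x y
  proof -
    obtain z where "z > x" "z < y" "F y - F x = (y - x) * ?f z"
      using MVT2[OF \<open>x < y\<close>, of F ?f] DF by blast
    moreover have "?f z = 0"
      using that \<open>z > x\<close> \<open>z < y\<close> by (intro flat_bump_outside) auto
    ultimately show ?thesis by simp
  qed
  have "(LINT x|lborel. indicator {a..b} x *\<^sub>R ?f x) = F b - F a"
    using assms F cont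
    by (intro integral_FTC_atLeastAtMost) (auto intro: has_vector_derivative_at_within continuous_on_subset[OF flat_bump_continuous])
  also have "(\<lambda>x. indicator {a..b} x *\<^sub>R ?f x) = ?f"
  proof
    show "indicator {a..b} x *\<^sub>R ?f x = ?f x" for x
      using flat_bump_outside[of x a b n] by (cases "x \<in> {a..b}") auto
  qed
  finally have Jeq: "F b - F a = J" by (simp add: J_def)
  define \<theta> where "\<theta> x = (F x - F a) / J" for x
  have mono: "F x \<le> F y" if "x \<le> y" for x y
    using that DF flat_bump_nonneg by (intro DERIV_nonneg_imp_nondecreasing[of x y F]) blast+
  have 1: "\<theta> x = 0" if "x \<le> a" for x using that const[of x a] by (cases "x = a") (auto simp: \<theta>_def)
  have Fb: "F x = F b" if "b \<le> x" for x using that const[of b x] by (cases "x = b") auto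
  have 2: "\<theta> x = 1" if "b \<le> x" for x unfolding \<theta>_def Fb[OF that] Jeq using J by simp
  have mono': "\<theta> x \<le> \<theta> y" if "x \<le> y" for x y
    unfolding \<theta>_def using J mono[OF that] by (simp add: divide_right_mono)
  show thesis
  proof
    show "(\<theta> has_real_derivative ?f x / (LINT x|lborel. ?f x)) (at x)" for x
      unfolding \<theta>_def[abs_def] J_def[symmetric] using DF[of x] J by (auto intro!: derivative_eq_intros)
    show "0 \<le> \<theta> x" for x using 1[of x] 1[of a] mono'[of a x] by (cases "x \<le> a") auto
    show "\<theta> x \<le> 1" for x using 2[of x] 2[of b] mono'[of x b] by (cases "b \<le> x") auto
  qed (fact 1 2)+
qed

text \<open>The test functions of the proof of \<open>distr_deriv_integral\<close>: smooth trapezoids over the interval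
  from \<open>s\<close> to \<open>t\<close>. Their derivatives are a normalized bump just after \<open>s\<close> minus one just after
  \<open>t\<close>, so a distributional derivative tested against them compares averages at \<open>s\<close> and \<open>t\<close>.\<close>

lemma smooth_trapezoid:
  assumes "0 < s" "0 < h" "s + h \<le> t" "t + h < T"
  obtains \<eta> where "\<eta> \<in> test_functions T"
    "deriv \<eta> = (\<lambda>x. flat_bump n s (s + h) x / (LINT x|lborel. flat_bump n s (s + h) x)
       - flat_bump n t (t + h) x / (LINT x|lborel. flat_bump n t (t + h) x))"
    "\<And>x. \<bar>\<eta> x - indicator {s..t} x\<bar> \<le> indicator {s..s + h} x + indicator {t..t + h} x"
    "\<eta> \<in> borel_measurable borel"
proof -
  let ?J = "\<lambda>a. LINT x|lborel. flat_bump n a (a + h) x"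
  obtain \<theta>1 where 1: "\<And>x. (\<theta>1 has_real_derivative flat_bump n s (s + h) x / ?J s) (at x)"
    "\<And>x. x \<le> s \<Longrightarrow> \<theta>1 x = 0" "\<And>x. s + h \<le> x \<Longrightarrow> \<theta>1 x = 1" "\<And>x. 0 \<le> \<theta>1 x" "\<And>x. \<theta>1 x \<le> 1"
    using smooth_step[of s "s + h" n] assms by (auto simp: add.commute)
  obtain \<theta>2 where 2: "\<And>x. (\<theta>2 has_real_derivative flat_bump n t (t + h) x / ?J t) (at x)"
    "\<And>x. x \<le> t \<Longrightarrow> \<theta>2 x = 0" "\<And>x. t + h \<le> x \<Longrightarrow> \<theta>2 x = 1" "\<And>x. 0 \<le> \<theta>2 x" "\<And>x. \<theta>2 x \<le> 1"
    using smooth_step[of t "t + h" n] assms by (auto simp: add.commute)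
  define \<eta> where "\<eta> x = \<theta>1 x - \<theta>2 x" for x
  let ?d = "\<lambda>x. flat_bump n s (s + h) x / ?J s
       - flat_bump n t (t + h) x / ?J t"
  have D: "(\<eta> has_real_derivative ?d x) (at x)" for x
    unfolding \<eta>_def[abs_def] by (intro DERIV_diff 1 2)
  have cont: "continuous_on UNIV \<eta>"
    using DERIV_isCont[OF D] by (simp add: continuous_on_eq_continuous_at)
  have "(\<lambda>x. (1 / ?J s) * flat_bump n s (s + h) x +
      (- 1 / ?J t) * flat_bump n t (t + h) x) \<in> flat_bumps"
    by (intro flat_bumps.add flat_bumps.scale flat_bump_in_flat_bumps)
  also have "(\<lambda>x. (1 / ?J s) * flat_bump n s (s + h) x +
      (- 1 / ?J t) * flat_bump n t (t + h) x) = ?d"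
    by simp
  finally have d: "?d \<in> flat_bumps" .
  have smooth: "(deriv ^^ m) \<eta> differentiable (at x)" for m x
  proof (rule iterated_deriv_differentiable[where S="insert \<eta> flat_bumps"])
    fix f assume "f \<in> insert \<eta> flat_bumps"
    then consider "f = \<eta>" | "f \<in> flat_bumps" by auto
    then show "\<exists>g\<in>insert \<eta> flat_bumps. \<forall>x. (f has_real_derivative g x) (at x)"
    proof cases
      case 1
      show ?thesis unfolding 1 by (rule bexI[of _ ?d]) (use D d in auto)
    next
      case 2
      then show ?thesis using flat_bumps_derivative by blast
    qed
  qed simp
  have "\<eta> x = 0" if "x \<notin> {s..t + h}" for x
    using that 1(2)[of x] 2(2)[of x] 1(3)[of x] 2(3)[of x] assms
    by (cases "x < s") (simp_all add: \<eta>_def)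
  then have supp: "{x. \<eta> x \<noteq> 0} \<subseteq> {s..t + h}" by blast
  then have cl: "closure {x. \<eta> x \<noteq> 0} \<subseteq> {s..t + h}" by (rule closure_minimal) simp
  show thesis
  proof
    have "compact (closure {x. \<eta> x \<noteq> 0})"
      using supp bounded_subset[OF bounded_closed_interval supp] by (simp add: compact_closure)
    moreover have "closure {x. \<eta> x \<noteq> 0} \<subseteq> {0<..<T}" using cl assms by fastforce
    ultimately show "\<eta> \<in> test_functions T"
      using smooth by (simp add: test_functions_def)
    show "deriv \<eta> = ?d" using D by (auto simp: fun_eq_iff intro: DERIV_imp_deriv)
    show "\<bar>\<eta> x - indicator {s..t} x\<bar> \<le> indicator {s..s + h} x + indicator {t..t + h} x" for x
    proof -
      consider "x < s" | "s \<le> x" "x \<le> s + h" | "s + h < x" "x < t" | "t \<le> x" "x \<le> t + h" | "t + h < x"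
        by linarith
      then show ?thesis
        using 1(2-5)[of x] 2(2-5)[of x] assms
        by cases (simp_all add: \<eta>_def indicator_def)
    qed
    show "\<eta> \<in> borel_measurable borel" by (rule borel_measurable_continuous_onI[OF cont])
  qed
qed

text \<open>In the limit \<open>n \<rightarrow> \<infinity>\<close> the bumps become indicators and the derivative of the trapezoid becomes
  a difference of averages of length \<open>h\<close>. The trapezoid differs from the indicator of the interval
  only on the two ramps, which accounts for the right-hand side.\<close>

lemma averages_of_distr_deriv:
  fixes f g :: "real \<Rightarrow> real"
  assumes D: "has_distr_deriv T (\<lambda>x. f x) g"
    and f: "integrable lborel (\<lambda>x. indicator {0<..<T} x * f x)"
    and g: "integrable lborel (\<lambda>x. indicator {0<..<T} x * g x)"
    and st: "0 < s" "0 < h" "s + h \<le> t" "t + h < T"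
  defines "f0 \<equiv> \<lambda>x. indicator {0<..<T} x * f x" and "g0 \<equiv> \<lambda>x. indicator {0<..<T} x * g x"
  shows "\<bar>(LINT x:{t..t + h}|lborel. f0 x) / h - (LINT x:{s..s + h}|lborel. f0 x) / h - (LINT x:{s..t}|lborel. g0 x)\<bar>
    \<le> (LINT x:{s..s + h}|lborel. \<bar>g0 x\<bar>) + (LINT x:{t..t + h}|lborel. \<bar>g0 x\<bar>)"
proof -
  define b1 b2 where "b1 n = flat_bump n s (s + h)" and "b2 n = flat_bump n t (t + h)" for n
  define J1 J2 where "J1 n = (LINT x|lborel. b1 n x)" and "J2 n = (LINT x|lborel. b2 n x)" for n
  define C where "C = (LINT x:{s..s + h}|lborel. \<bar>g0 x\<bar>) + (LINT x:{t..t + h}|lborel. \<bar>g0 x\<bar>)"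
  note f = f[folded f0_def] and g = g[folded g0_def]
  have [measurable]: "f0 \<in> borel_measurable borel" "g0 \<in> borel_measurable borel"
    using f g by auto
  have si: "set_integrable lborel {a..b} g0" "set_integrable lborel {a..b} (\<lambda>x. \<bar>g0 x\<bar>)" for a b :: real
    using g by (auto intro!: integrable_imp_set_integrable)
  have intb: "integrable lborel (\<lambda>x. f0 x * flat_bump n a b x)" for n a b
    by (rule Bochner_Integration.integrable_bound[OF f])
       (auto simp: abs_mult abs_of_nonneg flat_bump_nonneg intro!: mult_left_le flat_bump_le_1)
  let ?X = "\<lambda>n. (LINT x|lborel. f0 x * b2 n x) / J2 n - (LINT x|lborel. f0 x * b1 n x) / J1 n
       - (LINT x:{s..t}|lborel. g0 x)"
  have bound: "\<bar>?X n\<bar> \<le> C" for n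
  proof -
    obtain \<eta> where \<eta>: "\<eta> \<in> test_functions T"
      "deriv \<eta> = (\<lambda>x. b1 n x / J1 n - b2 n x / J2 n)"
      "\<And>x. \<bar>\<eta> x - indicator {s..t} x\<bar> \<le> indicator {s..s + h} x + indicator {t..t + h} x"
      and [measurable]: "\<eta> \<in> borel_measurable borel"
      by (rule smooth_trapezoid[OF st, of n, folded b1_def b2_def, folded J1_def J2_def]) (rule that)
    have "(LINT x:{0<..<T}|lborel. f x * deriv \<eta> x) = (LINT x|lborel. f0 x * b1 n x / J1 n - f0 x * b2 n x / J2 n)"
      unfolding set_lebesgue_integral_def \<eta>(2) f0_def
      by (intro Bochner_Integration.integral_cong) (auto simp: algebra_simps)
    also have "\<dots> = (LINT x|lborel. f0 x * b1 n x) / J1 n - (LINT x|lborel. f0 x * b2 n x) / J2 n"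
      unfolding b1_def b2_def using intb by simp
    finally have L: "(LINT x:{0<..<T}|lborel. f x * deriv \<eta> x)
       = (LINT x|lborel. f0 x * b1 n x) / J1 n - (LINT x|lborel. f0 x * b2 n x) / J2 n" .
    have R: "(LINT x:{0<..<T}|lborel. g x * \<eta> x) = (LINT x|lborel. g0 x * \<eta> x)"
      unfolding set_lebesgue_integral_def g0_def
      by (intro Bochner_Integration.integral_cong) (auto simp: algebra_simps)
    have "(LINT x:{0<..<T}|lborel. f x * deriv \<eta> x) = - (LINT x:{0<..<T}|lborel. g x * \<eta> x)"
      using D \<eta>(1) by (simp add: has_distr_deriv_def)
    with L R have eq: "?X n = (LINT x|lborel. g0 x * \<eta> x) - (LINT x:{s..t}|lborel. g0 x)" by simp
    have 1: "integrable lborel (\<lambda>x. indicator {s..t} x * g0 x)"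
      using si(1)[of s t] by (simp add: set_integrable_def)
    have dom: "\<bar>g0 x * (\<eta> x - indicator {s..t} x)\<bar> \<le> indicator {s..s + h} x * \<bar>g0 x\<bar> + indicator {t..t + h} x * \<bar>g0 x\<bar>" for x
      using mult_left_mono[OF \<eta>(3)[of x], of "\<bar>g0 x\<bar>"]
      unfolding abs_mult by (simp add: distrib_left mult.commute)
    have domint: "integrable lborel (\<lambda>x. indicator {s..s + h} x * \<bar>g0 x\<bar> + indicator {t..t + h} x * \<bar>g0 x\<bar>)"
      using si(2)[of s "s + h"] si(2)[of t "t + h"] by (simp add: set_integrable_def)
    have 2: "integrable lborel (\<lambda>x. g0 x * (\<eta> x - indicator {s..t} x))"
    proof (rule Bochner_Integration.integrable_bound[OF domint])
      show "AE x in lborel. norm (g0 x * (\<eta> x - indicator {s..t} x))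
        \<le> norm (indicator {s..s + h} x * \<bar>g0 x\<bar> + indicator {t..t + h} x * \<bar>g0 x\<bar>)"
        using dom by (intro AE_I2) (smt (verit) real_norm_def)
    qed measurable
    have "(LINT x|lborel. g0 x * \<eta> x)
        = (LINT x|lborel. g0 x * (\<eta> x - indicator {s..t} x) + indicator {s..t} x * g0 x)"
      by (intro Bochner_Integration.integral_cong) (auto simp: algebra_simps)
    also have "\<dots> = (LINT x|lborel. g0 x * (\<eta> x - indicator {s..t} x)) + (LINT x:{s..t}|lborel. g0 x)"
      using 1 2 by (simp add: set_lebesgue_integral_def)
    finally have "?X n = (LINT x|lborel. g0 x * (\<eta> x - indicator {s..t} x))"
      using eq by simp
    also have "\<bar>\<dots>\<bar> \<le> (LINT x|lborel. \<bar>g0 x * (\<eta> x - indicator {s..t} x)\<bar>)"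
      by (rule integral_abs_bound)
    also have "\<dots> \<le> (LINT x|lborel. indicator {s..s + h} x * \<bar>g0 x\<bar> + indicator {t..t + h} x * \<bar>g0 x\<bar>)"
      using 2 domint dom by (intro integral_mono) auto
    also have "\<dots> = C"
      using si(2)[of s "s + h"] si(2)[of t "t + h"] by (simp add: set_integrable_def set_lebesgue_integral_def C_def)
    finally show ?thesis .
  qed
  have "?X \<longlonglongrightarrow> (LINT x:{t..t + h}|lborel. f0 x) / (t + h - t) - (LINT x:{s..s + h}|lborel. f0 x) / (s + h - s)
      - (LINT x:{s..t}|lborel. g0 x)"
    unfolding b1_def b2_def J1_def J2_def
    by (intro tendsto_diff tendsto_divide tendsto_const flat_bump_integral_tendsto f flat_bump_mass_tendsto)
       (use st in auto)
  then have "(\<lambda>n. \<bar>?X n\<bar>) \<longlonglongrightarrow> \<bar>(LINT x:{t..t + h}|lborel. f0 x) / (t + h - t)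
      - (LINT x:{s..s + h}|lborel. f0 x) / (s + h - s) - (LINT x:{s..t}|lborel. g0 x)\<bar>"
    by (rule tendsto_rabs)
  from LIMSEQ_le_const2[OF this, of C] bound show ?thesis by (simp add: C_def)
qed

text \<open>The lemma of du Bois-Reymond in integrated form. At Lebesgue points \<open>s\<close> and \<open>t\<close> of \<open>f\<close>
  and of the absolute value of \<open>g\<close>, let \<open>h \<rightarrow> 0\<close> in \<open>averages_of_distr_deriv\<close>.\<close>

lemma distr_deriv_integral:
  fixes f g :: "real \<Rightarrow> real"
  assumes D: "has_distr_deriv T f g"
    and f: "set_integrable lborel {0<..<T} f" and g: "set_integrable lborel {0<..<T} g"
  shows "\<exists>N\<in>null_sets lborel. \<forall>s\<in>{0<..<T} - N. \<forall>t\<in>{0<..<T} - N. s < t \<longrightarrow>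
    f t - f s = (LINT x:{s..t}|lborel. g x)"
proof -
  define f0 g0 where "f0 = (\<lambda>x. indicator {0<..<T} x * f x)" and "g0 = (\<lambda>x. indicator {0<..<T} x * g x)"
  have f0: "integrable lborel f0" and g0: "integrable lborel g0"
    using f g by (simp_all add: set_integrable_def f0_def g0_def)
  have "AE t in lborel. ((\<lambda>h. (LINT y:{t..t+h}|lborel. f0 y) / h) \<longlongrightarrow> f0 t) (at_right 0) \<and>
     ((\<lambda>h. (LINT y:{t..t+h}|lborel. \<bar>g0 y\<bar>) / h) \<longlongrightarrow> \<bar>g0 t\<bar>) (at_right 0)"
    using right_averages_tendsto[OF f0] right_averages_tendsto[OF integrable_abs[OF g0]]
    by eventually_elim simp
  then obtain N where N: "N \<in> null_sets lborel" and
    avg: "\<And>t. t \<notin> N \<Longrightarrow> ((\<lambda>h. (LINT y:{t..t+h}|lborel. f0 y) / h) \<longlongrightarrow> f0 t) (at_right 0)"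
    and avg': "\<And>t. t \<notin> N \<Longrightarrow> ((\<lambda>h. (LINT y:{t..t+h}|lborel. \<bar>g0 y\<bar>) / h) \<longlongrightarrow> \<bar>g0 t\<bar>) (at_right 0)"
    by (elim AE_E3) (rule that, assumption, simp_all)
  have vanish: "((\<lambda>h. (LINT y:{t..t+h}|lborel. \<bar>g0 y\<bar>)) \<longlongrightarrow> 0) (at_right 0)" if "t \<notin> N" for t
  proof -
    have "((\<lambda>h. (LINT y:{t..t+h}|lborel. \<bar>g0 y\<bar>) / h * h) \<longlongrightarrow> \<bar>g0 t\<bar> * 0) (at_right 0)"
      by (intro tendsto_mult avg' that) (auto intro: tendsto_ident_at)
    then have "((\<lambda>h. (LINT y:{t..t+h}|lborel. \<bar>g0 y\<bar>) / h * h) \<longlongrightarrow> 0) (at_right 0)" by simp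
    then show ?thesis
      by (rule Lim_transform_eventually)
         (auto simp: eventually_at_right_field intro!: exI[of _ 1])
  qed
  show ?thesis
  proof (intro bexI[OF _ N] ballI impI)
    fix s t assume s: "s \<in> {0<..<T} - N" and t: "t \<in> {0<..<T} - N" and "s < t"
    let ?L = "\<lambda>h. \<bar>(LINT x:{t..t + h}|lborel. f0 x) / h - (LINT x:{s..s + h}|lborel. f0 x) / h - (LINT x:{s..t}|lborel. g0 x)\<bar>"
    have "\<bar>f0 t - f0 s - (LINT x:{s..t}|lborel. g0 x)\<bar> \<le> 0 + 0"
    proof (rule tendsto_le)
      show "((\<lambda>h. (LINT x:{s..s + h}|lborel. \<bar>g0 x\<bar>) + (LINT x:{t..t + h}|lborel. \<bar>g0 x\<bar>)) \<longlongrightarrow> 0 + 0) (at_right 0)"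
        using s t by (intro tendsto_add vanish) auto
      show "(?L \<longlongrightarrow> \<bar>f0 t - f0 s - (LINT x:{s..t}|lborel. g0 x)\<bar>) (at_right 0)"
        using s t by (intro tendsto_rabs tendsto_diff avg tendsto_const) auto
      show "\<forall>\<^sub>F h in at_right 0. ?L h \<le> (LINT x:{s..s + h}|lborel. \<bar>g0 x\<bar>) + (LINT x:{t..t + h}|lborel. \<bar>g0 x\<bar>)"
      proof (rule eventually_at_rightI[of 0 "min (t - s) (T - t)"])
        fix h assume "h \<in> {0<..<min (t - s) (T - t)}"
        then show "?L h \<le> (LINT x:{s..s + h}|lborel. \<bar>g0 x\<bar>) + (LINT x:{t..t + h}|lborel. \<bar>g0 x\<bar>)"
          using averages_of_distr_deriv[OF D, of s h t] f0 g0 s by (auto simp: f0_def g0_def)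
      qed (use \<open>s < t\<close> t in auto)
    qed simp
    then have "f0 t - f0 s = (LINT x:{s..t}|lborel. g0 x)" by simp
    moreover have "f0 t = f t" "f0 s = f s" using s t by (auto simp: f0_def)
    moreover have "(LINT x:{s..t}|lborel. g0 x) = (LINT x:{s..t}|lborel. g x)"
      using s t by (intro set_lebesgue_integral_cong) (auto simp: g0_def)
    ultimately show "f t - f s = (LINT x:{s..t}|lborel. g x)" by simp
  qed
qed

text \<open>A distributional derivative is only known to be integrable on compact subsets of the interval;
  a dominating function makes it integrable up to the endpoints.\<close>

lemma set_integrable_interval_dominated:
  fixes f :: "real \<Rightarrow> real"
  assumes loc: "\<And>K. compact K \<Longrightarrow> K \<subseteq> {0<..<T} \<Longrightarrow> set_integrable lborel K f"
    and w: "set_integrable lborel {0<..<T} w"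
    and dom: "AE t in lborel. t \<in> {0<..<T} \<longrightarrow> \<bar>f t\<bar> \<le> w t"
  shows "set_integrable lborel {0<..<T} f"
proof -
  define K where "K n = {1 / real (Suc n)..T - 1 / real (Suc n)}" for n
  have "set_integrable lborel (K n) f" for n
  proof (rule loc)
    show "K n \<subseteq> {0<..<T}"
    proof
      fix x assume "x \<in> K n"
      moreover have "0 < 1 / real (Suc n)" by simp
      ultimately show "x \<in> {0<..<T}"
        unfolding K_def atLeastAtMost_iff greaterThanLessThan_iff by linarith
    qed
  qed (simp add: K_def)
  then have meas: "(\<lambda>x. indicator (K n) x * f x) \<in> borel_measurable lborel" for n
    by (auto simp: set_integrable_def)
  have lim: "(\<lambda>n. indicator (K n) x * f x) \<longlonglongrightarrow> indicator {0<..<T} x * f x" for x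
  proof (cases "x \<in> {0<..<T}")
    case True
    have "(\<lambda>n. 1 / real (Suc n)) \<longlonglongrightarrow> 0"
      using LIMSEQ_inverse_real_of_nat by (simp add: inverse_eq_divide)
    then have "\<forall>\<^sub>F n in sequentially. 1 / real (Suc n) < min x (T - x)"
      using True by (intro order_tendstoD) auto
    then have "\<forall>\<^sub>F n in sequentially. indicator (K n) x * f x = indicator {0<..<T} x * f x"
      by eventually_elim (use True in \<open>auto simp: K_def indicator_def\<close>)
    then show ?thesis by (rule tendsto_eventually)
  next
    case False
    have "x \<notin> K n" for n
    proof -
      have "0 < 1 / real (Suc n)" by simp
      then show ?thesis
        using False unfolding K_def atLeastAtMost_iff greaterThanLessThan_iff by linarith
    qed
    with False show ?thesis by simp
  qed
  have [measurable]: "(\<lambda>x. indicator {0<..<T} x * f x) \<in> borel_measurable lborel"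
    by (rule borel_measurable_LIMSEQ_real[OF lim meas])
  show ?thesis
    unfolding set_integrable_def
  proof (rule Bochner_Integration.integrable_bound[OF w[unfolded set_integrable_def]])
    show "AE x in lborel. norm (indicator {0<..<T} x *\<^sub>R f x) \<le> norm (indicator {0<..<T} x *\<^sub>R w x)"
      using dom by eventually_elim (auto simp: indicator_def)
  qed simp
qed

section \<open>Continuously differentiable test functions\<close>

text \<open>The square of the positive part, a convenient building block of class \<open>C\<^sup>1\<close>.\<close>

definition pos_sq :: "real \<Rightarrow> real" where
  "pos_sq u = (max 0 u)\<^sup>2"

lemma pos_sq_has_derivative: "(pos_sq has_real_derivative 2 * max 0 u) (at u)"
proof -
  consider "u > 0" | "u = 0" | "u < 0" by linarith
  then show ?thesis
  proof cases
    case 1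
    have "((\<lambda>u. u\<^sup>2) has_real_derivative 2 * max 0 u) (at u)"
      using 1 by (auto intro!: derivative_eq_intros)
    then show ?thesis
      by (rule has_field_derivative_transform_within_open[where S="{0<..}"])
         (use 1 in \<open>auto simp: pos_sq_def\<close>)
  next
    case 2
    have "((\<lambda>h::real. max 0 h) \<longlongrightarrow> max 0 0) (at 0)"
      by (intro tendsto_intros)
    then have "((\<lambda>h. (pos_sq (u + h) - pos_sq u) / h) \<longlongrightarrow> max 0 0) (at 0)"
      by (rule Lim_transform_eventually)
         (auto simp: 2 pos_sq_def eventually_at_filter power2_eq_square max_def intro!: always_eventually)
    then show ?thesis by (simp add: DERIV_def 2)
  next
    case 3
    have "((\<lambda>u. 0) has_real_derivative 2 * max 0 u) (at u)"
      using 3 by auto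
    then show ?thesis
      by (rule has_field_derivative_transform_within_open[where S="{..<0}"])
         (use 3 in \<open>auto simp: pos_sq_def\<close>)
  qed
qed

lemma pos_sq_simps [simp]: "u \<le> 0 \<Longrightarrow> pos_sq u = 0" "pos_sq 1 = 1" "0 \<le> pos_sq u"
  by (auto simp: pos_sq_def max_def)

lemma pos_sq_ge_1: "1 \<le> u \<Longrightarrow> 1 \<le> pos_sq u"
  by (simp add: pos_sq_def max_def)

lemma pos_sq_le_1: "u \<le> 1 \<Longrightarrow> pos_sq u \<le> 1"
  by (simp add: pos_sq_def max_def power_le_one)

lemma continuous_on_pos_sq [continuous_intros]:
  "continuous_on A f \<Longrightarrow> continuous_on A (\<lambda>x. pos_sq (f x))"
  unfolding pos_sq_def by (intro continuous_intros)

definition C1_grad :: "('a::euclidean_space \<Rightarrow> real) \<Rightarrow> ('a \<Rightarrow> 'a) \<Rightarrow> bool" where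
  "C1_grad f D \<longleftrightarrow> continuous_on UNIV D \<and> (\<forall>x. GDERIV f x :> D x)"

lemma C1_grad_continuous: "C1_grad f D \<Longrightarrow> continuous_on UNIV f"
  unfolding C1_grad_def gderiv_def
  by (meson continuous_at_imp_continuous_on has_derivative_continuous)

lemma C1_grad_sum:
  assumes "finite S" "\<And>p. p \<in> S \<Longrightarrow> C1_grad (f p) (D p)"
  shows "C1_grad (\<lambda>x. \<Sum>p\<in>S. f p x) (\<lambda>x. \<Sum>p\<in>S. D p x)"
  unfolding C1_grad_def gderiv_def inner_sum_right
  using assms by (auto simp: C1_grad_def gderiv_def intro!: continuous_on_sum has_derivative_sum)

lemma C1_grad_compose:
  assumes "C1_grad f D" "\<And>u. (k has_real_derivative k' u) (at u)" "continuous_on UNIV k'"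
  shows "C1_grad (\<lambda>x. k (f x)) (\<lambda>x. k' (f x) *\<^sub>R D x)"
  unfolding C1_grad_def
proof (intro conjI allI)
  show "continuous_on UNIV (\<lambda>x. k' (f x) *\<^sub>R D x)"
    using assms(1) C1_grad_continuous[OF assms(1)]
    by (auto simp: C1_grad_def intro!: continuous_intros continuous_on_compose2[OF assms(3)])
  show "GDERIV (\<lambda>x. k (f x)) x :> k' (f x) *\<^sub>R D x" for x
    using assms(1,2) by (intro GDERIV_DERIV_compose) (auto simp: C1_grad_def)
qed

lemma C1_grad_mult:
  assumes "C1_grad f D" "C1_grad g E"
  shows "C1_grad (\<lambda>x. f x * g x) (\<lambda>x. f x *\<^sub>R E x + g x *\<^sub>R D x)"
  unfolding C1_grad_def
proof (intro conjI allI)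
  show "continuous_on UNIV (\<lambda>x. f x *\<^sub>R E x + g x *\<^sub>R D x)"
    using assms C1_grad_continuous[OF assms(1)] C1_grad_continuous[OF assms(2)]
    by (auto simp: C1_grad_def intro!: continuous_intros)
  show "GDERIV (\<lambda>x. f x * g x) x :> f x *\<^sub>R E x + g x *\<^sub>R D x" for x
    using assms by (intro GDERIV_mult) (auto simp: C1_grad_def)
qed

lemma C1_grad_inner_left: "C1_grad (\<lambda>x. x \<bullet> e) (\<lambda>x. e)"
  by (auto simp: C1_grad_def gderiv_def intro!: derivative_eq_intros)

lemma C1_grad_norm_sq: "C1_grad (\<lambda>x. (x - p) \<bullet> (x - p)) (\<lambda>x. 2 *\<^sub>R (x - p))"
  by (auto simp: C1_grad_def gderiv_def inner_commute algebra_simps intro!: continuous_intros derivative_eq_intros)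

text \<open>\<open>D\<close> is the gradient of the compactly supported function \<open>f\<close>, and \<open>L\<close> a Lipschitz constant.\<close>

definition test_fun :: "('a::euclidean_space \<Rightarrow> real) \<Rightarrow> ('a \<Rightarrow> 'a) \<Rightarrow> real \<Rightarrow> bool" where
  "test_fun f D L \<longleftrightarrow> C1_grad f D \<and> (\<forall>x. norm (D x) \<le> L) \<and> (\<exists>B. \<forall>x. B < norm x \<longrightarrow> f x = 0)"

lemma test_fun_bounded:
  assumes "test_fun f D L"
  shows "\<exists>M. \<forall>x. \<bar>f x\<bar> \<le> M"
proof -
  obtain B where B: "\<And>x. B < norm x \<Longrightarrow> f x = 0" using assms by (auto simp: test_fun_def)
  have "continuous_on UNIV f" using assms C1_grad_continuous by (auto simp: test_fun_def)
  then have "compact (f ` cball 0 B)"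
    by (intro compact_continuous_image) (auto intro: continuous_on_subset)
  then have "bounded (f ` cball 0 B)" by (rule compact_imp_bounded)
  then obtain M where M: "\<And>y. y \<in> f ` cball 0 B \<Longrightarrow> \<bar>y\<bar> \<le> M"
    by (auto simp: bounded_iff)
  have "\<bar>f x\<bar> \<le> max M 0" for x
    using M[of "f x"] B[of x] by (cases "B < norm x") (auto simp: max_def not_less)
  then show ?thesis by blast
qed

text \<open>Equal to \<open>1\<close> for \<open>u \<le> 0\<close> and to \<open>0\<close> for \<open>u \<ge> 1\<close>.\<close>

definition plateau :: "real \<Rightarrow> real" where
  "plateau u = pos_sq (1 - pos_sq u)"

definition plateau' :: "real \<Rightarrow> real" where
  "plateau' u = - 4 * max 0 (1 - pos_sq u) * max 0 u"

lemma plateau_has_derivative: "(plateau has_real_derivative plateau' u) (at u)"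
  unfolding plateau_def[abs_def] plateau'_def
  by (rule DERIV_cong[OF DERIV_chain2[OF pos_sq_has_derivative
      DERIV_diff[OF DERIV_const pos_sq_has_derivative]]]) simp

lemma continuous_on_plateau': "continuous_on UNIV plateau'"
  unfolding plateau'_def[abs_def] by (intro continuous_intros)

lemma plateau_bounds: "0 \<le> plateau u" "plateau u \<le> 1"
  by (auto simp: plateau_def intro!: pos_sq_le_1)

lemma plateau_values: "u \<le> 0 \<Longrightarrow> plateau u = 1" "1 \<le> u \<Longrightarrow> plateau u = 0" "1 \<le> u \<Longrightarrow> plateau' u = 0"
  using pos_sq_ge_1[of u] by (auto simp: plateau_def plateau'_def max_def)

lemma plateau'_bound: "\<bar>plateau' u\<bar> \<le> 4"
proof (cases "1 \<le> u")
  case False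
  have "max 0 (1 - pos_sq u) * max 0 u \<le> 1 * 1"
    using False by (intro mult_mono) auto
  then show ?thesis by (simp add: plateau'_def abs_mult)
qed (simp add: plateau_values)

text \<open>Equal to \<open>1\<close> on the ball of radius \<open>R\<close> about \<open>p\<close> and to \<open>0\<close> outside that of radius \<open>2 * R\<close>.\<close>

definition bump :: "'a::euclidean_space \<Rightarrow> real \<Rightarrow> 'a \<Rightarrow> real" where
  "bump p R x = plateau ((x - p) \<bullet> (x - p) / R\<^sup>2 - 1)"

definition bump_grad :: "'a::euclidean_space \<Rightarrow> real \<Rightarrow> 'a \<Rightarrow> 'a" where
  "bump_grad p R x = (plateau' ((x - p) \<bullet> (x - p) / R\<^sup>2 - 1) * (1 / R\<^sup>2)) *\<^sub>R (2 *\<^sub>R (x - p))"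

lemma C1_grad_bump:
  assumes "R > 0"
  shows "C1_grad (bump p R) (bump_grad p R)"
proof -
  have "C1_grad (\<lambda>x. (\<lambda>u. plateau (u / R\<^sup>2 - 1)) ((x - p) \<bullet> (x - p)))
     (\<lambda>x. (\<lambda>u. plateau' (u / R\<^sup>2 - 1) * (1 / R\<^sup>2)) ((x - p) \<bullet> (x - p)) *\<^sub>R (2 *\<^sub>R (x - p)))"
  proof (rule C1_grad_compose[OF C1_grad_norm_sq])
    show "((\<lambda>u. plateau (u / R\<^sup>2 - 1)) has_real_derivative plateau' (u / R\<^sup>2 - 1) * (1 / R\<^sup>2)) (at u)" for u
      by (rule DERIV_cong[OF DERIV_chain2[OF plateau_has_derivative
          DERIV_diff[OF DERIV_cdivide[OF DERIV_ident] DERIV_const]]]) simp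
    show "continuous_on UNIV (\<lambda>u. plateau' (u / R\<^sup>2 - 1) * (1 / R\<^sup>2))"
      by (intro continuous_intros continuous_on_compose2[OF continuous_on_plateau'])
         (use assms in auto)
  qed
  then show ?thesis
    unfolding bump_def[abs_def] bump_grad_def[abs_def] .
qed

lemma bump_bounds: "0 \<le> bump p R x" "bump p R x \<le> 1"
  by (auto simp: bump_def plateau_bounds)

lemma bump_eq_1:
  assumes "R > 0" "dist x p \<le> R"
  shows "bump p R x = 1"
proof -
  have "(dist x p)\<^sup>2 \<le> R\<^sup>2" using assms by (intro power_mono) auto
  then show ?thesis using assms
    by (auto simp: bump_def dist_norm power2_norm_eq_inner intro!: plateau_values)
qed

lemma
  assumes "R > 0" "2 * R \<le> dist x p"
  shows bump_eq_0: "bump p R x = 0" and bump_grad_eq_0: "bump_grad p R x = 0"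
proof -
  have "(2 * R)\<^sup>2 \<le> (dist x p)\<^sup>2" using assms by (intro power_mono) auto
  then have "4 * R\<^sup>2 \<le> (x - p) \<bullet> (x - p)" by (simp add: dist_norm power2_norm_eq_inner)
  then have "2 * R\<^sup>2 \<le> (x - p) \<bullet> (x - p)" using zero_le_power2[of R] by linarith
  then have *: "1 \<le> (x - p) \<bullet> (x - p) / R\<^sup>2 - 1" using assms
    by (simp add: field_simps)
  show "bump p R x = 0" "bump_grad p R x = 0"
    unfolding bump_def bump_grad_def plateau_values(2,3)[OF *] by simp_all
qed

lemma bump_grad_bound:
  assumes "R > 0"
  shows "norm (bump_grad p R x) \<le> 16 / R"
proof (cases "2 * R \<le> dist x p")
  case True
  then show ?thesis using assms by (simp add: bump_grad_eq_0)
next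
  case False
  have "norm (bump_grad p R x) = \<bar>plateau' ((x - p) \<bullet> (x - p) / R\<^sup>2 - 1)\<bar> * (2 / R\<^sup>2 * norm (x - p))"
    by (simp add: bump_grad_def abs_mult)
  also have "\<dots> \<le> 4 * (2 / R\<^sup>2 * (2 * R))"
    using False assms by (intro mult_mono plateau'_bound) (auto simp: dist_norm)
  also have "\<dots> = 16 / R" using assms by (simp add: power2_eq_square)
  finally show ?thesis .
qed

text \<open>A \<open>C\<^sup>1\<close> substitute for the indicator of the \<open>R\<close>-neighbourhood of \<open>S\<close>: it is \<open>1\<close> where some
  bump is \<open>1\<close> and \<open>0\<close> where all of them vanish.\<close>

definition cluster :: "'a::euclidean_space set \<Rightarrow> real \<Rightarrow> 'a \<Rightarrow> real" where
  "cluster S R x = 1 - pos_sq (1 - (\<Sum>p\<in>S. bump p R x))"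

definition cluster_grad :: "'a::euclidean_space set \<Rightarrow> real \<Rightarrow> 'a \<Rightarrow> 'a" where
  "cluster_grad S R x = (2 * max 0 (1 - (\<Sum>p\<in>S. bump p R x))) *\<^sub>R (\<Sum>p\<in>S. bump_grad p R x)"

lemma cluster_bounds: "0 \<le> cluster S R x" "cluster S R x \<le> 1"
  by (auto simp: cluster_def intro!: pos_sq_le_1 sum_nonneg bump_bounds)

lemma cluster_eq_1:
  assumes "finite S" "p \<in> S" "R > 0" "dist x p \<le> R"
  shows "cluster S R x = 1"
proof -
  have "bump p R x \<le> (\<Sum>p\<in>S. bump p R x)"
    using assms by (intro member_le_sum bump_bounds) auto
  then show ?thesis using assms by (simp add: cluster_def bump_eq_1)
qed

lemma cluster_eq_0:
  assumes "R > 0" "\<And>p. p \<in> S \<Longrightarrow> 2 * R \<le> dist x p"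
  shows "cluster S R x = 0"
  using assms by (simp add: cluster_def bump_eq_0)

text \<open>The gradient is at most \<open>2\<close> times a sum of \<open>card S\<close> gradients of size at most \<open>16 / R\<close>.\<close>

lemma test_fun_cluster:
  fixes S :: "'a::euclidean_space set"
  assumes S: "finite S" and R: "R > 0"
  shows "test_fun (cluster S R) (cluster_grad S R) (32 * card S / R)"
  unfolding test_fun_def
proof (intro conjI allI)
  have "C1_grad (\<lambda>x. (\<lambda>u. 1 - pos_sq (1 - u)) (\<Sum>p\<in>S. bump p R x))
     (\<lambda>x. (\<lambda>u. 2 * max 0 (1 - u)) (\<Sum>p\<in>S. bump p R x) *\<^sub>R (\<Sum>p\<in>S. bump_grad p R x))"
  proof (rule C1_grad_compose[where k="\<lambda>u. 1 - pos_sq (1 - u)" and k'="\<lambda>u. 2 * max 0 (1 - u)"])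
    show "C1_grad (\<lambda>x. \<Sum>p\<in>S. bump p R x) (\<lambda>x. \<Sum>p\<in>S. bump_grad p R x)"
      by (intro C1_grad_sum C1_grad_bump S R)
    show "((\<lambda>u. 1 - pos_sq (1 - u)) has_real_derivative 2 * max 0 (1 - u)) (at u)" for u
      by (rule DERIV_cong[OF DERIV_diff[OF DERIV_const DERIV_chain2[OF pos_sq_has_derivative
          DERIV_diff[OF DERIV_const DERIV_ident]]]]) simp
  qed (intro continuous_intros)
  then show "C1_grad (cluster S R) (cluster_grad S R)"
    by (simp add: cluster_def[abs_def] cluster_grad_def[abs_def])
  show "norm (cluster_grad S R x) \<le> 32 * card S / R" for x
  proof -
    have "norm (\<Sum>p\<in>S. bump_grad p R x) \<le> (\<Sum>p\<in>S. 16 / R)"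
      using R by (intro sum_norm_le bump_grad_bound)
    moreover have "0 \<le> (\<Sum>p\<in>S. bump p R x)" by (intro sum_nonneg bump_bounds)
    ultimately have "2 * max 0 (1 - (\<Sum>p\<in>S. bump p R x)) * norm (\<Sum>p\<in>S. bump_grad p R x) \<le> 2 * (\<Sum>p\<in>S. 16 / R)"
      by (intro mult_mono) auto
    then show ?thesis by (simp add: cluster_grad_def abs_mult)
  qed
  obtain B where B: "\<And>p. p \<in> S \<Longrightarrow> norm p \<le> B"
    using finite_imp_bounded[OF S] by (auto simp: bounded_iff)
  show "\<exists>B. \<forall>x. B < norm x \<longrightarrow> cluster S R x = 0"
  proof (intro exI allI impI cluster_eq_0 R)
    fix x p :: 'a assume "B + 2 * R < norm x" "p \<in> S"
    then show "2 * R \<le> dist x p" using B[of p] norm_triangle_ineq2[of x p] by (simp add: dist_norm)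
  qed
qed

text \<open>A coordinate function cut off near \<open>p\<close>; it reads off one component of the velocity of a
  particle that is near \<open>p\<close>.\<close>

definition coord_bump :: "'a::euclidean_space \<Rightarrow> 'a \<Rightarrow> real \<Rightarrow> 'a \<Rightarrow> real" where
  "coord_bump e p R x = (x \<bullet> e) * bump p R x"

definition coord_bump_grad :: "'a::euclidean_space \<Rightarrow> 'a \<Rightarrow> real \<Rightarrow> 'a \<Rightarrow> 'a" where
  "coord_bump_grad e p R x = (x \<bullet> e) *\<^sub>R bump_grad p R x + bump p R x *\<^sub>R e"

lemma coord_bump_eq_0:
  assumes "R > 0" "2 * R \<le> dist x p"
  shows "coord_bump e p R x = 0" "coord_bump_grad e p R x = 0"
  using assms by (simp_all add: coord_bump_def coord_bump_grad_def bump_eq_0 bump_grad_eq_0)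

lemma bump_grad_eq_0_inside:
  assumes "R > 0" "dist x p \<le> R"
  shows "bump_grad p R x = 0"
proof -
  have "(dist x p)\<^sup>2 \<le> R\<^sup>2" using assms by (intro power_mono) auto
  then show ?thesis using assms
    by (simp add: bump_grad_def plateau'_def dist_norm power2_norm_eq_inner max_def)
qed

lemma coord_bump_inside:
  assumes "R > 0" "dist x p \<le> R"
  shows "coord_bump e p R x = x \<bullet> e" "coord_bump_grad e p R x = e"
  using assms by (simp_all add: coord_bump_def coord_bump_grad_def bump_eq_1 bump_grad_eq_0_inside)

lemma test_fun_coord_bump:
  fixes p :: "'a::euclidean_space"
  assumes R: "R > 0"
  shows "\<exists>L. test_fun (coord_bump e p R) (coord_bump_grad e p R) L"
proof
  show "test_fun (coord_bump e p R) (coord_bump_grad e p R)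
    ((norm p + 2 * R) * norm e * (16 / R) + norm e)"
    unfolding test_fun_def
  proof (intro conjI allI)
    show "C1_grad (coord_bump e p R) (coord_bump_grad e p R)"
      unfolding coord_bump_def[abs_def] coord_bump_grad_def[abs_def]
      by (intro C1_grad_mult C1_grad_bump C1_grad_inner_left R)
    show "norm (coord_bump_grad e p R x) \<le> (norm p + 2 * R) * norm e * (16 / R) + norm e" for x
    proof (cases "2 * R \<le> dist x p")
      case False
      then have "norm x \<le> norm p + 2 * R" using norm_triangle_ineq2[of x p] by (simp add: dist_norm)
      then have "\<bar>x \<bullet> e\<bar> \<le> (norm p + 2 * R) * norm e"
        using Cauchy_Schwarz_ineq2[of x e] mult_right_mono[of "norm x" "norm p + 2 * R" "norm e"] by simp
      then have "norm ((x \<bullet> e) *\<^sub>R bump_grad p R x) \<le> (norm p + 2 * R) * norm e * (16 / R)"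
        unfolding norm_scaleR using R by (intro mult_mono bump_grad_bound) auto
      moreover have "norm (bump p R x *\<^sub>R e) \<le> norm e"
        using bump_bounds[of p R x] by (simp add: mult_left_le_one_le)
      ultimately show ?thesis
        unfolding coord_bump_grad_def by (intro norm_triangle_le) linarith
    qed (use R in \<open>simp add: coord_bump_eq_0\<close>)
    show "\<exists>B. \<forall>x. B < norm x \<longrightarrow> coord_bump e p R x = 0"
    proof (intro exI allI impI coord_bump_eq_0 R)
      fix x :: 'a assume "norm p + 2 * R < norm x"
      then show "2 * R \<le> dist x p" using norm_triangle_ineq2[of x p] by (simp add: dist_norm)
    qed
  qed
qed

text \<open>Masses are at most \<open>1\<close>, and \<open>C1c (UNIV \<times> {0<..1})\<close> asks for functions that vanish above
  \<open>1\<close>. Differentiability at mass \<open>1\<close> is relative to masses at most \<open>1\<close>, so the jump is harmless.\<close>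

definition mass_product :: "('a::euclidean_space \<Rightarrow> real) \<Rightarrow> (real \<Rightarrow> real) \<Rightarrow> 'a \<times> real \<Rightarrow> real" where
  "mass_product f \<zeta> = (\<lambda>(x, m). if m \<le> 1 then f x * \<zeta> m else 0)"

lemma mass_product_in_C1c:
  assumes f: "test_fun f D L" and \<zeta>: "C1_grad \<zeta> \<zeta>'" and \<delta>: "0 < \<delta>" "\<And>m. m < \<delta> \<Longrightarrow> \<zeta> m = 0"
  shows "mass_product f \<zeta> \<in> C1c (UNIV \<times> {0<..1})"
proof -
  let ?E = "\<lambda>p. (\<zeta> (snd p) *\<^sub>R D (fst p), f (fst p) * \<zeta>' (snd p))"
  have fD: "C1_grad f D" using f by (simp add: test_fun_def)
  obtain B where B: "\<And>x. B < norm x \<Longrightarrow> f x = 0" using f by (auto simp: test_fun_def)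
  have cont: "continuous_on UNIV ?E"
    using fD \<zeta> C1_grad_continuous[OF fD] C1_grad_continuous[OF \<zeta>]
    by (auto simp: C1_grad_def intro!: continuous_intros
        intro: continuous_on_compose2[where f=fst] continuous_on_compose2[where f=snd])
  have "((\<lambda>p. f (fst p) * \<zeta> (snd p)) has_derivative (\<lambda>h. h \<bullet> ?E p)) (at p)" for p
  proof -
    have 1: "((\<lambda>p. f (fst p)) has_derivative (\<lambda>h. fst h \<bullet> D (fst p))) (at p)"
      using has_derivative_compose[of fst fst p UNIV f] fD by (auto simp: C1_grad_def gderiv_def has_derivative_fst)
    have 2: "((\<lambda>p. \<zeta> (snd p)) has_derivative (\<lambda>h. snd h * \<zeta>' (snd p))) (at p)"
    proof -
      have "(\<zeta> has_derivative (\<lambda>h. h \<bullet> \<zeta>' (snd p))) (at (snd p))"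
        using \<zeta> unfolding C1_grad_def gderiv_def by blast
      from has_derivative_compose[OF bounded_linear_imp_has_derivative[OF bounded_linear_snd] this]
      show ?thesis by simp
    qed
    show ?thesis
      by (rule has_derivative_eq_rhs[OF has_derivative_mult[OF 1 2]])
         (auto simp: inner_prod_def algebra_simps)
  qed
  then have "(mass_product f \<zeta> has_derivative (\<lambda>h. h \<bullet> ?E p)) (at p within UNIV \<times> {0<..1})"
    if "p \<in> UNIV \<times> {0<..1}" for p
    by (rule has_derivative_transform[OF that, rotated, OF has_derivative_at_withinI])
       (auto simp: mass_product_def)
  then have "C1_on (UNIV \<times> {0<..1}) (mass_product f \<zeta>)"
    unfolding C1_on_def using continuous_on_subset[OF cont] by blast
  moreover have supp: "{p. mass_product f \<zeta> p \<noteq> 0} \<subseteq> cball 0 B \<times> {\<delta>..1}"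
    using B \<delta> by (force simp: mass_product_def not_less split: if_splits)
  then have "closure {p. mass_product f \<zeta> p \<noteq> 0} \<subseteq> cball 0 B \<times> {\<delta>..1}"
    by (intro closure_minimal closed_Times) auto
  moreover have "bounded {p. mass_product f \<zeta> p \<noteq> 0}"
    by (rule bounded_subset[OF _ supp]) (intro bounded_Times bounded_cball bounded_closed_interval)
  ultimately show ?thesis
    using \<delta>(1) by (force simp: C1c_def compact_closure)
qed

section \<open>Narrow topology and measurable kernels\<close>

text \<open>The usual bounded continuous functions that decrease to the indicator of a closed set.\<close>

definition closed_approx :: "'a::metric_space set \<Rightarrow> nat \<Rightarrow> 'a \<Rightarrow>\<^sub>C real" where
  "closed_approx C n = Bcontfun (\<lambda>x. max 0 (1 - real n * infdist x C))"

lemma apply_closed_approx: "apply_bcontfun (closed_approx C n) x = max 0 (1 - real n * infdist x C)"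
proof -
  have "(\<lambda>x. max 0 (1 - real n * infdist x C)) \<in> bcontfun"
    by (intro bcontfun_normI[where b=1] continuous_intros) (auto simp: infdist_nonneg)
  then show ?thesis by (simp add: closed_approx_def Bcontfun_inverse)
qed

lemma closed_approx_integral_tendsto:
  fixes C :: "'a::metric_space set"
  assumes M: "M \<in> space (prob_algebra borel)" and C: "closed C" "C \<noteq> {}"
  shows "(\<lambda>n. \<integral>x. apply_bcontfun (closed_approx C n) x \<partial>M) \<longlonglongrightarrow> measure M C"
proof -
  interpret prob_space M using M by (simp add: space_prob_algebra)
  have sets: "sets M = sets borel" using M by (simp add: space_prob_algebra)
  have lim: "(\<lambda>n. apply_bcontfun (closed_approx C n) x) \<longlonglongrightarrow> indicator C x" for x
  proof (cases "x \<in> C")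
    case True
    then show ?thesis by (simp add: apply_closed_approx)
  next
    case False
    then have pos: "infdist x C > 0"
      using C in_closed_iff_infdist_zero infdist_nonneg[of x C] by (metis less_eq_real_def)
    then obtain N where N: "1 / infdist x C < real N" using reals_Archimedean2 by blast
    have "\<forall>\<^sub>F n in sequentially. apply_bcontfun (closed_approx C n) x = indicator C x"
      using eventually_ge_at_top[of N]
    proof eventually_elim
      case (elim n)
      then have "1 / infdist x C < real n" using N by linarith
      then have "1 < real n * infdist x C" using pos by (simp add: field_simps)
      then show ?case using False by (simp add: apply_closed_approx)
    qed
    then show ?thesis by (rule tendsto_eventually)
  qed
  have "(\<lambda>n. \<integral>x. apply_bcontfun (closed_approx C n) x \<partial>M) \<longlonglongrightarrow> (\<integral>x. indicator C x \<partial>M)"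
  proof (rule integral_dominated_convergence[where w="\<lambda>_. 1"])
    show "AE x in M. norm (apply_bcontfun (closed_approx C n) x) \<le> 1" for n
      by (auto simp: apply_closed_approx infdist_nonneg)
    show "apply_bcontfun (closed_approx C n) \<in> borel_measurable M" for n
      unfolding measurable_cong_sets[OF sets refl]
      by (rule borel_measurable_continuous_onI) (auto intro: continuous_on_apply_bcontfun)
    show "(\<lambda>x. indicator C x :: real) \<in> borel_measurable M"
      unfolding measurable_cong_sets[OF sets refl]
      by (intro borel_measurable_indicator borel_closed C)
  qed (use lim in auto)
  then show ?thesis using C sets by (simp add: emeasure_eq_measure)
qed

lemma measure_eqI_bcontfun:
  fixes M N :: "'a::metric_space measure"
  assumes M: "M \<in> space (prob_algebra borel)" and N: "N \<in> space (prob_algebra borel)"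
    and eq: "\<And>\<phi> :: 'a \<Rightarrow>\<^sub>C real. (\<integral>x. apply_bcontfun \<phi> x \<partial>M) = (\<integral>x. apply_bcontfun \<phi> x \<partial>N)"
  shows "M = N"
proof (rule measure_eqI_generator_eq[where E="Collect closed" and A="\<lambda>_. UNIV" and \<Omega>=UNIV])
  interpret M: prob_space M using M by (simp add: space_prob_algebra)
  interpret N: prob_space N using N by (simp add: space_prob_algebra)
  show "emeasure M C = emeasure N C" if "C \<in> Collect closed" for C
  proof (cases "C = {}")
    case False
    have "measure M C = measure N C"
      using closed_approx_integral_tendsto[OF M _ False] closed_approx_integral_tendsto[OF N _ False] that
      unfolding eq by (auto intro: LIMSEQ_unique)
    then show ?thesis by (simp add: M.emeasure_eq_measure N.emeasure_eq_measure)
  qed simp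
  show "sets M = sigma_sets UNIV (Collect closed)" "sets N = sigma_sets UNIV (Collect closed)"
    using M N by (auto simp: space_prob_algebra borel_eq_closed)
  show "emeasure M UNIV \<noteq> \<infinity>" by simp
qed (auto simp: Int_stable_def)

text \<open>The mass of a closed set is a limit of integrals of bounded continuous functions, which are
  continuous in time; closed sets generate the Borel sets.\<close>

lemma narrow_continuous_measurable:
  fixes \<mu> :: "real \<Rightarrow> 'a::metric_space measure"
  assumes "continuous_map (top_of_set A) narrow_topology \<mu>"
  shows "\<mu> \<in> restrict_space borel A \<rightarrow>\<^sub>M subprob_algebra borel"
proof (rule measurable_subprob_algebra_generated[where G="Collect closed" and \<Omega>=UNIV])
  have P: "\<mu> t \<in> space (prob_algebra borel)" if "t \<in> A" for t
    using assms that by (auto simp: continuous_map_narrow_topology_iff)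
  have C: "continuous_on A (\<lambda>t. \<integral>x. apply_bcontfun \<phi> x \<partial>\<mu> t)" for \<phi> :: "'a \<Rightarrow>\<^sub>C real"
    using assms by (auto simp: continuous_map_narrow_topology_iff)
  have ps: "prob_space (\<mu> t)" "sets (\<mu> t) = sets borel" if "t \<in> A" for t
    using P[OF that] by (auto simp: space_prob_algebra)
  show "subprob_space (\<mu> t)" "sets (\<mu> t) = sets borel" if "t \<in> space (restrict_space borel A)" for t
    using ps[of t] that by (auto simp: prob_space_imp_subprob_space space_restrict_space)
  have em: "(\<lambda>t. emeasure (\<mu> t) C) \<in> borel_measurable (restrict_space borel A)" if "closed C" for C
  proof (cases "C = {}")
    case False
    have "(\<lambda>t. measure (\<mu> t) C) \<in> borel_measurable (restrict_space borel A)"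
    proof (rule borel_measurable_LIMSEQ_real)
      show "(\<lambda>n. \<integral>x. apply_bcontfun (closed_approx C n) x \<partial>\<mu> t) \<longlonglongrightarrow> measure (\<mu> t) C"
        if "t \<in> space (restrict_space borel A)" for t
        using that \<open>closed C\<close> False by (intro closed_approx_integral_tendsto P) (auto simp: space_restrict_space)
      show "(\<lambda>t. \<integral>x. apply_bcontfun (closed_approx C n) x \<partial>\<mu> t) \<in> borel_measurable (restrict_space borel A)" for n
        by (rule borel_measurable_continuous_on_restrict[OF C])
    qed
    then have "(\<lambda>t. ennreal (measure (\<mu> t) C)) \<in> borel_measurable (restrict_space borel A)" by measurable
    then show ?thesis
      by (rule measurable_cong[THEN iffD1, rotated])
         (auto simp: space_restrict_space finite_measure.emeasure_eq_measure prob_space.finite_measure[OF ps(1)])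
  qed simp
  then show "(\<lambda>t. emeasure (\<mu> t) C) \<in> borel_measurable (restrict_space borel A)" if "C \<in> Collect closed" for C
    using that by auto
  show "(\<lambda>t. emeasure (\<mu> t) UNIV) \<in> borel_measurable (restrict_space borel A)"
    using em by auto
qed (auto simp: Int_stable_def borel_eq_closed)

text \<open>The double integral in the hypothesis is an iterated lower integral until the inner one is known
  to be measurable in time; this is what measurability of the kernel is for.\<close>

lemma kernel_norm_integrable:
  fixes v :: "real \<Rightarrow> 'a::euclidean_space \<Rightarrow> 'a"
  assumes \<mu>: "continuous_map (top_of_set {0..T}) narrow_topology \<mu>"
    and v: "(\<lambda>(t, x). v t x) \<in> borel_measurable (restrict_space borel ({0..T} \<times> UNIV))"
    and fin: "(\<integral>\<^sup>+ t\<in>{0..T}. (\<integral>\<^sup>+ x. ennreal (norm (v t x)) \<partial>\<mu> t) \<partial>lborel) < \<infinity>"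
  shows "set_integrable lborel {0<..<T} (\<lambda>t. \<integral>x. norm (v t x) \<partial>\<mu> t)"
    and "AE t in lborel. t \<in> {0<..<T} \<longrightarrow> integrable (\<mu> t) (v t)"
    and "t \<in> {0..T} \<Longrightarrow> v t \<in> borel_measurable (\<mu> t)"
proof -
  let ?R = "restrict_space borel {0..T} :: real measure"
  define G where "G t = (\<integral>\<^sup>+ x. ennreal (norm (v t x)) \<partial>\<mu> t)" for t
  have sets: "sets (\<mu> t) = sets borel" if "t \<in> {0..T}" for t
    using \<mu> that by (auto simp: continuous_map_narrow_topology_iff space_prob_algebra)
  have "(\<lambda>p. p) \<in> (?R \<Otimes>\<^sub>M (borel :: 'a measure)) \<rightarrow>\<^sub>M restrict_space borel ({0..T} \<times> UNIV)"
  proof (rule measurable_restrict_space2)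
    show "(\<lambda>p. p) \<in> space (?R \<Otimes>\<^sub>M (borel :: 'a measure)) \<rightarrow> {0..T} \<times> UNIV"
      by (auto simp: space_pair_measure space_restrict_space)
    have "(\<lambda>p. (fst p, snd p)) \<in> (?R \<Otimes>\<^sub>M (borel :: 'a measure)) \<rightarrow>\<^sub>M (borel \<Otimes>\<^sub>M borel)"
      by (intro measurable_Pair measurable_compose[OF measurable_fst] measurable_snd
          measurable_restrict_space1 measurable_ident_sets) auto
    then show "(\<lambda>p. p) \<in> (?R \<Otimes>\<^sub>M (borel :: 'a measure)) \<rightarrow>\<^sub>M borel"
      by (simp add: borel_prod)
  qed
  from measurable_compose[OF this v]
  have v2: "(\<lambda>(t, x). v t x) \<in> borel_measurable (?R \<Otimes>\<^sub>M borel)" .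
  show v1: "v t \<in> borel_measurable (\<mu> t)" if t: "t \<in> {0..T}" for t
    unfolding measurable_cong_sets[OF sets[OF t] refl]
    using measurable_Pair2[OF v2, of t] t by (simp add: space_restrict_space)
  have "(\<lambda>(t, x). ennreal (norm (v t x))) \<in> borel_measurable (?R \<Otimes>\<^sub>M borel)"
    using v2 by (simp add: case_prod_beta')
  then have "G \<in> borel_measurable ?R"
    unfolding G_def[abs_def]
    by (rule nn_integral_measurable_subprob_algebra2[OF _ narrow_continuous_measurable[OF \<mu>]])
  then have Gm: "(\<lambda>t. G t * indicator {0..T} t) \<in> borel_measurable lborel"
    by (simp add: borel_measurable_restrict_space_iff_ennreal)
  have "AE t in lborel. G t * indicator {0..T} t \<noteq> \<infinity>"
    using fin by (intro nn_integral_PInf_AE Gm) (auto simp: G_def)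
  then show "AE t in lborel. t \<in> {0<..<T} \<longrightarrow> integrable (\<mu> t) (v t)"
  proof eventually_elim
    case (elim t)
    then show ?case
      using v1[of t] by (auto simp: integrable_iff_bounded G_def less_top)
  qed
  have Heq: "(\<integral>x. norm (v t x) \<partial>\<mu> t) = enn2real (G t)" if "t \<in> {0..T}" for t
    unfolding G_def using v1[OF that] by (intro integral_eq_nn_integral) auto
  show "set_integrable lborel {0<..<T} (\<lambda>t. \<integral>x. norm (v t x) \<partial>\<mu> t)"
    unfolding set_integrable_def
  proof (rule integrableI_bounded)
    have "(\<lambda>t. indicator {0<..<T} t *\<^sub>R enn2real (G t * indicator {0..T} t)) \<in> borel_measurable lborel"
      using Gm by measurable
    also have "(\<lambda>t. indicator {0<..<T} t *\<^sub>R enn2real (G t * indicator {0..T} t)) =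
        (\<lambda>t. indicator {0<..<T} t *\<^sub>R (\<integral>x. norm (v t x) \<partial>\<mu> t))"
      by (auto simp: fun_eq_iff indicator_def Heq)
    finally show "(\<lambda>t. indicator {0<..<T} t *\<^sub>R (\<integral>x. norm (v t x) \<partial>\<mu> t)) \<in> borel_measurable lborel" .
    have "(\<integral>\<^sup>+ t. ennreal (norm (indicator {0<..<T} t *\<^sub>R (\<integral>x. norm (v t x) \<partial>\<mu> t))) \<partial>lborel)
        \<le> (\<integral>\<^sup>+ t. G t * indicator {0..T} t \<partial>lborel)"
    proof (rule nn_integral_mono)
      fix t
      show "ennreal (norm (indicator {0<..<T} t *\<^sub>R (\<integral>x. norm (v t x) \<partial>\<mu> t))) \<le> G t * indicator {0..T} t"
        using Heq[of t] by (cases "G t") (auto simp: indicator_def)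
    qed
    also have "\<dots> < \<infinity>" using fin by (simp add: G_def)
    finally show "(\<integral>\<^sup>+ t. ennreal (norm (indicator {0<..<T} t *\<^sub>R (\<integral>x. norm (v t x) \<partial>\<mu> t))) \<partial>lborel) < \<infinity>" .
  qed
qed

section \<open>Matching and selection\<close>

text \<open>Hall's marriage theorem, with the induction of Halmos and Vaughan: either every proper nonempty
  subset has a neighbour to spare, and then any first choice can be made, or some subset is tight, and
  then it and its complement are matched separately.\<close>

lemma marriage:
  assumes "finite X" "\<And>x. x \<in> X \<Longrightarrow> finite (R x)"
    and "\<And>S. S \<subseteq> X \<Longrightarrow> card S \<le> card (\<Union>x\<in>S. R x)"
  shows "\<exists>f. inj_on f X \<and> (\<forall>x\<in>X. f x \<in> R x)"
  using assms
proof (induction "card X" arbitrary: X R rule: less_induct)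
  case less
  note fin = \<open>finite X\<close> and finR = less.prems(2) and hall = less.prems(3)
  show ?case
  proof (cases "X = {}")
    case False
    show ?thesis
    proof (cases "\<forall>S. S \<subset> X \<longrightarrow> S \<noteq> {} \<longrightarrow> card S < card (\<Union>x\<in>S. R x)")
      case True
      obtain x where x: "x \<in> X" using False by blast
      have "card {x} \<le> card (\<Union>x\<in>{x}. R x)" using hall[of "{x}"] x by simp
      then obtain y where y: "y \<in> R x" by (force simp: card_gt_0_iff)
      have "\<exists>f. inj_on f (X - {x}) \<and> (\<forall>z\<in>X - {x}. f z \<in> R z - {y})"
      proof (rule less.hyps)
        show "card (X - {x}) < card X" using x fin by (rule card_Diff1_less[rotated])
        fix S assume S: "S \<subseteq> X - {x}"
        show "card S \<le> card (\<Union>z\<in>S. R z - {y})"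
        proof (cases "S = {}")
          case False
          have "card S < card (\<Union>z\<in>S. R z)" using True S x False by blast
          moreover have eq: "(\<Union>z\<in>S. R z - {y}) = (\<Union>z\<in>S. R z) - {y}" by blast
          moreover have "card (\<Union>z\<in>S. R z) - 1 \<le> card ((\<Union>z\<in>S. R z) - {y})"
            by (metis card_Diff_singleton_if diff_le_self le_refl)
          ultimately show ?thesis unfolding eq by linarith
        qed simp
      qed (use fin finR in auto)
      then obtain f where f: "inj_on f (X - {x})" "\<forall>z\<in>X - {x}. f z \<in> R z - {y}" by blast
      have "inj_on (f(x := y)) X"
        using f by (auto simp: inj_on_def)
      moreover have "\<forall>z\<in>X. (f(x := y)) z \<in> R z" using f y by auto
      ultimately show ?thesis by blast
    next
      case False
      then obtain S where S: "S \<subset> X" "S \<noteq> {}" "card (\<Union>x\<in>S. R x) \<le> card S" unfolding not_all not_imp not_less by metis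
      have finS: "finite S" using S fin finite_subset by blast
      define W where "W = (\<Union>x\<in>S. R x)"
      have finW: "finite W" unfolding W_def using finS finR S by blast
      have "\<exists>f. inj_on f S \<and> (\<forall>x\<in>S. f x \<in> R x)"
      proof (rule less.hyps)
        show "card S < card X" using S fin by (simp add: psubset_card_mono)
        show "card U \<le> card (\<Union>x\<in>U. R x)" if "U \<subseteq> S" for U using hall[of U] that S by blast
      qed (use finS finR S in auto)
      then obtain f where f: "inj_on f S" "\<forall>x\<in>S. f x \<in> R x" by blast
      have "\<exists>f. inj_on f (X - S) \<and> (\<forall>x\<in>X - S. f x \<in> R x - W)"
      proof (rule less.hyps)
        show "card (X - S) < card X" using S fin by (intro psubset_card_mono) auto
        fix U assume U: "U \<subseteq> X - S"
        have finU: "finite U" using U fin finite_subset by blast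
        have "card U + card S = card (U \<union> S)" using U finU finS by (subst card_Un_disjoint) auto
        also have "\<dots> \<le> card (\<Union>x\<in>U \<union> S. R x)" using U S by (intro hall) auto
        also have "(\<Union>x\<in>U \<union> S. R x) = (\<Union>x\<in>U. R x - W) \<union> W" by (auto simp: W_def)
        also have "card \<dots> \<le> card (\<Union>x\<in>U. R x - W) + card W" by (rule card_Un_le)
        finally show "card U \<le> card (\<Union>x\<in>U. R x - W)" using S(3) by (simp add: W_def)
      qed (use fin finR in auto)
      then obtain g where g: "inj_on g (X - S)" "\<forall>x\<in>X - S. g x \<in> R x - W" by blast
      have "f ` S \<subseteq> W" using f by (auto simp: W_def)
      then have "inj_on (\<lambda>x. if x \<in> S then f x else g x) (S \<union> (X - S))"
        using f g by (intro inj_on_disjoint_Un) auto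
      then have "inj_on (\<lambda>x. if x \<in> S then f x else g x) X"
        using S(1) by (simp add: Un_absorb1 psubset_imp_subset)
      then show ?thesis using f g by (intro exI[of _ "\<lambda>x. if x \<in> S then f x else g x"]) auto
    qed
  qed simp
qed

text \<open>For finitely many times, compose the step bijections in temporal order; the bound is a
  difference of values of \<open>W\<close>, so it adds up along the composition. Each time has finitely many
  enumerations, so the space of all choices is compact by Tychonoff's theorem, and the constraint for
  each pair of times is closed.\<close>

lemma compatible_enumerations:
  fixes P :: "real \<Rightarrow> 'a::metric_space set" and W :: "real \<Rightarrow> real"
  assumes P: "\<And>t. t \<in> G \<Longrightarrow> finite (P t) \<and> card (P t) = N"
    and step: "\<And>s t. s \<in> G \<Longrightarrow> t \<in> G \<Longrightarrow> s < t \<Longrightarrow>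
      \<exists>h. bij_betw h (P s) (P t) \<and> (\<forall>x\<in>P s. dist x (h x) \<le> W t - W s)"
  shows "\<exists>f. (\<forall>t\<in>G. bij_betw (f t) {..<N} (P t)) \<and>
    (\<forall>s\<in>G. \<forall>t\<in>G. s < t \<longrightarrow> (\<forall>i<N. dist (f s i) (f t i) \<le> W t - W s))"
proof -
  define B where "B t = {h \<in> {..<N} \<rightarrow>\<^sub>E P t. bij_betw h {..<N} (P t)}" for t
  have finB: "finite (B t)" if "t \<in> G" for t
    by (rule finite_subset[of _ "{..<N} \<rightarrow>\<^sub>E P t"]) (use P[OF that] in \<open>auto simp: B_def intro!: finite_PiE\<close>)
  have BI: "restrict h {..<N} \<in> B t" if "bij_betw h {..<N} (P t)" for h t
    using that by (auto simp: B_def bij_betw_def inj_on_def)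
  have neB: "B t \<noteq> {}" if "t \<in> G" for t
    using P[OF that] ex_bij_betw_nat_finite[of "P t"] BI[of _ t] by (auto simp: lessThan_atLeast0)
  define ok where "ok s t h k \<longleftrightarrow> (\<forall>i<N. dist (h i) (k i) \<le> W t - W s)"
    for s t :: real and h k :: "nat \<Rightarrow> 'a"
  have finite_stage: "\<exists>f. (\<forall>t\<in>F. f t \<in> B t) \<and> (\<forall>s\<in>F. \<forall>t\<in>F. s < t \<longrightarrow> ok s t (f s) (f t))"
    if "finite F" "F \<subseteq> G" for F
    using that
  proof (induction rule: finite_linorder_max_induct)
    case (insert b A)
    then obtain f where f: "\<forall>t\<in>A. f t \<in> B t" "\<forall>s\<in>A. \<forall>t\<in>A. s < t \<longrightarrow> ok s t (f s) (f t)" by auto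
    have b: "b \<in> G" using insert.prems by simp
    show ?case
    proof (cases "A = {}")
      case True
      then show ?thesis using neB[OF b] by (auto intro: exI[of _ "\<lambda>_. SOME h. h \<in> B b"] some_in_eq[THEN iffD2])
    next
      case False
      define m where "m = Max A"
      have m: "m \<in> A" "m < b" "\<And>s. s \<in> A \<Longrightarrow> s \<le> m"
        using False insert.hyps by (auto simp: m_def)
      then have "m \<in> G" using insert.prems by auto
      from step[OF this b \<open>m < b\<close>] obtain h where
        h: "bij_betw h (P m) (P b)" "\<And>x. x \<in> P m \<Longrightarrow> dist x (h x) \<le> W b - W m" by blast
      define k where "k = restrict (h \<circ> f m) {..<N}"
      have fm: "bij_betw (f m) {..<N} (P m)" using f(1) m(1) by (auto simp: B_def)
      then have "k \<in> B b" unfolding k_def using h(1) by (intro BI bij_betw_trans)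
      have okm: "ok m b (f m) k"
        using fm h(2) by (auto simp: ok_def k_def bij_betw_def)
      have "ok s b (f s) k" if s: "s \<in> A" for s
      proof (cases "s = m")
        case False
        then have "ok s m (f s) (f m)" using f(2) s m by (auto simp: order_less_le)
        then show ?thesis using okm unfolding ok_def
          by (smt (verit) dist_triangle)
      qed (use okm in simp)
      then show ?thesis
        using f \<open>k \<in> B b\<close> insert.hyps
        by (intro exI[of _ "f(b := k)"]) auto
    qed
  qed auto
  define X where "X = product_topology (\<lambda>t. discrete_topology (B t)) G"
  have top: "topspace X = (\<Pi>\<^sub>E t\<in>G. B t)" by (simp add: X_def)
  have compact: "compact_space X"
    unfolding X_def compact_space_product_topology using finB by (auto simp: compact_space_discrete_topology)
  define K where "K = (\<lambda>(s, t). {f \<in> topspace X. ok s t (f s) (f t)})"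
  define Q where "Q = {(s, t). s \<in> G \<and> t \<in> G \<and> s < t}"
  have closed: "closedin X (K (s, t))" if "(s, t) \<in> Q" for s t
  proof -
    have pre: "closedin X {f \<in> topspace X. f t \<in> {a}}" if "t \<in> G" "a \<in> B t" for t a
      unfolding X_def
      by (rule closedin_continuous_map_preimage[OF continuous_map_product_projection[OF that(1)]])
         (use that in simp)
    have "K (s, t) = (\<Union>(a, b)\<in>{(a, b)\<in>B s \<times> B t. ok s t a b}.
        {f \<in> topspace X. f s \<in> {a}} \<inter> {f \<in> topspace X. f t \<in> {b}})"
      using that by (auto simp: K_def Q_def top PiE_iff)
    moreover have "finite {(a, b)\<in>B s \<times> B t. ok s t a b}"
      by (rule finite_subset[of _ "B s \<times> B t"]) (use that finB in \<open>auto simp: Q_def\<close>)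
    moreover have "closedin X ({f \<in> topspace X. f s \<in> {a}} \<inter> {f \<in> topspace X. f t \<in> {b}})"
      if "a \<in> B s" "b \<in> B t" for a b
      using that \<open>(s, t) \<in> Q\<close> by (intro closedin_Int pre) (auto simp: Q_def)
    ultimately show ?thesis by (auto intro!: closedin_Union)
  qed
  have "\<Inter>(insert (topspace X) (K ` Q)) \<noteq> {}"
  proof (rule compact[unfolded compact_space_fip, rule_format], intro conjI ballI allI impI)
    show "closedin X C" if "C \<in> insert (topspace X) (K ` Q)" for C
      using that closed by auto
    fix \<F> assume "finite \<F> \<and> \<F> \<subseteq> insert (topspace X) (K ` Q)"
    then have "finite (\<F> - {topspace X})" "\<F> - {topspace X} \<subseteq> K ` Q" by auto
    then obtain D where D: "D \<subseteq> Q" "finite D" "\<F> - {topspace X} = K ` D"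
      by (meson finite_subset_image)
    define F where "F = fst ` D \<union> snd ` D"
    have F: "finite F" "F \<subseteq> G" using D by (auto simp: F_def Q_def)
    then obtain f where f: "\<forall>t\<in>F. f t \<in> B t" "\<forall>s\<in>F. \<forall>t\<in>F. s < t \<longrightarrow> ok s t (f s) (f t)"
      using finite_stage by blast
    define g where "g = restrict (\<lambda>t. if t \<in> F then f t else SOME h. h \<in> B t) G"
    have g: "g \<in> topspace X"
      using f neB by (auto simp: top g_def some_in_eq)
    have "g \<in> K d" if "d \<in> D" for d
    proof -
      have "d \<in> Q" using that D(1) by blast
      then have "fst d < snd d" by (auto simp: Q_def)
      moreover have "fst d \<in> F" "snd d \<in> F" using that by (auto simp: F_def)
      moreover from this have "g (fst d) = f (fst d)" "g (snd d) = f (snd d)" using F by (auto simp: g_def)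
      ultimately show ?thesis using f(2) g unfolding K_def case_prod_beta' by simp
    qed
    then have "g \<in> C" if "C \<in> \<F>" for C
      using g D(3) that by (cases "C = topspace X") blast+
    then show "\<Inter>\<F> \<noteq> {}" by blast
  qed
  then obtain f where f: "f \<in> topspace X" "\<And>s t. (s, t) \<in> Q \<Longrightarrow> f \<in> K (s, t)" by blast
  show ?thesis
  proof (intro exI[of _ f] conjI ballI impI)
    show "bij_betw (f t) {..<N} (P t)" if "t \<in> G" for t
      using f(1) that by (auto simp: top B_def PiE_iff)
    show "\<forall>i<N. dist (f s i) (f t i) \<le> W t - W s" if "s \<in> G" "t \<in> G" "s < t" for s t
      using f(2)[of s t] that by (auto simp: K_def Q_def ok_def)
  qed
qed

text \<open>The modulus of continuity makes the curve uniformly continuous on the dense set \<open>G\<close>.\<close>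

lemma extend_controlled_curve:
  fixes c :: "real \<Rightarrow> 'a::complete_space" and W :: "real \<Rightarrow> real"
  assumes W: "continuous_on {0..T} W" and G: "G \<subseteq> {0..T}" "{0..T} \<subseteq> closure G"
    and c: "\<And>s t. s \<in> G \<Longrightarrow> t \<in> G \<Longrightarrow> s < t \<Longrightarrow> dist (c s) (c t) \<le> W t - W s"
  shows "\<exists>\<gamma>. continuous_on {0..T} \<gamma> \<and> (\<forall>t\<in>G. \<gamma> t = c t) \<and>
    (\<forall>s\<in>{0..T}. \<forall>t\<in>{0..T}. dist (\<gamma> s) (\<gamma> t) \<le> \<bar>W t - W s\<bar>)"
proof -
  have c': "dist (c s) (c t) \<le> \<bar>W t - W s\<bar>" if "s \<in> G" "t \<in> G" for s t
    using c[of s t] c[of t s] that by (cases s t rule: linorder_cases) (auto simp: dist_commute)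
  have cl: "closure G = {0..T}"
    using G by (simp add: antisym closure_minimal)
  have "uniformly_continuous_on G c"
    unfolding uniformly_continuous_on_def
  proof (intro allI impI)
    fix e :: real assume "e > 0"
    have "uniformly_continuous_on {0..T} W" by (rule compact_uniformly_continuous[OF W]) simp
    then obtain d where "d > 0" and d: "\<And>s t. s \<in> {0..T} \<Longrightarrow> t \<in> {0..T} \<Longrightarrow> dist t s < d \<Longrightarrow> dist (W t) (W s) < e"
      using \<open>e > 0\<close> unfolding uniformly_continuous_on_def by metis
    then show "\<exists>d>0. \<forall>x\<in>G. \<forall>x'\<in>G. dist x' x < d \<longrightarrow> dist (c x') (c x) < e"
      using G(1) c' by (intro exI[of _ d]) (smt (verit) dist_real_def subsetD)
  qed
  from uniformly_continuous_on_extension_on_closure[OF this]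
  obtain \<gamma> where \<gamma>: "uniformly_continuous_on (closure G) \<gamma>" "\<And>x. x \<in> G \<Longrightarrow> c x = \<gamma> x" by metis
  have cont: "continuous_on {0..T} \<gamma>" using \<gamma>(1) cl uniformly_continuous_imp_continuous by metis
  have "dist (\<gamma> s) (\<gamma> t) \<le> \<bar>W t - W s\<bar>" if st: "s \<in> {0..T}" "t \<in> {0..T}" for s t
  proof -
    have "s \<in> closure G" "t \<in> closure G" using st cl by auto
    then obtain a b where a: "\<And>n. a n \<in> G" "a \<longlonglongrightarrow> s" and b: "\<And>n. b n \<in> G" "b \<longlonglongrightarrow> t"
      unfolding closure_sequential by blast
    have lim: "(\<lambda>n. f (u n)) \<longlonglongrightarrow> f x"
      if "continuous_on {0..T} f" "\<And>n. u n \<in> G" "u \<longlonglongrightarrow> x" "x \<in> {0..T}"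
      for f :: "real \<Rightarrow> 'b::topological_space" and u x
      using subsetD[OF G(1) that(2)]
      by (intro continuous_on_tendsto_compose[OF that(1) that(3)]) (use that in \<open>auto intro!: always_eventually\<close>)
    have \<gamma>_lim: "(\<lambda>n. \<gamma> (a n)) \<longlonglongrightarrow> \<gamma> s" "(\<lambda>n. \<gamma> (b n)) \<longlonglongrightarrow> \<gamma> t"
      by (rule lim[OF cont a st(1)], rule lim[OF cont b st(2)])
    have W_lim: "(\<lambda>n. W (a n)) \<longlonglongrightarrow> W s" "(\<lambda>n. W (b n)) \<longlonglongrightarrow> W t"
      by (rule lim[OF W a st(1)], rule lim[OF W b st(2)])
    show ?thesis
    proof (rule LIMSEQ_le)
      show "(\<lambda>n. dist (\<gamma> (a n)) (\<gamma> (b n))) \<longlonglongrightarrow> dist (\<gamma> s) (\<gamma> t)"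
        by (intro tendsto_dist \<gamma>_lim)
      show "(\<lambda>n. \<bar>W (b n) - W (a n)\<bar>) \<longlonglongrightarrow> \<bar>W t - W s\<bar>"
        by (intro tendsto_rabs tendsto_diff W_lim)
      have "dist (\<gamma> (a n)) (\<gamma> (b n)) \<le> \<bar>W (b n) - W (a n)\<bar>" for n
        using c'[OF a(1)[of n] b(1)[of n]] \<gamma>(2)[OF a(1)[of n]] \<gamma>(2)[OF b(1)[of n]] by simp
      then show "\<exists>N. \<forall>n\<ge>N. dist (\<gamma> (a n)) (\<gamma> (b n)) \<le> \<bar>W (b n) - W (a n)\<bar>" by blast
    qed
  qed
  then show ?thesis using cont \<gamma>(2) by auto
qed

section \<open>Absolute continuity\<close>

lemma indefinite_integral_continuous:
  fixes w :: "real \<Rightarrow> real"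
  assumes w: "integrable lborel w"
  shows "continuous_on UNIV (\<lambda>x. LINT y:{..x}|lborel. w y)"
proof (rule continuous_at_imp_continuous_on, rule ballI)
  fix x :: real
  have [measurable]: "w \<in> borel_measurable borel" using w by auto
  show "isCont (\<lambda>x. LINT y:{..x}|lborel. w y) x"
    unfolding continuous_at_sequentially comp_def
  proof (intro allI impI)
    fix u assume u: "u \<longlonglongrightarrow> x"
    show "(\<lambda>n. LINT y:{..u n}|lborel. w y) \<longlonglongrightarrow> (LINT y:{..x}|lborel. w y)"
      unfolding set_lebesgue_integral_def
    proof (rule integral_dominated_convergence[where w="\<lambda>y. norm (w y)"])
      show "AE y in lborel. (\<lambda>n. indicator {..u n} y *\<^sub>R w y) \<longlonglongrightarrow> indicator {..x} y *\<^sub>R w y"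
        using AE_lborel_singleton[of x]
      proof eventually_elim
        case (elim y)
        have "\<forall>\<^sub>F n in sequentially. indicator {..u n} y *\<^sub>R w y = indicator {..x} y *\<^sub>R w y"
        proof (cases "y < x")
          case True
          show ?thesis using order_tendstoD(1)[OF u True] by eventually_elim (use True in auto)
        next
          case False
          then have "x < y" using elim by simp
          show ?thesis using order_tendstoD(2)[OF u \<open>x < y\<close>] by eventually_elim (use \<open>x < y\<close> in auto)
        qed
        then show ?case by (rule tendsto_eventually)
      qed
    qed (use w in \<open>auto simp: indicator_def\<close>)
  qed
qed

text \<open>Split \<open>w\<close> at a level \<open>M\<close>: the part above \<open>M\<close> has small integral, and the part below contributes
  at most \<open>M\<close> times the total length.\<close>

lemma integral_control_AC:
  fixes \<gamma> :: "real \<Rightarrow> 'a::metric_space" and w :: "real \<Rightarrow> real"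
  assumes w: "integrable lborel w" "\<And>x. 0 \<le> w x" and C: "0 \<le> C"
    and \<gamma>: "\<And>s t. 0 \<le> s \<Longrightarrow> s \<le> t \<Longrightarrow> t \<le> T \<Longrightarrow> dist (\<gamma> s) (\<gamma> t) \<le> C * (LINT y:{s..t}|lborel. w y)"
  shows "\<gamma> \<in> AC T"
  unfolding AC_def
proof (intro CollectI allI impI)
  fix \<epsilon> :: real assume "\<epsilon> > 0"
  have [measurable]: "w \<in> borel_measurable borel" using w by auto
  \<comment> \<open>\<open>C + 1\<close> instead of \<open>C\<close>, which may be \<open>0\<close>\<close>
  define e where "e = \<epsilon> / (2 * (C + 1))"
  have "e > 0" using C \<open>\<epsilon> > 0\<close> by (simp add: e_def)
  have "(\<lambda>n. LINT y|lborel. indicator {real n<..} (w y) * w y) \<longlonglongrightarrow> (LINT y::real|lborel. 0 :: real)"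
  proof (rule integral_dominated_convergence[where w=w and f="\<lambda>_. 0"])
    show "AE y in lborel. (\<lambda>n. indicator {real n<..} (w y) * w y) \<longlonglongrightarrow> 0"
    proof (rule AE_I2)
      fix y
      obtain m where m: "w y < real m" using reals_Archimedean2 by blast
      have "\<forall>\<^sub>F n in sequentially. indicator {real n<..} (w y) * w y = 0"
        using eventually_ge_at_top[of m] by eventually_elim (use m in \<open>auto simp: indicator_def\<close>)
      then show "(\<lambda>n. indicator {real n<..} (w y) * w y) \<longlonglongrightarrow> 0" by (rule tendsto_eventually)
    qed
  qed (use w in \<open>auto simp: indicator_def\<close>)
  then have "\<forall>\<^sub>F n in sequentially. (LINT y|lborel. indicator {real n<..} (w y) * w y) < e"
    using \<open>e > 0\<close> by (intro order_tendstoD(2)) auto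
  then obtain M where M: "(LINT y|lborel. indicator {real M<..} (w y) * w y) < e"
    by (auto simp: eventually_sequentially)
  define \<delta> where "\<delta> = e / (real M + 1)"
  have "\<delta> > 0" using \<open>e > 0\<close> by (simp add: \<delta>_def)
  show "\<exists>\<delta>>0. \<forall>(n::nat) a b.
     (\<forall>i<n. 0 \<le> a i \<and> a i \<le> b i \<and> b i \<le> T) \<longrightarrow>
     disjoint_family_on (\<lambda>i. {a i<..<b i}) {..<n} \<longrightarrow>
     (\<Sum>i<n. b i - a i) < \<delta> \<longrightarrow> (\<Sum>i<n. dist (\<gamma> (a i)) (\<gamma> (b i))) < \<epsilon>"
  proof (intro exI[of _ \<delta>] conjI allI impI \<open>\<delta> > 0\<close>)
    fix n and a b :: "nat \<Rightarrow> real"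
    assume ab: "\<forall>i<n. 0 \<le> a i \<and> a i \<le> b i \<and> b i \<le> T"
      and disj: "disjoint_family_on (\<lambda>i. {a i<..<b i}) {..<n}"
      and small: "(\<Sum>i<n. b i - a i) < \<delta>"
    have open_closed: "(LINT y:{s..t}|lborel. w y) = (LINT y|lborel. indicator {s<..<t} y * w y)" for s t
      unfolding set_lebesgue_integral_def
    proof (rule integral_cong_AE)
      show "AE y in lborel. indicator {s..t} y *\<^sub>R w y = indicator {s<..<t} y * w y"
        using AE_lborel_singleton[of s] AE_lborel_singleton[of t]
        by eventually_elim (auto simp: indicator_def)
    qed auto
    have int: "integrable lborel (\<lambda>y. indicator {s<..<t} y * w y)" for s t
      using integrable_imp_set_integrable[OF w(1), of "{s<..<t}"] by (simp add: set_integrable_def)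
    have int_big: "integrable lborel (\<lambda>y. indicator {real M<..} (w y) * w y)"
      by (rule Bochner_Integration.integrable_bound[OF w(1)]) (auto simp: indicator_def)
    have int_small: "integrable lborel (\<lambda>y. real M * (\<Sum>i<n. indicator {a i<..<b i} y))"
      by (intro integrable_mult_right Bochner_Integration.integrable_sum integrable_real_indicator) 
         (use ab in auto)
    have "(\<Sum>i<n. LINT y:{a i..b i}|lborel. w y) = (LINT y|lborel. (\<Sum>i<n. indicator {a i<..<b i} y * w y))"
      unfolding open_closed by (rule Bochner_Integration.integral_sum[symmetric]) (rule int)
    also have "\<dots> \<le> (LINT y|lborel. real M * (\<Sum>i<n. indicator {a i<..<b i} y) + indicator {real M<..} (w y) * w y)"
    proof (rule integral_mono)
      fix y
      have eq: "(\<Sum>i<n. indicator {a i<..<b i} y :: real) = indicator (\<Union>i<n. {a i<..<b i}) y"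
        by (rule indicator_UN_disjoint[OF _ disj, symmetric]) simp
      show "(\<Sum>i<n. indicator {a i<..<b i} y * w y) \<le>
          real M * (\<Sum>i<n. indicator {a i<..<b i} y) + indicator {real M<..} (w y) * w y"
        unfolding sum_distrib_right[symmetric] eq using w(2)[of y] by (simp add: indicator_def)
    qed (intro Bochner_Integration.integrable_sum Bochner_Integration.integrable_add int int_big int_small)+
    also have "\<dots> = real M * (\<Sum>i<n. b i - a i) + (LINT y|lborel. indicator {real M<..} (w y) * w y)"
    proof -
      have "(LINT y|lborel. (\<Sum>i<n. indicator {a i<..<b i} y :: real)) = (\<Sum>i<n. LINT y|lborel. indicator {a i<..<b i} y)"
        by (intro Bochner_Integration.integral_sum integrable_real_indicator) (use ab in auto)
      also have "\<dots> = (\<Sum>i<n. b i - a i)" using ab by (intro sum.cong) auto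
      finally show ?thesis using int_big int_small by simp
    qed
    also have "\<dots> < e + e"
    proof -
      have "real M * (\<Sum>i<n. b i - a i) \<le> real M * \<delta>" using small by (intro mult_left_mono) auto
      also have "\<dots> \<le> e" using \<open>e > 0\<close> by (simp add: \<delta>_def field_simps)
      finally show ?thesis using M by linarith
    qed
    finally have *: "(\<Sum>i<n. LINT y:{a i..b i}|lborel. w y) < 2 * e" by simp
    have "(\<Sum>i<n. dist (\<gamma> (a i)) (\<gamma> (b i))) \<le> (\<Sum>i<n. C * (LINT y:{a i..b i}|lborel. w y))"
      using ab by (intro sum_mono \<gamma>) auto
    also have "\<dots> \<le> C * (2 * e)"
      unfolding sum_distrib_left[symmetric] using * C by (intro mult_left_mono) auto
    also have "\<dots> < (C + 1) * (2 * e)" using \<open>e > 0\<close> by simp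
    also have "\<dots> = \<epsilon>" using C by (simp add: e_def field_simps)
    finally show "(\<Sum>i<n. dist (\<gamma> (a i)) (\<gamma> (b i))) < \<epsilon>" .
  qed
qed

lemma abs_set_integral_le:
  fixes g h :: "'a \<Rightarrow> real"
  assumes "set_integrable M A g" "set_integrable M A h" "AE x\<in>A in M. \<bar>g x\<bar> \<le> h x"
  shows "\<bar>LINT x:A|M. g x\<bar> \<le> (LINT x:A|M. h x)"
proof -
  have "norm (LINT x:A|M. g x) \<le> (LINT x:A|M. norm (g x))"
    by (rule set_integral_norm_bound[OF assms(1)])
  also have "\<dots> \<le> (LINT x:A|M. h x)"
    using assms(3) by (intro set_integral_mono_AE set_integrable_norm assms(1,2)) simp
  finally show ?thesis by simp
qed

section \<open>Systems of finitely many particles\<close>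

text \<open>Hall's condition from a mass balance. If a subset \<open>S\<close> of \<open>X\<close> had fewer than \<open>card S\<close> points
  of \<open>Y\<close> within distance \<open>3 * R\<close>, then the sum over \<open>X\<close> of a cluster function around \<open>S\<close> would exceed
  its sum over \<open>Y\<close> by at least \<open>1\<close>. The centres are moved into \<open>D\<close>, which costs a distance of \<open>R\<close>,
  because the balance is only available for countably many functions.\<close>

lemma bij_betw_by_cluster_transport:
  fixes X Y :: "'a::euclidean_space set"
  assumes fin: "finite X" "finite Y" "card X = card Y"
    and D: "\<And>x e. 0 < e \<Longrightarrow> \<exists>d\<in>D. dist d x < e" and R: "0 < R"
    and transport: "\<And>S. finite S \<Longrightarrow> S \<subseteq> D \<Longrightarrow> card S \<le> card X \<Longrightarrow>
      (\<Sum>x\<in>X. cluster S R x) - (\<Sum>y\<in>Y. cluster S R y) < 1"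
  shows "\<exists>h. bij_betw h X Y \<and> (\<forall>x\<in>X. dist x (h x) \<le> 3 * R)"
proof -
  define nb where "nb x = {y \<in> Y. dist x y \<le> 3 * R}" for x
  obtain p where p: "\<And>x. p x \<in> D" "\<And>x. dist (p x) x < R" using D[OF R] by metis
  have "\<exists>f. inj_on f X \<and> (\<forall>x\<in>X. f x \<in> nb x)"
  proof (rule marriage[OF fin(1)])
    show "finite (nb x)" for x using fin by (simp add: nb_def)
    fix S assume S: "S \<subseteq> X"
    have finS: "finite S" using S fin finite_subset by blast
    show "card S \<le> card (\<Union>x\<in>S. nb x)"
    proof (rule ccontr)
      assume "\<not> card S \<le> card (\<Union>x\<in>S. nb x)"
      then have less: "card (\<Union>x\<in>S. nb x) + 1 \<le> card S" by simp
      let ?f = "cluster (p ` S) R"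
      have "?f x = 1" if "x \<in> S" for x
        using that finS R p(2)[of x]
        by (intro cluster_eq_1[of "p ` S" "p x"]) (auto simp: dist_commute)
      then have "real (card S) = (\<Sum>x\<in>S. ?f x)" by simp
      also have "\<dots> \<le> (\<Sum>x\<in>X. ?f x)"
        using S fin by (intro sum_mono2) (auto simp: cluster_bounds)
      finally have 1: "real (card S) \<le> (\<Sum>x\<in>X. ?f x)" .
      have zero: "?f y = 0" if "y \<in> Y - (\<Union>x\<in>S. nb x)" for y
      proof (rule cluster_eq_0[OF R])
        fix q assume "q \<in> p ` S"
        then obtain x where x: "x \<in> S" "q = p x" by blast
        then have "3 * R < dist x y" using that by (auto simp: nb_def)
        then show "2 * R \<le> dist y q"
          using p(2)[of x] dist_triangle[of x y q] x by (simp add: dist_commute)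
      qed
      have "(\<Sum>y\<in>Y. ?f y) = (\<Sum>y\<in>(\<Union>x\<in>S. nb x). ?f y)"
        using fin zero by (intro sum.mono_neutral_right) (auto simp: nb_def)
      also have "\<dots> \<le> (\<Sum>y\<in>(\<Union>x\<in>S. nb x). 1)"
        by (intro sum_mono cluster_bounds)
      finally have "(\<Sum>y\<in>Y. ?f y) \<le> real (card (\<Union>x\<in>S. nb x))" by simp
      moreover have "(\<Sum>x\<in>X. ?f x) - (\<Sum>y\<in>Y. ?f y) < 1"
      proof (rule transport)
        show "card (p ` S) \<le> card X"
          using card_image_le[OF finS, of p] card_mono[OF fin(1) S] by linarith
      qed (use p(1) finS in auto)
      ultimately show False using 1 less by linarith
    qed
  qed
  then obtain f where f: "inj_on f X" "\<forall>x\<in>X. f x \<in> nb x" by blast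
  then have "f ` X = Y"
    using fin by (intro card_subset_eq) (auto simp: nb_def card_image)
  then show ?thesis using f by (auto simp: bij_betw_def nb_def intro!: exI[of _ f])
qed

lemma dense_if_conull:
  fixes T :: real
  assumes T: "0 < T" and G: "AE t in lborel. t \<in> {0<..<T} \<longrightarrow> t \<in> G"
  shows "{0..T} \<subseteq> closure G"
proof
  fix x assume x: "x \<in> {0..T}"
  show "x \<in> closure G"
  proof (rule ccontr)
    assume "x \<notin> closure G"
    then obtain e where e: "e > 0" "\<And>y. y \<in> G \<Longrightarrow> e \<le> dist y x"
      unfolding closure_approachable by (auto simp: not_less)
    define a b where "a = max 0 (x - e)" and "b = min T (x + e)"
    have ab: "a < b" using x e(1) T by (auto simp: a_def b_def)
    have "AE t in lborel. t \<notin> {a<..<b}"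
      using G
    proof eventually_elim
      case (elim t)
      show ?case
      proof
        assume t: "t \<in> {a<..<b}"
        then have "t \<in> G" using elim by (auto simp: a_def b_def)
        from e(2)[OF this] t show False by (auto simp: a_def b_def dist_real_def)
      qed
    qed
    then have "{a<..<b} \<in> null_sets lborel" by (subst AE_iff_null_sets) auto
    then show False using ab by (auto simp: null_sets_def)
  qed
qed

text \<open>The functions against which the equation is tested in space: cluster functions give the
  matching, cut-off coordinates the velocity. Rational radii and centres in a countable set \<open>D\<close> keep
  the family countable, so that one null set of times serves all of them.\<close>

definition tests :: "'a::euclidean_space set \<Rightarrow> (('a \<Rightarrow> real) \<times> ('a \<Rightarrow> 'a)) set" where
  "tests D = (\<lambda>(S, R). (cluster S R, cluster_grad S R)) ` ({S. finite S \<and> S \<subseteq> D} \<times> {R \<in> \<rat>. 0 < R}) \<union>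
     (\<lambda>(e, p, R). (coord_bump e p R, coord_bump_grad e p R)) ` (Basis \<times> D \<times> {R \<in> \<rat>. 0 < R})"

lemma countable_tests:
  assumes "countable D"
  shows "countable (tests D)"
proof -
  have "countable {R :: real. R \<in> \<rat> \<and> 0 < R}"
    by (rule countable_subset[OF _ countable_rat]) auto
  moreover have "countable {S. finite S \<and> S \<subseteq> D}"
    using countable_Collect_finite_subset[OF assms] by (simp add: conj_commute)
  ultimately show ?thesis
    unfolding tests_def using assms
    by (intro countable_Un countable_image countable_SIGMA countable_finite[OF finite_Basis]) auto
qed

lemma tests_test_fun: "(f, Df) \<in> tests D \<Longrightarrow> \<exists>L. test_fun f Df L"
  using test_fun_cluster test_fun_coord_bump by (fastforce simp: tests_def)

text \<open>Finitely many moving points, known only as the sets \<open>P t\<close> of their positions at the times of a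
  conull set \<open>G\<close>, where they are pairwise distinct. The axiom \<open>transport\<close> is the continuity equation
  with velocity \<open>v\<close> in integrated form, and \<open>H\<close> bounds the total speed.\<close>

locale particle_system =
  fixes T :: real and G :: "real set" and P :: "real \<Rightarrow> 'a::euclidean_space set" and N :: nat
    and v :: "real \<Rightarrow> 'a \<Rightarrow> 'a" and H :: "real \<Rightarrow> real" and D :: "'a set"
  assumes T: "0 < T"
    and G: "G \<subseteq> {0<..<T}" "AE t in lborel. t \<in> {0<..<T} \<longrightarrow> t \<in> G"
    and P: "\<And>t. t \<in> G \<Longrightarrow> finite (P t)" "\<And>t. t \<in> G \<Longrightarrow> card (P t) = N"
    and H: "set_integrable lborel {0<..<T} H" "\<And>t. t \<in> G \<Longrightarrow> (\<Sum>x\<in>P t. norm (v t x)) \<le> H t"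
    and D: "countable D" "\<And>x e. 0 < e \<Longrightarrow> \<exists>d\<in>D. dist d x < e"
    and transport: "\<And>f Df. (f, Df) \<in> tests D \<Longrightarrow> \<exists>g. set_integrable lborel {0<..<T} g \<and>
      (\<forall>t\<in>G. g t = (\<Sum>x\<in>P t. Df x \<bullet> v t x)) \<and>
      (\<forall>s\<in>G. \<forall>t\<in>G. s < t \<longrightarrow> (\<Sum>x\<in>P t. f x) - (\<Sum>x\<in>P s. f x) = (LINT r:{s..t}|lborel. g r))"
begin

text \<open>The summand \<open>1\<close> makes the indefinite integral strictly increasing on the interval, which leaves room for a
  rational radius in \<open>matching\<close>.\<close>

definition w :: "real \<Rightarrow> real" where
  "w t = indicator {0<..<T} t * (\<bar>H t\<bar> + 1)"

definition U :: "real \<Rightarrow> real" where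
  "U t = (LINT r:{..t}|lborel. w r)"

text \<open>Three times the bound \<open>33 * (N + 1)\<close> for the radius in \<open>matching\<close>.\<close>

definition K :: real where
  "K = 99 * (real N + 1)"

lemma w_integrable: "integrable lborel w"
proof -
  have "integrable lborel (\<lambda>t. \<bar>indicator {0<..<T} t * H t\<bar> + indicator {0<..<T} t)"
    using H(1) T by (intro Bochner_Integration.integrable_add integrable_abs integrable_real_indicator)
      (auto simp: set_integrable_def)
  also have "(\<lambda>t. \<bar>indicator {0<..<T} t * H t\<bar> + indicator {0<..<T} t) = w"
    by (auto simp: w_def indicator_def fun_eq_iff)
  finally show ?thesis .
qed

lemma w_nonneg: "0 \<le> w t"
  by (simp add: w_def)

lemma U_diff: "s \<le> t \<Longrightarrow> U t - U s = (LINT r:{s..t}|lborel. w r)"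
  unfolding U_def by (rule set_integral_atMost_diff[OF w_integrable])

lemma U_mono: "s \<le> t \<Longrightarrow> U s \<le> U t"
proof -
  assume "s \<le> t"
  moreover have "0 \<le> (LINT r:{s..t}|lborel. w r)"
    unfolding set_lebesgue_integral_def by (intro Bochner_Integration.integral_nonneg) (simp add: w_nonneg)
  ultimately show ?thesis using U_diff[of s t] by simp
qed

lemma Icc_subset: "s \<in> G \<Longrightarrow> t \<in> G \<Longrightarrow> {s..t} \<subseteq> {0<..<T}"
  using subsetD[OF G(1), of s] subsetD[OF G(1), of t] by auto

lemma U_strict:
  assumes "s \<in> {0<..<T}" "t \<in> {0<..<T}" "s < t"
  shows "U s < U t"
proof -
  have "(LINT r:{s..t}|lborel. 1) \<le> (LINT r:{s..t}|lborel. w r)"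
  proof (rule set_integral_mono)
    show "set_integrable lborel {s..t} (\<lambda>r. 1 :: real)" by (simp add: set_integrable_def emeasure_lborel_Icc_eq)
    show "set_integrable lborel {s..t} w" by (intro integrable_imp_set_integrable w_integrable) auto
    show "1 \<le> w r" if "r \<in> {s..t}" for r using that assms by (auto simp: w_def)
  qed
  moreover have "(LINT r:{s..t}|lborel. 1) = t - s"
    using assms by (simp add: set_lebesgue_integral_def)
  ultimately show ?thesis using U_diff[of s t] assms by simp
qed

lemma G_dense: "{0..T} \<subseteq> closure G"
  using dense_if_conull[OF T G(2)] .

lemma test_increment_bound:
  assumes f: "(f, Df) \<in> tests D" "test_fun f Df L" and st: "s \<in> G" "t \<in> G" "s < t"
  shows "\<bar>(\<Sum>x\<in>P t. f x) - (\<Sum>x\<in>P s. f x)\<bar> \<le> L * (U t - U s)"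
proof -
  obtain g where g: "set_integrable lborel {0<..<T} g" "\<And>t. t \<in> G \<Longrightarrow> g t = (\<Sum>x\<in>P t. Df x \<bullet> v t x)"
    and eq: "(\<Sum>x\<in>P t. f x) - (\<Sum>x\<in>P s. f x) = (LINT r:{s..t}|lborel. g r)"
    using transport[OF f(1)] st by blast
  have L: "norm (Df x) \<le> L" for x using f(2) by (auto simp: test_fun_def)
  then have "0 \<le> L" using norm_ge_zero[of "Df 0"] by (metis order_trans)
  have sub: "{s..t} \<subseteq> {0<..<T}" using st by (intro Icc_subset)
  have gi: "set_integrable lborel {s..t} g"
    by (rule set_integrable_subset[OF g(1)]) (use sub in auto)
  have "\<bar>LINT r:{s..t}|lborel. g r\<bar> \<le> (LINT r:{s..t}|lborel. L * w r)"
  proof (rule abs_set_integral_le[OF gi])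
    show "set_integrable lborel {s..t} (\<lambda>r. L * w r)"
      by (intro integrable_imp_set_integrable integrable_mult_right w_integrable) auto
    show "AE r\<in>{s..t} in lborel. \<bar>g r\<bar> \<le> L * w r"
      using G(2)
    proof eventually_elim
      case (elim r)
      show ?case
      proof
        assume r: "r \<in> {s..t}"
        then have rG: "r \<in> G" using elim sub by auto
        have "\<bar>g r\<bar> \<le> (\<Sum>x\<in>P r. \<bar>Df x \<bullet> v r x\<bar>)" unfolding g(2)[OF rG] by (rule sum_abs)
        also have "\<dots> \<le> (\<Sum>x\<in>P r. L * norm (v r x))"
          by (intro sum_mono order_trans[OF Cauchy_Schwarz_ineq2] mult_right_mono L) auto
        also have "\<dots> \<le> L * H r"
          unfolding sum_distrib_left[symmetric] using \<open>0 \<le> L\<close> H(2)[OF rG] by (rule mult_left_mono[rotated])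
        also have "\<dots> \<le> L * w r"
          using \<open>0 \<le> L\<close> r sub by (intro mult_left_mono) (auto simp: w_def)
        finally show "\<bar>g r\<bar> \<le> L * w r" .
      qed
    qed
  qed
  also have "\<dots> = L * (U t - U s)" using U_diff[of s t] st by simp
  finally show ?thesis using eq by simp
qed

text \<open>A cluster function of radius \<open>R\<close> has Lipschitz constant at most \<open>32 * N / R\<close>. So its sum over
  the particles changes by less than \<open>1\<close> between \<open>s\<close> and \<open>t\<close> as soon as \<open>R\<close> is larger than
  \<open>32 * N\<close> times the increment of \<open>U\<close>, and the displacement is then at most \<open>3 * R\<close>. A factor
  \<open>N + 1\<close> keeps \<open>R\<close> positive when there is no particle.\<close>

lemma matching:
  assumes st: "s \<in> G" "t \<in> G" "s < t"
  shows "\<exists>h. bij_betw h (P s) (P t) \<and> (\<forall>x\<in>P s. dist x (h x) \<le> K * U t - K * U s)"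
proof -
  have pos: "0 < U t - U s" using U_strict[of s t] st subsetD[OF G(1)] by auto
  then have "32 * (real N + 1) * (U t - U s) < 33 * (real N + 1) * (U t - U s)" by simp
  then obtain R where R: "R \<in> \<rat>" "32 * (real N + 1) * (U t - U s) < R" "R < 33 * (real N + 1) * (U t - U s)"
    using Rats_dense_in_real by blast
  have "0 < 32 * (real N + 1) * (U t - U s)" using pos by simp
  with R(2) have "0 < R" by linarith
  have "\<exists>h. bij_betw h (P s) (P t) \<and> (\<forall>x\<in>P s. dist x (h x) \<le> 3 * R)"
  proof (rule bij_betw_by_cluster_transport[where D=D])
    fix S assume S: "finite S" "S \<subseteq> D" "card S \<le> card (P s)"
    have "(cluster S R, cluster_grad S R) \<in> tests D"
      using S R \<open>0 < R\<close> by (auto simp: tests_def)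
    from test_increment_bound[OF this test_fun_cluster[OF S(1) \<open>0 < R\<close>] st]
    have "(\<Sum>x\<in>P s. cluster S R x) - (\<Sum>y\<in>P t. cluster S R y) \<le> 32 * card S / R * (U t - U s)"
      by linarith
    also have "\<dots> \<le> 32 * (real N + 1) / R * (U t - U s)"
      using S(3) P(2)[OF st(1)] \<open>0 < R\<close> pos by (intro mult_right_mono divide_right_mono) auto
    also have "\<dots> < 1" using R(2) \<open>0 < R\<close> by (simp add: field_simps)
    finally show "(\<Sum>x\<in>P s. cluster S R x) - (\<Sum>y\<in>P t. cluster S R y) < 1" .
  qed (use st P D \<open>0 < R\<close> in auto)
  moreover have "3 * R \<le> K * U t - K * U s"
    using R(3) by (simp add: K_def algebra_simps)
  ultimately show ?thesis by force
qed

lemma curves_exist: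
  "\<exists>\<gamma>. (\<forall>i<N. continuous_on {0..T} (\<gamma> i) \<and> \<gamma> i \<in> AC T) \<and> (\<forall>t\<in>G. bij_betw (\<lambda>i. \<gamma> i t) {..<N} (P t))"
proof -
  obtain c where c: "\<And>t. t \<in> G \<Longrightarrow> bij_betw (c t) {..<N} (P t)"
    "\<And>s t i. s \<in> G \<Longrightarrow> t \<in> G \<Longrightarrow> s < t \<Longrightarrow> i < N \<Longrightarrow> dist (c s i) (c t i) \<le> K * U t - K * U s"
    using compatible_enumerations[of G P N "\<lambda>t. K * U t"] P matching by metis
  have Uc: "continuous_on {0..T} (\<lambda>t. K * U t)"
    using indefinite_integral_continuous[OF w_integrable]
    by (auto simp: U_def[abs_def] intro!: continuous_intros intro: continuous_on_subset)
  have "\<forall>i. \<exists>\<gamma>. i < N \<longrightarrow> continuous_on {0..T} \<gamma> \<and> (\<forall>t\<in>G. \<gamma> t = c t i) \<and>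
      (\<forall>s\<in>{0..T}. \<forall>t\<in>{0..T}. dist (\<gamma> s) (\<gamma> t) \<le> \<bar>K * U t - K * U s\<bar>)"
  proof
    fix i
    have "G \<subseteq> {0..T}" using G(1) by auto
    from extend_controlled_curve[OF Uc this G_dense, of "\<lambda>t. c t i"] c(2)[of _ _ i]
    show "\<exists>\<gamma>. i < N \<longrightarrow> continuous_on {0..T} \<gamma> \<and> (\<forall>t\<in>G. \<gamma> t = c t i) \<and>
      (\<forall>s\<in>{0..T}. \<forall>t\<in>{0..T}. dist (\<gamma> s) (\<gamma> t) \<le> \<bar>K * U t - K * U s\<bar>)" by blast
  qed
  then obtain \<gamma> where \<gamma>: "\<And>i. i < N \<Longrightarrow> continuous_on {0..T} (\<gamma> i)" "\<And>i t. i < N \<Longrightarrow> t \<in> G \<Longrightarrow> \<gamma> i t = c t i"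
      "\<And>i s t. i < N \<Longrightarrow> s \<in> {0..T} \<Longrightarrow> t \<in> {0..T} \<Longrightarrow> dist (\<gamma> i s) (\<gamma> i t) \<le> \<bar>K * U t - K * U s\<bar>"
    by metis
  have "\<gamma> i \<in> AC T" if "i < N" for i
  proof (rule integral_control_AC[OF w_integrable w_nonneg, where C=K])
    show "0 \<le> K" by (simp add: K_def)
    fix s t :: real assume st: "0 \<le> s" "s \<le> t" "t \<le> T"
    have "dist (\<gamma> i s) (\<gamma> i t) \<le> \<bar>K * (U t - U s)\<bar>"
      using \<gamma>(3)[OF that, of s t] st by (simp add: right_diff_distrib)
    also have "\<dots> = K * (U t - U s)"
      using U_mono[of s t] st by (simp add: abs_mult K_def)
    finally show "dist (\<gamma> i s) (\<gamma> i t) \<le> K * (LINT r:{s..t}|lborel. w r)"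
      using U_diff[of s t] st by simp
  qed
  moreover have "bij_betw (\<lambda>i. \<gamma> i t) {..<N} (P t)" if "t \<in> G" for t
    using c(1)[OF that] \<gamma>(2)[OF _ that] by (subst bij_betw_cong[of _ _ "c t"]) auto
  ultimately show ?thesis using \<gamma>(1) by blast
qed

text \<open>By \<open>transport\<close>, the sum differs on \<open>G\<close> by a constant from an indefinite integral; both sides are
  continuous and \<open>G\<close> is dense, so they do on the whole interval.\<close>

lemma test_sum_derivative:
  assumes \<gamma>: "\<And>i. i < N \<Longrightarrow> continuous_on {0..T} (\<gamma> i)" "\<And>t. t \<in> G \<Longrightarrow> bij_betw (\<lambda>i. \<gamma> i t) {..<N} (P t)"
    and f: "(f, Df) \<in> tests D"
  shows "AE t in lborel. t \<in> {0<..<T} \<longrightarrow>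
    ((\<lambda>\<tau>. \<Sum>i<N. f (\<gamma> i \<tau>)) has_real_derivative (\<Sum>x\<in>P t. Df x \<bullet> v t x)) (at t)"
proof -
  obtain g where g: "set_integrable lborel {0<..<T} g" "\<And>t. t \<in> G \<Longrightarrow> g t = (\<Sum>x\<in>P t. Df x \<bullet> v t x)"
    and eq: "\<And>s t. s \<in> G \<Longrightarrow> t \<in> G \<Longrightarrow> s < t \<Longrightarrow> (\<Sum>x\<in>P t. f x) - (\<Sum>x\<in>P s. f x) = (LINT r:{s..t}|lborel. g r)"
    using transport[OF f] by blast
  define g0 where "g0 t = indicator {0<..<T} t * g t" for t
  have g0: "integrable lborel g0" using g(1) by (simp add: set_integrable_def g0_def[abs_def])
  define V where "V t = (LINT r:{..t}|lborel. g0 r)" for t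
  define F where "F t = (\<Sum>i<N. f (\<gamma> i t))" for t
  have FP: "F t = (\<Sum>x\<in>P t. f x)" if "t \<in> G" for t
    unfolding F_def using sum.reindex_bij_betw[OF \<gamma>(2)[OF that], of f] by simp
  have FV: "F t - V t = F s - V s" if "s \<in> G" "t \<in> G" "s < t" for s t
  proof -
    have "V t - V s = (LINT r:{s..t}|lborel. g0 r)"
      unfolding V_def using that by (intro set_integral_atMost_diff g0) auto
    also have "\<dots> = (LINT r:{s..t}|lborel. g r)"
      using subsetD[OF Icc_subset[OF that(1,2)]] by (intro set_lebesgue_integral_cong) (auto simp: g0_def)
    finally show ?thesis using eq[OF that] FP that by simp
  qed
  have cf: "continuous_on UNIV f"
    using tests_test_fun[OF f] C1_grad_continuous by (auto simp: test_fun_def)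
  have Fc: "continuous_on {0..T} F"
    unfolding F_def[abs_def] using \<gamma>(1) by (intro continuous_on_sum continuous_on_compose2[OF cf]) auto
  have Vc: "continuous_on {0..T} V"
    using indefinite_integral_continuous[OF g0] unfolding V_def[abs_def] by (rule continuous_on_subset) simp
  obtain s where s: "s \<in> G"
    using G_dense T by (cases "G = {}") auto
  have cl: "closure G = {0..T}"
    using G(1) by (intro antisym G_dense closure_minimal) auto
  have const: "F t = (F s - V s) + V t" if "t \<in> {0..T}" for t
  proof -
    have "F t - V t = F s - V s"
    proof (rule continuous_constant_on_closure[of G "\<lambda>t. F t - V t"])
      show "continuous_on (closure G) (\<lambda>t. F t - V t)" unfolding cl by (intro continuous_intros Fc Vc)
      show "F t - V t = F s - V s" if "t \<in> G" for t
        using FV[OF s that] FV[OF that s] by (cases s t rule: linorder_cases) auto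
    qed (use that cl in simp)
    then show ?thesis by simp
  qed
  have "AE t in lborel. (V has_real_derivative g0 t) (at t)"
    unfolding V_def[abs_def] by (rule indefinite_integral_has_derivative_AE[OF g0])
  with G(2) show ?thesis
  proof eventually_elim
    case (elim t)
    show ?case
    proof
      assume t: "t \<in> {0<..<T}"
      have "((\<lambda>t. (F s - V s) + V t) has_real_derivative g0 t) (at t)"
        using elim(2) by (auto intro!: derivative_eq_intros)
      moreover have "g0 t = (\<Sum>x\<in>P t. Df x \<bullet> v t x)" using elim(1) t g(2) by (simp add: g0_def)
      ultimately have "(F has_real_derivative (\<Sum>x\<in>P t. Df x \<bullet> v t x)) (at t)"
        using has_field_derivative_transform_within_open[of _ _ t "{0<..<T}" F] const t by fastforce
      then show "((\<lambda>\<tau>. \<Sum>i<N. f (\<gamma> i \<tau>)) has_real_derivative (\<Sum>x\<in>P t. Df x \<bullet> v t x)) (at t)"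
        by (simp add: F_def[abs_def])
    qed
  qed
qed

text \<open>At a time in \<open>G\<close> the particles are separated. A coordinate function cut off in a ball that
  contains only particle \<open>i\<close> turns the sum over the particles, for all nearby times, into one
  coordinate of that particle.\<close>

lemma curves_velocity:
  assumes \<gamma>: "\<And>i. i < N \<Longrightarrow> continuous_on {0..T} (\<gamma> i)" "\<And>t. t \<in> G \<Longrightarrow> bij_betw (\<lambda>i. \<gamma> i t) {..<N} (P t)"
  shows "AE t in lborel. t \<in> {0<..<T} \<longrightarrow> (\<forall>i<N. (\<gamma> i has_vector_derivative v t (\<gamma> i t)) (at t))"
proof -
  have "AE t in lborel. \<forall>q\<in>tests D. t \<in> {0<..<T} \<longrightarrow>
    ((\<lambda>\<tau>. \<Sum>i<N. fst q (\<gamma> i \<tau>)) has_real_derivative (\<Sum>x\<in>P t. snd q x \<bullet> v t x)) (at t)"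
    unfolding AE_ball_countable[OF countable_tests[OF D(1)]]
    using test_sum_derivative[OF \<gamma>] by auto
  with G(2) show ?thesis
  proof eventually_elim
    case (elim t)
    show ?case
    proof (intro impI allI)
      fix i assume t: "t \<in> {0<..<T}" and i: "i < N"
      then have tG: "t \<in> G" using elim(1) by simp
      note bij = \<gamma>(2)[OF tG]
      have iP: "\<gamma> i t \<in> P t" using bij i by (auto simp: bij_betw_def)
      obtain \<delta> where \<delta>: "\<delta> > 0" "\<And>x. x \<in> P t \<Longrightarrow> x \<noteq> \<gamma> i t \<Longrightarrow> \<delta> \<le> dist (\<gamma> i t) x"
        using finite_set_avoid[OF P(1)[OF tG], of "\<gamma> i t"] by blast
      \<comment> \<open>other particles stay at distance at least \<open>4 * R - R\<close> from the centre, which is beyond \<open>2 * R\<close>\<close>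
      obtain R where R: "R \<in> \<rat>" "0 < R" "R < \<delta> / 4"
        using Rats_dense_in_real[of 0 "\<delta> / 4"] \<delta>(1) by auto
      obtain p where p: "p \<in> D" "dist p (\<gamma> i t) < R / 2" using D(2)[of "R / 2"] R by auto
      have far: "4 * R \<le> dist (\<gamma> i t) (\<gamma> j t)" if "j < N" "j \<noteq> i" for j
      proof -
        have "\<gamma> j t \<in> P t" "\<gamma> j t \<noteq> \<gamma> i t" using bij that i by (auto simp: bij_betw_def inj_on_def)
        from \<delta>(2)[OF this] show ?thesis using R(3) by simp
      qed
      have isc: "isCont (\<gamma> j) t" if "j < N" for j
        using continuous_on_interior[OF \<gamma>(1)[OF that], of t] t by simp
      have "\<forall>\<^sub>F \<tau> in at t. \<forall>j\<in>{..<N}. dist (\<gamma> j \<tau>) (\<gamma> j t) < R / 2"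
        using isc R(2) by (intro eventually_ball_finite ballI tendstoD) (auto simp: isCont_def)
      then have near: "\<forall>\<^sub>F \<tau> in nhds t. \<forall>j\<in>{..<N}. dist (\<gamma> j \<tau>) (\<gamma> j t) < R / 2"
        using R(2) by (auto simp: eventually_at_filter elim!: eventually_mono)
      have pj: "2 * R \<le> dist y p" if "j < N" "j \<noteq> i" "dist y (\<gamma> j t) < R / 2" for j y
        using far[OF that(1,2)] that(3) p(2) dist_triangle[of "\<gamma> i t" "\<gamma> j t" p]
          dist_triangle[of "\<gamma> j t" p y] R(2) by (auto simp: dist_commute)
      have component: "((\<lambda>\<tau>. \<gamma> i \<tau> \<bullet> e) has_real_derivative v t (\<gamma> i t) \<bullet> e) (at t)" if e: "e \<in> Basis" for e
      proof -
        let ?f = "coord_bump e p R" and ?Df = "coord_bump_grad e p R"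
        have "(?f, ?Df) \<in> tests D" 
          unfolding tests_def by (rule UnI2, rule image_eqI[where x="(e, p, R)"]) (use e p R in auto)
        then have der: "((\<lambda>\<tau>. \<Sum>j<N. ?f (\<gamma> j \<tau>)) has_real_derivative (\<Sum>x\<in>P t. ?Df x \<bullet> v t x)) (at t)"
          using elim(2) t by force
        have "\<forall>\<^sub>F \<tau> in nhds t. (\<Sum>j<N. ?f (\<gamma> j \<tau>)) = \<gamma> i \<tau> \<bullet> e"
          using near
        proof eventually_elim
          case (elim \<tau>)
          have "(\<Sum>j<N. ?f (\<gamma> j \<tau>)) = (\<Sum>j\<in>{i}. ?f (\<gamma> j \<tau>))"
            using i elim pj R(2) by (intro sum.mono_neutral_right) (auto intro!: coord_bump_eq_0)
          moreover have "dist (\<gamma> i \<tau>) p \<le> R"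
            using bspec[OF elim, of i] i p(2) dist_triangle[of "\<gamma> i \<tau>" p "\<gamma> i t"] by (simp add: dist_commute)
          ultimately show ?case using coord_bump_inside[OF R(2)] by simp
        qed
        from DERIV_cong_ev[OF refl this refl] der
        have "((\<lambda>\<tau>. \<gamma> i \<tau> \<bullet> e) has_real_derivative (\<Sum>x\<in>P t. ?Df x \<bullet> v t x)) (at t)" by simp
        moreover have "(\<Sum>x\<in>P t. ?Df x \<bullet> v t x) = v t (\<gamma> i t) \<bullet> e"
        proof -
          have "(\<Sum>x\<in>P t. ?Df x \<bullet> v t x) = (\<Sum>j<N. ?Df (\<gamma> j t) \<bullet> v t (\<gamma> j t))"
            using sum.reindex_bij_betw[OF bij, of "\<lambda>x. ?Df x \<bullet> v t x"] by simp
          also have "\<dots> = (\<Sum>j\<in>{i}. ?Df (\<gamma> j t) \<bullet> v t (\<gamma> j t))"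
          proof (intro sum.mono_neutral_right ballI)
            fix j assume j: "j \<in> {..<N} - {i}"
            then have "2 * R \<le> dist (\<gamma> j t) p" using R(2) by (intro pj) auto
            then show "?Df (\<gamma> j t) \<bullet> v t (\<gamma> j t) = 0"
              by (simp add: coord_bump_eq_0(2)[OF R(2)])
          qed (use i in auto)
          also have "\<dots> = v t (\<gamma> i t) \<bullet> e"
            using coord_bump_inside(2)[OF R(2), of "\<gamma> i t" p e] p(2) R(2) by (simp add: dist_commute inner_commute)
          finally show ?thesis .
        qed
        ultimately show ?thesis by simp
      qed
      show "(\<gamma> i has_vector_derivative v t (\<gamma> i t)) (at t)"
        unfolding has_vector_derivative_def has_derivative_componentwise_within[of "\<gamma> i"]
        using component by (auto simp: has_field_derivative_def mult_commute_abs)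
    qed
  qed
qed

end

section \<open>Atoms of solutions\<close>

lemma C1_Rk_coordinate: "C1_Rk 1 (\<lambda>y. y 0)"
  and partial_coordinate: "partial 0 (\<lambda>y. y 0) y = 1"
proof -
  have 1: "partial 0 (\<lambda>y. y 0) y = 1" for y
    by (simp add: partial_def)
  then show "partial 0 (\<lambda>y. y 0) y = 1" .
  have "continuous_map (Euclidean_space 1) euclideanreal (\<lambda>y. y 0)"
    unfolding Euclidean_space_def
    by (intro continuous_map_from_subtopology continuous_map_product_projection) simp
  moreover have "partial 0 (\<lambda>y. y 0) = (\<lambda>_. 1)"
    using 1 by blast
  ultimately show "C1_Rk 1 (\<lambda>y. y 0)"
    by (simp add: C1_Rk_def)
qed

lemma finite_heavy_atoms:
  assumes "prob_space M" "sets M = sets borel" and "0 < (e::real)"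
  shows "finite {x::'a::euclidean_space. e \<le> measure M {x}}"
proof -
  interpret prob_space M by fact
  have "finite {x. e \<le> measure M {x}} \<and> card {x. e \<le> measure M {x}} \<le> nat \<lceil>1 / e\<rceil>"
  proof (rule finite_if_finite_subsets_card_bdd)
    fix A assume A: "A \<subseteq> {x. e \<le> measure M {x}}" "finite A"
    have "e * card A = (\<Sum>x\<in>A. e)" by simp
    also have "\<dots> \<le> (\<Sum>x\<in>A. measure M {x})" using A by (intro sum_mono) auto
    also have "\<dots> = measure M A"
      using A(2) assms(2) by (intro finite_measure_eq_sum_singleton[symmetric]) auto
    also have "\<dots> \<le> 1" by simp
    finally have "real (card A) \<le> 1 / e" using \<open>0 < e\<close> by (simp add: field_simps)
    then show "card A \<le> nat \<lceil>1 / e\<rceil>" by linarith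
  qed
  then show ?thesis ..
qed

text \<open>Masses below \<open>a / 2\<close> are avoided because \<open>r < a / 8\<close>, the finitely many others because \<open>r\<close> is at
  most a third of their distance to \<open>a\<close>.\<close>

lemma isolating_bump:
  assumes a: "0 < (a::real)" and fin: "finite (F \<inter> {a / 2..})"
  obtains c r where "c \<in> \<rat>" "r \<in> \<rat>" "0 < r" "2 * r < c" "bump c r a = 1" "\<And>b. b \<in> F \<Longrightarrow> b \<noteq> a \<Longrightarrow> bump c r b = 0"
proof -
  obtain \<delta> where \<delta>: "\<delta> > 0" "\<And>b. b \<in> F \<inter> {a / 2..} \<Longrightarrow> b \<noteq> a \<Longrightarrow> \<delta> \<le> dist a b"
    using finite_set_avoid[OF fin, of a] by blast
  obtain r where r: "r \<in> \<rat>" "0 < r" "r < min (\<delta> / 3) (a / 8)"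
    using Rats_dense_in_real[of 0 "min (\<delta> / 3) (a / 8)"] \<delta>(1) a by auto
  obtain c where c: "c \<in> \<rat>" "a < c" "c < a + r" using Rats_dense_in_real[of a "a + r"] r by auto
  show thesis
  proof
    show "c \<in> \<rat>" "r \<in> \<rat>" "0 < r" "2 * r < c" using c r by auto
    show "bump c r a = 1" using c r by (intro bump_eq_1) (auto simp: dist_real_def)
    show "bump c r b = 0" if "b \<in> F" "b \<noteq> a" for b
    proof (rule bump_eq_0[OF \<open>0 < r\<close>])
      show "2 * r \<le> dist b c"
        using \<delta>(2)[of b] that c r by (cases "a / 2 \<le> b") (auto simp: dist_real_def)
    qed
  qed
qed

text \<open>The motion of the atoms is studied first, whether or not they carry all of the mass.\<close>

locale GC_solution =
  fixes T :: real and \<mu> :: "real \<Rightarrow> 'a::euclidean_space measure" and v :: "real \<Rightarrow> 'a \<Rightarrow> 'a"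
  assumes T: "0 < T"
    and \<mu>: "continuous_map (top_of_set {0..T}) narrow_topology \<mu>"
    and v: "(\<lambda>(t, x). v t x) \<in> borel_measurable (restrict_space borel ({0..T} \<times> UNIV))"
    and v_finite: "(\<integral>\<^sup>+ t\<in>{0..T}. (\<integral>\<^sup>+ x. ennreal (norm (v t x)) \<partial>\<mu> t) \<partial>lborel) < \<infinity>"
    and CE: "CE_GC T \<mu> v"
begin

definition H :: "real \<Rightarrow> real" where
  "H t = (\<integral>x. norm (v t x) \<partial>\<mu> t)"

definition level :: "real \<Rightarrow> real \<Rightarrow> 'a set" where
  "level a t = {x. measure (\<mu> t) {x} = a}"

lemmas kernel = kernel_norm_integrable[OF \<mu> v v_finite, folded H_def]

lemma \<mu>_prob: "t \<in> {0..T} \<Longrightarrow> prob_space (\<mu> t)" "t \<in> {0..T} \<Longrightarrow> sets (\<mu> t) = sets borel"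
  using \<mu> by (auto simp: continuous_map_narrow_topology_iff space_prob_algebra)

lemma mass_le_1: "t \<in> {0..T} \<Longrightarrow> measure (\<mu> t) A \<le> 1"
  using prob_space.prob_le_1[OF \<mu>_prob(1)] .

lemma finite_level: "t \<in> {0..T} \<Longrightarrow> 0 < a \<Longrightarrow> finite (level a t)"
  using finite_heavy_atoms[OF \<mu>_prob, of t a] by (rule finite_subset[rotated]) (auto simp: level_def)

lemma finite_masses: "t \<in> {0..T} \<Longrightarrow> 0 < a \<Longrightarrow> finite (range (\<lambda>x. measure (\<mu> t) {x}) \<inter> {a..})"
  using finite_imageI[OF finite_heavy_atoms[OF \<mu>_prob, of t a], of "\<lambda>x. measure (\<mu> t) {x}"]
  by (rule finite_subset[rotated]) auto

lemma velocity_integral_bound: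
  assumes int: "integrable (\<mu> t) (v t)" and L: "\<And>x. norm (E x) \<le> L" and k: "\<And>x. 0 \<le> k x" "\<And>x. k x \<le> 1"
  shows "\<bar>\<integral>x. (E x \<bullet> v t x) * k x \<partial>\<mu> t\<bar> \<le> L * H t"
proof -
  have "0 \<le> L" using L[of 0] norm_ge_zero[of "E 0"] by linarith
  have "\<bar>\<integral>x. (E x \<bullet> v t x) * k x \<partial>\<mu> t\<bar> \<le> (\<integral>x. \<bar>(E x \<bullet> v t x) * k x\<bar> \<partial>\<mu> t)"
    by (rule integral_abs_bound)
  also have "\<dots> \<le> (\<integral>x. L * norm (v t x) \<partial>\<mu> t)"
  proof (rule integral_mono')
    fix x
    have "\<bar>(E x \<bullet> v t x) * k x\<bar> \<le> (L * norm (v t x)) * 1"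
      unfolding abs_mult using k[of x] \<open>0 \<le> L\<close>
      by (intro mult_mono order_trans[OF Cauchy_Schwarz_ineq2] mult_right_mono L) auto
    then show "\<bar>(E x \<bullet> v t x) * k x\<bar> \<le> L * norm (v t x)" by simp
  qed (use int \<open>0 \<le> L\<close> in auto)
  finally show ?thesis by (simp add: H_def)
qed

text \<open>The continuity equation for the test function \<open>f x * \<zeta> m\<close>, integrated between times of \<open>G\<close>.\<close>

definition increments :: "real set \<Rightarrow> ('a \<Rightarrow> real) \<Rightarrow> ('a \<Rightarrow> 'a) \<Rightarrow> (real \<Rightarrow> real) \<Rightarrow> (real \<Rightarrow> real) \<Rightarrow> bool" where
  "increments G f Df \<zeta> g \<longleftrightarrow> set_integrable lborel {0<..<T} g \<and>
     (\<forall>t\<in>G. g t = (\<integral>x. (Df x \<bullet> v t x) * \<zeta> (measure (\<mu> t) {x}) \<partial>\<mu> t)) \<and>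
     (\<forall>s\<in>G. \<forall>t\<in>G. s < t \<longrightarrow>
        (\<integral>x. f x * \<zeta> (measure (\<mu> t) {x}) \<partial>\<mu> t) - (\<integral>x. f x * \<zeta> (measure (\<mu> s) {x}) \<partial>\<mu> s)
          = (LINT r:{s..t}|lborel. g r))"

lemma incrementsD:
  assumes "increments G f Df \<zeta> g"
  shows "set_integrable lborel {0<..<T} g"
    and "t \<in> G \<Longrightarrow> g t = (\<integral>x. (Df x \<bullet> v t x) * \<zeta> (measure (\<mu> t) {x}) \<partial>\<mu> t)"
    and "s \<in> G \<Longrightarrow> t \<in> G \<Longrightarrow> s < t \<Longrightarrow>
      (\<integral>x. f x * \<zeta> (measure (\<mu> t) {x}) \<partial>\<mu> t) - (\<integral>x. f x * \<zeta> (measure (\<mu> s) {x}) \<partial>\<mu> s)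
        = (LINT r:{s..t}|lborel. g r)"
  using assms by (simp_all add: increments_def)

text \<open>The generalized cylinder function \<open>M \<mapsto> \<integral>x. f x * \<zeta> (measure M {x}) \<partial>M\<close>, whose outer function is
  the coordinate on \<open>\<real>\<^sup>1\<close>. Its Wasserstein differential is \<open>\<zeta> (measure M {x}) *\<^sub>R Df x\<close>, because
  the mass is a parameter in it.\<close>

lemma GC_increments:
  assumes f: "test_fun f Df L" and \<zeta>: "C1_grad \<zeta> \<zeta>'" "0 < \<delta>" "\<And>m. m < \<delta> \<Longrightarrow> \<zeta> m = 0" "\<And>m. 0 \<le> \<zeta> m \<and> \<zeta> m \<le> 1"
  shows "\<exists>N\<in>null_sets lborel. \<exists>g. increments ({0<..<T} - N) f Df \<zeta> g"
proof -
  let ?\<Psi> = "\<lambda>y :: nat \<Rightarrow> real. y 0" and ?\<phi> = "\<lambda>_ :: nat. mass_product f \<zeta>"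
  define F where "F t = GC_fun 1 ?\<Psi> ?\<phi> (\<mu> t)" for t
  define g where "g t = (\<integral>x. GC_gradW 1 ?\<Psi> ?\<phi> x (\<mu> t) \<bullet> v t x \<partial>\<mu> t)" for t
  have "GC1c_rep 1 ?\<Psi> ?\<phi>"
    using mass_product_in_C1c[OF f \<zeta>(1-3)] C1_Rk_coordinate by (simp add: GC1c_rep_def)
  then have D: "has_distr_deriv T F g"
    using CE by (simp add: CE_GC_def F_def[abs_def] g_def[abs_def])
  have Feq: "F t = (\<integral>x. f x * \<zeta> (measure (\<mu> t) {x}) \<partial>\<mu> t)" if "t \<in> {0..T}" for t
    using mass_le_1[OF that] by (simp add: F_def GC_fun_def Lhat_vec_def Lhat_def mass_product_def)
  have grad: "grad (\<lambda>y. mass_product f \<zeta> (y, m)) x = \<zeta> m *\<^sub>R Df x" if "m \<le> 1" for m x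
  proof (rule grad_eqI)
    have "GDERIV (\<lambda>y. f y * \<zeta> m) x :> f x *\<^sub>R 0 + \<zeta> m *\<^sub>R Df x"
      using f by (intro GDERIV_mult GDERIV_const) (auto simp: test_fun_def C1_grad_def)
    then show "GDERIV (\<lambda>y. mass_product f \<zeta> (y, m)) x :> \<zeta> m *\<^sub>R Df x"
      using that by (simp add: mass_product_def)
  qed
  have geq: "g t = (\<integral>x. (Df x \<bullet> v t x) * \<zeta> (measure (\<mu> t) {x}) \<partial>\<mu> t)" if "t \<in> {0..T}" for t
    using mass_le_1[OF that] by (simp add: g_def GC_gradW_def partial_coordinate grad mult.commute)
  have loc: "set_integrable lborel K F" "set_integrable lborel K g" if "compact K" "K \<subseteq> {0<..<T}" for K
    using D that by (auto simp: has_distr_deriv_def)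
  have L: "norm (Df x) \<le> L" for x using f by (auto simp: test_fun_def)
  then have "0 \<le> L" using norm_ge_zero[of "Df 0"] by (metis order_trans)
  obtain M where M: "\<And>x. \<bar>f x\<bar> \<le> M" using test_fun_bounded[OF f] by blast
  then have "0 \<le> M" using abs_ge_zero[of "f 0"] by (metis order_trans)
  have Fb: "\<bar>F t\<bar> \<le> M" if t: "t \<in> {0..T}" for t
  proof -
    interpret prob_space "\<mu> t" using \<mu>_prob(1)[OF t] .
    have "\<bar>F t\<bar> \<le> (\<integral>x. \<bar>f x * \<zeta> (measure (\<mu> t) {x})\<bar> \<partial>\<mu> t)"
      unfolding Feq[OF t] by (rule integral_abs_bound)
    also have "\<dots> \<le> (\<integral>x. M \<partial>\<mu> t)"
    proof (rule integral_mono')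
      show "\<bar>f x * \<zeta> (measure (\<mu> t) {x})\<bar> \<le> M" for x
        using mult_mono[OF M[of x], of "\<bar>\<zeta> (measure (\<mu> t) {x})\<bar>" 1] \<zeta>(4)[of "measure (\<mu> t) {x}"] \<open>0 \<le> M\<close>
        by (simp add: abs_mult)
    qed (use \<open>0 \<le> M\<close> in auto)
    finally show ?thesis by (simp add: prob_space)
  qed
  have gb: "AE t in lborel. t \<in> {0<..<T} \<longrightarrow> \<bar>g t\<bar> \<le> L * H t"
    using kernel(2)
  proof eventually_elim
    case (elim t)
    show ?case
    proof
      assume t: "t \<in> {0<..<T}"
      then have int: "integrable (\<mu> t) (v t)" and t': "t \<in> {0..T}" using elim by auto
      show "\<bar>g t\<bar> \<le> L * H t"
        unfolding geq[OF t'] using \<zeta>(4) by (intro velocity_integral_bound int L) auto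
    qed
  qed
  have Fi: "set_integrable lborel {0<..<T} F"
    by (rule set_integrable_interval_dominated[OF loc(1), where w="\<lambda>_. M"])
       (use Fb T in \<open>auto simp: set_integrable_def\<close>)
  have gi: "set_integrable lborel {0<..<T} g"
    by (rule set_integrable_interval_dominated[OF loc(2) _ gb]) (use kernel(1) in auto)
  obtain N where N: "N \<in> null_sets lborel" "\<And>s t. s \<in> {0<..<T} - N \<Longrightarrow> t \<in> {0<..<T} - N \<Longrightarrow> s < t \<Longrightarrow>
      F t - F s = (LINT r:{s..t}|lborel. g r)"
    using distr_deriv_integral[OF D Fi gi] by blast
  have "increments ({0<..<T} - N) f Df \<zeta> g"
    unfolding increments_def using gi geq N(2) Feq by simp
  with N(1) show ?thesis by blast
qed

text \<open>A bump in mass that isolates \<open>a\<close> turns integrals into finite sums.\<close>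

lemma isolated_integral:
  assumes t: "t \<in> {0..T}" and a: "0 < a" and iso: "bump c r a = 1" "\<And>x. measure (\<mu> t) {x} \<noteq> a \<Longrightarrow> bump c r (measure (\<mu> t) {x}) = 0"
  shows "(\<integral>x. h x * bump c r (measure (\<mu> t) {x}) \<partial>\<mu> t) = a * (\<Sum>x\<in>level a t. h x)"
proof -
  interpret prob_space "\<mu> t" using \<mu>_prob(1)[OF t] .
  have "(\<integral>x. h x * bump c r (measure (\<mu> t) {x}) \<partial>\<mu> t) = (\<integral>x. h x * indicator (level a t) x \<partial>\<mu> t)"
    using iso by (intro Bochner_Integration.integral_cong) (auto simp: level_def indicator_def)
  also have "\<dots> = (\<Sum>x\<in>level a t. h x * measure (\<mu> t) {x})"
    using finite_level[OF t a] \<mu>_prob(2)[OF t] emeasure_finite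
    by (intro integral_indicator_finite_real) (auto simp: less_top[symmetric])
  also have "\<dots> = (\<Sum>x\<in>level a t. a * h x)"
    by (intro sum.cong) (auto simp: level_def)
  finally show ?thesis by (simp add: sum_distrib_left)
qed

text \<open>Centres and radii of bumps in the mass variable. The condition \<open>2 * r < c\<close> keeps their supports
  away from mass \<open>0\<close>.\<close>

definition mass_windows :: "(real \<times> real) set" where
  "mass_windows = {(c, r). c \<in> \<rat> \<and> r \<in> \<rat> \<and> 0 < r \<and> 2 * r < c}"

text \<open>\<open>G\<close> consists of times at which the integrated equation holds for all pairs of a test function
  in space and a bump in mass from the countable families.\<close>

definition good :: "'a set \<Rightarrow> real set \<Rightarrow> bool" where
  "good D G \<longleftrightarrow> G \<subseteq> {0<..<T} \<and> (\<forall>t\<in>G. integrable (\<mu> t) (v t)) \<and>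
     (\<forall>(f, Df)\<in>tests D. \<forall>(c, r)\<in>mass_windows. \<exists>g. increments G f Df (bump c r) g)"

lemma good_exists:
  assumes D: "countable D" and Q: "AE t in lborel. t \<in> {0<..<T} \<longrightarrow> Q t"
  shows "\<exists>G. good D G \<and> (\<forall>t\<in>G. Q t) \<and> (AE t in lborel. t \<in> {0<..<T} \<longrightarrow> t \<in> G)"
proof -
  define J where "J = tests D \<times> mass_windows"
  have "countable mass_windows"
    by (rule countable_subset[of _ "\<rat> \<times> \<rat>"]) (auto simp: mass_windows_def countable_rat)
  then have J: "countable J" unfolding J_def using countable_tests[OF D] by auto
  have "\<exists>N\<in>null_sets lborel. \<exists>g. increments ({0<..<T} - N) f Df (bump c r) g"
    if f: "(f, Df) \<in> tests D" and cr: "0 < r" "2 * r < c" for f Df and c r :: real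
  proof -
    obtain L where L: "test_fun f Df L" using tests_test_fun[OF f] by blast
    have z: "bump c r m = 0" if "m < c - 2 * r" for m
      using that cr by (intro bump_eq_0) (auto simp: dist_real_def)
    show ?thesis
      by (rule GC_increments[OF L C1_grad_bump[OF cr(1)], where \<delta>="c - 2 * r"])
         (use cr z bump_bounds[of c r] in auto)
  qed
  then have "\<forall>j\<in>J. \<exists>N. N \<in> null_sets lborel \<and>
      (\<exists>g. increments ({0<..<T} - N) (fst (fst j)) (snd (fst j)) (bump (fst (snd j)) (snd (snd j))) g)"
    by (force simp: J_def mass_windows_def)
  then obtain N where N: "\<And>j. j \<in> J \<Longrightarrow> N j \<in> null_sets lborel" "\<And>j. j \<in> J \<Longrightarrow>
      \<exists>g. increments ({0<..<T} - N j) (fst (fst j)) (snd (fst j)) (bump (fst (snd j)) (snd (snd j))) g"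
    by (metis (no_types, lifting))
  define G where "G = {t \<in> {0<..<T}. integrable (\<mu> t) (v t) \<and> Q t \<and> (\<forall>j\<in>J. t \<notin> N j)}"
  have "AE t in lborel. \<forall>j\<in>J. t \<notin> N j"
    unfolding AE_ball_countable[OF J] using N(1) by (auto intro: AE_not_in)
  with kernel(2) Q have "AE t in lborel. t \<in> {0<..<T} \<longrightarrow> t \<in> G"
    by eventually_elim (auto simp: G_def)
  moreover have "\<exists>g. increments G f Df (bump c r) g" if "(f, Df) \<in> tests D" "(c, r) \<in> mass_windows" for f Df c r
  proof -
    have jJ: "((f, Df), (c, r)) \<in> J" using that by (simp add: J_def)
    then have "G \<subseteq> {0<..<T} - N ((f, Df), (c, r))" by (auto simp: G_def)
    moreover obtain g where "increments ({0<..<T} - N ((f, Df), (c, r))) f Df (bump c r) g"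
      using N(2)[OF jJ] by auto
    ultimately have "increments G f Df (bump c r) g" unfolding increments_def by (simp add: subset_iff)
    then show ?thesis by (rule exI[where x=g])
  qed
  then have "good D G" by (auto simp: good_def G_def)
  moreover have "\<forall>t\<in>G. Q t" by (simp add: G_def)
  ultimately show ?thesis by blast
qed

lemma goodD:
  assumes "good D G" "(f, Df) \<in> tests D" "(c, r) \<in> mass_windows"
  obtains g where "increments G f Df (bump c r) g"
  using bspec[OF bspec[OF conjunct2[OF conjunct2[OF assms(1)[unfolded good_def]]] assms(2), unfolded prod.case]
      assms(3), unfolded prod.case] by (elim exE)

lemma isolating_window:
  assumes "t \<in> {0..T}" "s \<in> {0..T}" "0 < a"
  obtains c r where "(c, r) \<in> mass_windows" "bump c r a = 1"
    "\<And>x. measure (\<mu> t) {x} \<noteq> a \<Longrightarrow> bump c r (measure (\<mu> t) {x}) = 0"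
    "\<And>x. measure (\<mu> s) {x} \<noteq> a \<Longrightarrow> bump c r (measure (\<mu> s) {x}) = 0"
    "bump c r 0 = 0"
proof -
  let ?F = "insert 0 (range (\<lambda>x. measure (\<mu> t) {x}) \<union> range (\<lambda>x. measure (\<mu> s) {x}))"
  have "finite (?F \<inter> {a / 2..})"
    using finite_masses[OF assms(1), of "a / 2"] finite_masses[OF assms(2), of "a / 2"] assms(3)
    by (simp add: Int_insert_left Int_Un_distrib2)
  from isolating_bump[OF assms(3) this] obtain c r where
    cr: "c \<in> \<rat>" "r \<in> \<rat>" "0 < r" "2 * r < c" "bump c r a = 1" "\<And>b. b \<in> ?F \<Longrightarrow> b \<noteq> a \<Longrightarrow> bump c r b = 0" by blast
  show thesis
    by (rule that[of c r]) (use cr assms(3) in \<open>auto simp: mass_windows_def\<close>)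
qed

lemma good_integrable_H:
  "good D G \<Longrightarrow> s \<in> G \<Longrightarrow> t \<in> G \<Longrightarrow> {s..t} \<subseteq> {0<..<T} \<and> set_integrable lborel {s..t} H"
proof -
  assume "good D G" "s \<in> G" "t \<in> G"
  then have "s \<in> {0<..<T}" "t \<in> {0<..<T}" by (auto simp: good_def)
  then have sub: "{s..t} \<subseteq> {0<..<T}" by auto
  with set_integrable_subset[OF kernel(1) _ sub] show ?thesis by simp
qed

text \<open>The window may depend on \<open>s\<close> and \<open>t\<close>: only the masses at these two times have to be isolated,
  while at intermediate times the crude bound by the total speed is enough.\<close>

lemma level_increment_bound:
  assumes G: "good D G" "AE t in lborel. t \<in> {0<..<T} \<longrightarrow> t \<in> G"
    and f: "(f, Df) \<in> tests D" "test_fun f Df L" and st: "s \<in> G" "t \<in> G" "s < t" and a: "0 < a"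
  shows "a * \<bar>(\<Sum>x\<in>level a t. f x) - (\<Sum>x\<in>level a s. f x)\<bar> \<le> L * (LINT r:{s..t}|lborel. H r)"
proof -
  have st': "t \<in> {0..T}" "s \<in> {0..T}" using G(1) st by (auto simp: good_def)
  obtain c r where cr: "(c, r) \<in> mass_windows" "bump c r a = 1"
    "\<And>x. measure (\<mu> t) {x} \<noteq> a \<Longrightarrow> bump c r (measure (\<mu> t) {x}) = 0"
    "\<And>x. measure (\<mu> s) {x} \<noteq> a \<Longrightarrow> bump c r (measure (\<mu> s) {x}) = 0"
    by (rule isolating_window[OF st' a]) (rule that; assumption)
  obtain g where "increments G f Df (bump c r) g" by (rule goodD[OF G(1) f(1) cr(1)])
  note g = incrementsD[OF this]
  note sub = conjunct1[OF good_integrable_H[OF G(1) st(1,2)]] and Hi = conjunct2[OF good_integrable_H[OF G(1) st(1,2)]]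
  have gi: "set_integrable lborel {s..t} g" by (rule set_integrable_subset[OF g(1) _ sub]) simp
  have "a * \<bar>(\<Sum>x\<in>level a t. f x) - (\<Sum>x\<in>level a s. f x)\<bar> = \<bar>a * (\<Sum>x\<in>level a t. f x) - a * (\<Sum>x\<in>level a s. f x)\<bar>"
    using a unfolding right_diff_distrib[symmetric] abs_mult by simp
  also have "\<dots> = \<bar>LINT r:{s..t}|lborel. g r\<bar>"
    using g(3)[OF st] isolated_integral[OF st'(1) a cr(2,3), of f] isolated_integral[OF st'(2) a cr(2,4), of f] by simp
  also have "\<dots> \<le> (LINT r:{s..t}|lborel. L * H r)"
  proof (rule abs_set_integral_le[OF gi])
    show "set_integrable lborel {s..t} (\<lambda>r. L * H r)" using Hi by simp
    show "AE r\<in>{s..t} in lborel. \<bar>g r\<bar> \<le> L * H r"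
      using G(2)
    proof eventually_elim
      case (elim \<tau>)
      show ?case
      proof
        assume "\<tau> \<in> {s..t}"
        then have \<tau>: "\<tau> \<in> G" using sub elim by auto
        then have "integrable (\<mu> \<tau>) (v \<tau>)" using G(1) by (auto simp: good_def)
        then show "\<bar>g \<tau>\<bar> \<le> L * H \<tau>"
          unfolding g(2)[OF \<tau>] using f(2)
          by (intro velocity_integral_bound bump_bounds) (auto simp: test_fun_def)
      qed
    qed
  qed
  also have "\<dots> = L * (LINT r:{s..t}|lborel. H r)" by simp
  finally show ?thesis .
qed

text \<open>A cluster function of large radius is \<open>1\<close> on all the atoms in question and has small gradient.\<close>

lemma card_level_constant:
  assumes G: "good D G" "AE t in lborel. t \<in> {0<..<T} \<longrightarrow> t \<in> G" and D: "D \<noteq> {}"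
    and st: "s \<in> G" "t \<in> G" and a: "0 < a"
  shows "card (level a s) = card (level a t)"
proof -
  have less: "card (level a s) = card (level a t)" if st: "s \<in> G" "t \<in> G" "s < t" for s t
  proof -
    have st': "t \<in> {0..T}" "s \<in> {0..T}" using G(1) st by (auto simp: good_def)
    obtain d where d: "d \<in> D" using D by blast
    have fin: "finite (level a t \<union> level a s)" using finite_level[OF _ a] st' by auto
    obtain B where B: "\<And>x. x \<in> level a t \<union> level a s \<Longrightarrow> dist x d \<le> B"
      using finite_imp_bounded[OF fin] unfolding bounded_any_center[of _ d] by (auto simp: dist_commute)
    let ?h = "LINT r:{s..t}|lborel. H r"
    obtain n where n: "max (max B 0) (32 * ?h / a) < real n" using reals_Archimedean2 by blast
    then have n': "0 < real n" "B \<le> real n" "32 * ?h / a < real n" by auto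
    have "(cluster {d} (real n), cluster_grad {d} (real n)) \<in> tests D"
      unfolding tests_def by (rule UnI1, rule image_eqI[where x="({d}, real n)"]) (use d n' in auto)
    from level_increment_bound[OF G this test_fun_cluster st a] n'(1)
    have "a * \<bar>(\<Sum>x\<in>level a t. cluster {d} (real n) x) - (\<Sum>x\<in>level a s. cluster {d} (real n) x)\<bar> \<le> 32 / real n * ?h"
      by simp
    moreover have "cluster {d} (real n) x = 1" if "x \<in> level a t \<union> level a s" for x
      using B[OF that] n' by (intro cluster_eq_1[of _ d]) auto
    ultimately have "a * \<bar>real (card (level a t)) - real (card (level a s))\<bar> \<le> 32 / real n * ?h"
      by simp
    also have "\<dots> < a" using n' a by (simp add: field_simps)
    finally have "\<bar>real (card (level a t)) - real (card (level a s))\<bar> < 1" using a by simp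
    then show ?thesis by linarith
  qed
  consider "s < t" | "s = t" | "t < s" by linarith
  then show ?thesis
  proof cases
    case 1
    show ?thesis by (rule less[OF st 1])
  next
    case 3
    show ?thesis by (rule less[OF st(2,1) 3, symmetric])
  qed simp
qed

text \<open>Since the number of atoms of each mass is the same at all times of \<open>G\<close>, the masses that occur
  are the same as well. So a window that isolates \<open>a\<close> at the time \<open>t0\<close> isolates it at all of them.\<close>

lemma level_particle_system:
  assumes G: "good D G" "AE t in lborel. t \<in> {0<..<T} \<longrightarrow> t \<in> G"
    and D: "countable D" "\<And>x e. 0 < e \<Longrightarrow> \<exists>d\<in>D. dist d x < e"
    and t0: "t0 \<in> G" and a: "0 < a"
  shows "particle_system T G (level a) (card (level a t0)) v (\<lambda>t. H t / a) D"
proof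
  have sub: "t \<in> {0..T}" if "t \<in> G" for t using G(1) that by (auto simp: good_def)
  have "D \<noteq> {}" using D(2)[of 1] by auto
  note card = card_level_constant[OF G this]
  show "0 < T" by (rule T)
  show "G \<subseteq> {0<..<T}" using G(1) by (simp add: good_def)
  show "finite (level a t)" if "t \<in> G" for t using finite_level[OF sub[OF that] a] .
  show "card (level a t) = card (level a t0)" if "t \<in> G" for t using card[OF that t0 a] .
  show "set_integrable lborel {0<..<T} (\<lambda>t. H t / a)" using kernel(1) by simp
  obtain c r where cr: "(c, r) \<in> mass_windows" "bump c r a = 1"
    "\<And>x. measure (\<mu> t0) {x} \<noteq> a \<Longrightarrow> bump c r (measure (\<mu> t0) {x}) = 0" "bump c r 0 = 0"
    by (rule isolating_window[OF sub[OF t0] sub[OF t0] a]) (rule that; assumption)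
  have iso: "bump c r (measure (\<mu> t) {x}) = 0" if "t \<in> G" "measure (\<mu> t) {x} \<noteq> a" for t x
  proof (cases "measure (\<mu> t) {x} = 0")
    case False
    define m where "m = measure (\<mu> t) {x}"
    have m: "0 < m" using False unfolding m_def by (simp add: zero_less_measure_iff)
    have "x \<in> level m t" by (simp add: level_def m_def)
    then have "card (level m t) \<noteq> 0" using finite_level[OF sub[OF that(1)] m] by auto
    then have "card (level m t0) \<noteq> 0" using card[OF that(1) t0 m] by simp
    then obtain y where "y \<in> level m t0" by (metis card.empty ex_in_conv)
    then show ?thesis using cr(3)[of y] that(2) by (simp add: level_def m_def)
  qed (use cr in simp)
  note isolated = isolated_integral[OF sub a cr(2) iso]
  show "(\<Sum>x\<in>level a t. norm (v t x)) \<le> H t / a" if "t \<in> G" for t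
  proof -
    have "a * (\<Sum>x\<in>level a t. norm (v t x)) = (\<integral>x. norm (v t x) * bump c r (measure (\<mu> t) {x}) \<partial>\<mu> t)"
      using isolated[OF that that, of "\<lambda>x. norm (v t x)"] that by simp
    also have "\<dots> \<le> H t"
      unfolding H_def using G(1) that bump_bounds[of c r]
      by (intro integral_mono') (auto simp: good_def intro!: mult_left_le)
    finally show ?thesis using a by (simp add: field_simps)
  qed
  fix f Df assume f: "(f, Df) \<in> tests D"
  obtain g where "increments G f Df (bump c r) g" by (rule goodD[OF G(1) f cr(1)])
  note g = incrementsD[OF this]
  show "\<exists>g. set_integrable lborel {0<..<T} g \<and>
      (\<forall>t\<in>G. g t = (\<Sum>x\<in>level a t. Df x \<bullet> v t x)) \<and>
      (\<forall>s\<in>G. \<forall>t\<in>G. s < t \<longrightarrow> (\<Sum>x\<in>level a t. f x) - (\<Sum>x\<in>level a s. f x) = (LINT r:{s..t}|lborel. g r))"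
  proof (intro exI[of _ "\<lambda>t. g t / a"] conjI ballI impI)
    show "set_integrable lborel {0<..<T} (\<lambda>t. g t / a)" using g(1) by simp
    show "g t / a = (\<Sum>x\<in>level a t. Df x \<bullet> v t x)" if "t \<in> G" for t
      using g(2)[OF that] isolated[OF that that, of "\<lambda>x. Df x \<bullet> v t x"] a by simp
    show "(\<Sum>x\<in>level a t. f x) - (\<Sum>x\<in>level a s. f x) = (LINT r:{s..t}|lborel. g r / a)"
      if "s \<in> G" "t \<in> G" "s < t" for s t
      using g(3)[OF that] isolated[OF that(1) that(1), of f] isolated[OF that(2) that(2), of f] a
      by (simp add: field_simps)
  qed
qed (use assms in auto)

text \<open>Each \<open>x i\<close> of positive mass lies on exactly one of the curves for that mass at time \<open>t0\<close>.
  The other indices receive the constant curve, so that all curves are distinguished by their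
  position at \<open>t0\<close>.\<close>

lemma atom_curves:
  fixes x :: "nat \<Rightarrow> 'a"
  assumes G: "good D G" "AE t in lborel. t \<in> {0<..<T} \<longrightarrow> t \<in> G"
    and D: "countable D" "\<And>x e. 0 < e \<Longrightarrow> \<exists>d\<in>D. dist d x < e"
    and t0: "t0 \<in> G" and x: "inj x"
  shows "\<exists>c. (\<forall>i. continuous_on {0..T} (c i) \<and> c i t0 = x i) \<and>
    (\<forall>i. 0 < measure (\<mu> t0) {x i} \<longrightarrow> c i \<in> AC T \<and>
      (AE t in lborel. t \<in> {0<..<T} \<longrightarrow> (c i has_vector_derivative v t (c i t)) (at t)) \<and>
      (\<forall>t\<in>G. measure (\<mu> t) {c i t} = measure (\<mu> t0) {x i})) \<and>
    (\<forall>t\<in>G. inj_on (\<lambda>i. c i t) {i. 0 < measure (\<mu> t0) {x i}})"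
proof -
  define m where "m i = measure (\<mu> t0) {x i}" for i
  have "\<forall>a. \<exists>\<gamma>. 0 < a \<longrightarrow> (\<forall>i<card (level a t0). continuous_on {0..T} (\<gamma> i) \<and> \<gamma> i \<in> AC T) \<and>
      (\<forall>t\<in>G. bij_betw (\<lambda>i. \<gamma> i t) {..<card (level a t0)} (level a t))"
    using particle_system.curves_exist[OF level_particle_system[OF G D t0]] by blast
  then obtain \<gamma> where \<gamma>: "\<And>a i. 0 < a \<Longrightarrow> i < card (level a t0) \<Longrightarrow> continuous_on {0..T} (\<gamma> a i)"
      "\<And>a i. 0 < a \<Longrightarrow> i < card (level a t0) \<Longrightarrow> \<gamma> a i \<in> AC T"
      "\<And>a t. 0 < a \<Longrightarrow> t \<in> G \<Longrightarrow> bij_betw (\<lambda>i. \<gamma> a i t) {..<card (level a t0)} (level a t)"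
    by metis
  have vel: "AE t in lborel. t \<in> {0<..<T} \<longrightarrow> (\<forall>i<card (level a t0). (\<gamma> a i has_vector_derivative v t (\<gamma> a i t)) (at t))"
    if "0 < a" for a
    using particle_system.curves_velocity[OF level_particle_system[OF G D t0 that] \<gamma>(1,3)[OF that]] .
  have "\<exists>j<card (level (m i) t0). \<gamma> (m i) j t0 = x i" if "0 < m i" for i
  proof -
    have "x i \<in> level (m i) t0" by (simp add: level_def m_def)
    then have "x i \<in> (\<lambda>j. \<gamma> (m i) j t0) ` {..<card (level (m i) t0)}"
      using \<gamma>(3)[OF that t0] by (simp add: bij_betw_def)
    then show ?thesis by (metis imageE lessThan_iff)
  qed
  then obtain j where j: "\<And>i. 0 < m i \<Longrightarrow> j i < card (level (m i) t0)" "\<And>i. 0 < m i \<Longrightarrow> \<gamma> (m i) (j i) t0 = x i"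
    by metis
  define c where "c i = (if 0 < m i then \<gamma> (m i) (j i) else (\<lambda>_. x i))" for i
  have cl: "c i t \<in> level (m i) t" if "0 < m i" "t \<in> G" for i t
    using \<gamma>(3)[OF that] j[OF that(1)] that by (auto simp: c_def bij_betw_def)
  show ?thesis
    unfolding m_def[symmetric]
  proof (intro exI[of _ c] conjI allI impI ballI)
    show "continuous_on {0..T} (c i)" "c i t0 = x i" for i
      using \<gamma>(1) j by (auto simp: c_def)
    show "c i \<in> AC T" if "0 < m i" for i using \<gamma>(2)[OF that j(1)[OF that]] that by (simp add: c_def)
    show "AE t in lborel. t \<in> {0<..<T} \<longrightarrow> (c i has_vector_derivative v t (c i t)) (at t)" if "0 < m i" for i
      using vel[OF that] by eventually_elim (use j(1)[OF that] that in \<open>auto simp: c_def\<close>)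
    show "measure (\<mu> t) {c i t} = m i" if "0 < m i" "t \<in> G" for i t
      using cl[OF that] by (simp add: level_def)
    show "inj_on (\<lambda>i. c i t) {i. 0 < m i}" if "t \<in> G" for t
    proof (rule inj_onI)
      fix i k assume ik: "i \<in> {i. 0 < m i}" "k \<in> {i. 0 < m i}" and eq: "c i t = c k t"
      have "m i = m k" using cl[of i t] cl[of k t] ik eq \<open>t \<in> G\<close> by (simp add: level_def)
      moreover from this have "j i = j k"
        using \<gamma>(3)[of "m i" t] j(1)[of i] j(1)[of k] ik eq \<open>t \<in> G\<close> by (auto simp: c_def bij_betw_def inj_on_def)
      ultimately have "x i = x k" using j(2)[of i] j(2)[of k] ik by simp
      then show "i = k" using x by (simp add: inj_def)
    qed
  qed
qed

end

section \<open>Sorting the atoms of a measure\<close>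

lemma space_borel_of [simp]: "space (borel_of X) = topspace X"
  unfolding borel_of_def by (rule space_measure_of) (auto dest: openin_subset)

lemma openin_in_borel_of: "openin X U \<Longrightarrow> U \<in> sets (borel_of X)"
  unfolding borel_of_def by (intro in_measure_of) (auto dest: openin_subset)

lemma closedin_in_borel_of:
  assumes "closedin X C"
  shows "C \<in> sets (borel_of X)"
proof -
  have "topspace X - (topspace X - C) \<in> sets (borel_of X)"
    using sets.compl_sets[OF openin_in_borel_of, of X "topspace X - C"] assms
    by (simp add: openin_diff)
  then show ?thesis using closedin_subset[OF assms] by (simp add: double_diff)
qed

text \<open>Choose greedily a point of maximal value among those not chosen yet. Once the positive values
  are used up, any new point will do, as the type is infinite; if they are never used up, finiteness of
  the superlevel sets ensures that each of them is eventually reached.\<close>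

lemma exists_decreasing_enumeration:
  fixes f :: "'a \<Rightarrow> real"
  assumes inf: "infinite (UNIV :: 'a set)" and fin: "\<And>e. 0 < e \<Longrightarrow> finite {y. e \<le> f y}" and nn: "\<And>y. 0 \<le> f y"
  obtains x :: "nat \<Rightarrow> 'a" where "inj x" "decseq (\<lambda>n. f (x n))" "\<And>y. 0 < f y \<Longrightarrow> y \<in> range x"
proof -
  have "\<exists>x :: nat \<Rightarrow> 'a. \<forall>n. x n \<notin> x ` {..<n} \<and> (\<forall>y. y \<notin> x ` {..<n} \<longrightarrow> f y \<le> f (x n))"
  proof (rule dependent_wellorder_choice)
    fix n :: nat and x :: "nat \<Rightarrow> 'a"
    let ?F = "x ` {..<n}"
    show "\<exists>r. r \<notin> ?F \<and> (\<forall>y. y \<notin> ?F \<longrightarrow> f y \<le> f r)"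
    proof (cases "\<exists>y. y \<notin> ?F \<and> 0 < f y")
      case True
      then obtain y where y: "y \<notin> ?F" "0 < f y" by blast
      define A where "A = {z. f y \<le> f z} - ?F"
      have A: "finite A" "A \<noteq> {}" using fin[OF y(2)] y(1) by (auto simp: A_def)
      then have "Max (f ` A) \<in> f ` A" by (intro Max_in) auto
      then obtain r where r: "r \<in> A" "f r = Max (f ` A)" by auto
      have "f z \<le> f r" if "z \<notin> ?F" for z
      proof (cases "f y \<le> f z")
        case True
        then have "f z \<in> f ` A" using that by (auto simp: A_def)
        then show ?thesis using A(1) r(2) by simp
      next
        case False
        then show ?thesis using r(1) by (simp add: A_def)
      qed
      then show ?thesis using r(1) by (auto simp: A_def)
    next
      case False
      obtain r where "r \<notin> ?F" using ex_new_if_finite[OF inf, of ?F] by auto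
      then show ?thesis using False nn by (metis not_less order_trans)
    qed
  next
    fix r :: 'a and x y :: "nat \<Rightarrow> 'a" and n :: nat
    assume "\<And>i. i < n \<Longrightarrow> x i = y i"
    then have "x ` {..<n} = y ` {..<n}" by auto
    then show "(r \<notin> x ` {..<n} \<and> (\<forall>z. z \<notin> x ` {..<n} \<longrightarrow> f z \<le> f r)) =
      (r \<notin> y ` {..<n} \<and> (\<forall>z. z \<notin> y ` {..<n} \<longrightarrow> f z \<le> f r))" by simp
  qed
  then obtain x :: "nat \<Rightarrow> 'a" where x: "\<And>n. x n \<notin> x ` {..<n}" "\<And>n y. y \<notin> x ` {..<n} \<Longrightarrow> f y \<le> f (x n)"
    by blast
  have inj: "inj x"
  proof (rule linorder_injI)
    show "x i \<noteq> x j" if "i < j" for i j using x(1)[of j] that by (metis imageI lessThan_iff)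
  qed
  show thesis
  proof
    show "inj x" by fact
    have "f (x (Suc n)) \<le> f (x n)" for n
    proof (rule x(2))
      show "x (Suc n) \<notin> x ` {..<n}" by (simp add: inj_image_mem_iff[OF inj])
    qed
    then show "decseq (\<lambda>n. f (x n))" by (rule decseq_SucI)
    show "y \<in> range x" if "0 < f y" for y
    proof (rule ccontr)
      assume "y \<notin> range x"
      then have "f y \<le> f (x n)" for n by (intro x(2)) auto
      then have "range x \<subseteq> {z. f y \<le> f z}" by auto
      then have "finite (range x)" using fin[OF that] finite_subset by blast
      then show False using inj by (simp add: finite_image_iff)
    qed
  qed
qed

text \<open>A countable set of full measure carries the measure by its points; sorting the points by mass
  gives the form required by \<open>Ppa\<close>, whose enumeration has to be injective.\<close>

lemma countably_supported_in_Ppa: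
  fixes M :: "'a::euclidean_space measure"
  assumes M: "prob_space M" "sets M = sets borel" and S: "countable S" "emeasure M (- S) = 0"
  shows "M \<in> Ppa euclidean"
proof -
  interpret prob_space M by fact
  have inf: "infinite (UNIV :: 'a set)" using finite_imp_bounded not_bounded_UNIV by blast
  obtain x :: "nat \<Rightarrow> 'a" where x: "inj x" "decseq (\<lambda>n. measure M {x n})" "\<And>y. 0 < measure M {y} \<Longrightarrow> y \<in> range x"
    by (rule exists_decreasing_enumeration[of "\<lambda>y. measure M {y}"])
       (use finite_heavy_atoms[OF M] inf in auto)
  have range_sets: "range x \<in> sets M" using M(2) by (simp add: sets.countable)
  have Sb: "S \<in> sets M" using S(1) M(2) by (simp add: sets.countable)
  have null: "emeasure M (A - range x) = 0" if A: "A \<in> sets M" for A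
  proof -
    have rest: "S - range x \<in> null_sets M"
    proof -
      have "(\<Union>y\<in>S - range x. {y}) \<in> null_sets M"
      proof (rule null_sets_UN')
        show "countable (S - range x)" using S(1) by auto
        show "{y} \<in> null_sets M" if "y \<in> S - range x" for y
          using x(3)[of y] that M(2) by (auto simp: null_sets_def emeasure_eq_measure zero_less_measure_iff)
      qed
      then show ?thesis by simp
    qed
    have "- S \<in> null_sets M" using S(2) Sb M(2) by (auto simp: null_sets_def)
    then have "- S \<union> (S - range x) \<in> null_sets M" using rest by (rule null_sets.Un)
    then have "A - range x \<in> null_sets M"
      by (rule null_sets_subset[OF _ sets.Diff[OF A range_sets]]) blast
    then show ?thesis by (rule null_setsD1)
  qed
  have eq: "emeasure M A = (\<Sum>n. ennreal (measure M {x n}) * indicator A (x n))" if A: "A \<in> sets M" for A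
  proof -
    \<comment> \<open>the empty sets keep the family disjoint and indexed by all of \<open>nat\<close>\<close>
    define B where "B n = (if x n \<in> A then {x n} else {})" for n
    have "B n \<in> sets M" for n using M(2) by (simp add: B_def)
    then have B: "range B \<subseteq> sets M" by (rule image_subsetI)
    have "B i \<inter> B j = {}" if "i \<noteq> j" for i j
      using inj_eq[OF x(1), of i j] that by (simp add: B_def)
    then have "disjoint_family B" by (simp add: disjoint_family_on_def)
    from suminf_emeasure[OF B this] have "(\<Sum>n. emeasure M (B n)) = emeasure M (\<Union>n. B n)" .
    moreover have "emeasure M (B n) = ennreal (measure M {x n}) * indicator A (x n)" for n
      by (simp add: B_def emeasure_eq_measure)
    moreover have "(\<Union>n. B n) = A \<inter> range x" by (auto simp: B_def split: if_splits)
    moreover have "emeasure M A = emeasure M (A \<inter> range x)"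
    proof -
      have "emeasure M (A \<inter> range x) + emeasure M (A - range x) = emeasure M ((A \<inter> range x) \<union> (A - range x))"
        using A range_sets by (intro plus_emeasure sets.Int sets.Diff) auto
      moreover have "(A \<inter> range x) \<union> (A - range x) = A" by auto
      ultimately show ?thesis using null[OF A] by simp
    qed
    ultimately show ?thesis by simp
  qed
  have tot: "(\<Sum>n. ennreal (measure M {x n})) = 1"
  proof -
    have "space M = UNIV" using sets_eq_imp_space_eq[OF M(2)] by simp
    then have "emeasure M UNIV = 1" using emeasure_space_1 by simp
    moreover have "UNIV \<in> sets M" unfolding M(2) by simp
    ultimately show ?thesis using eq[of UNIV] by simp
  qed
  have summ: "summable (\<lambda>n. measure M {x n})"
    by (intro summable_suminf_not_top) (simp_all add: tot)
  have "ennreal (\<Sum>n. measure M {x n}) = 1"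
    using suminf_ennreal_eq[OF measure_nonneg summable_sums[OF summ]] unfolding tot by (rule sym)
  then have sums: "(\<lambda>n. measure M {x n}) sums 1"
    using summable_sums[OF summ] unfolding ennreal_eq_1 by simp
  show ?thesis
    unfolding Ppa_def borel_of_euclidean
  proof (intro CollectI conjI exI[of _ "\<lambda>n. measure M {x n}"] exI[of _ x] ballI allI)
    show "emeasure M A = (\<Sum>i. ennreal (measure M {x i}) * emeasure (return borel (x i)) A)"
      if "A \<in> sets M" for A
      using eq[OF that] that M(2) by simp
  qed (use M(2) x sums in auto)
qed

lemma Ppa_euclideanE:
  fixes M :: "'a::euclidean_space measure"
  assumes "M \<in> Ppa euclidean" "prob_space M"
  obtains a :: "nat \<Rightarrow> real" and x where "inj x" "\<And>i. 0 \<le> a i" "\<And>i. a i \<le> 1" "decseq a" "a sums 1"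
    "\<And>i. measure M {x i} = a i"
proof -
  obtain a :: "nat \<Rightarrow> real" and x where x: "inj x" "\<forall>i. 0 \<le> a i \<and> a i \<le> 1" "decseq a" "a sums 1"
    and M: "sets M = sets borel"
      "\<And>A. A \<in> sets M \<Longrightarrow> emeasure M A = (\<Sum>i. ennreal (a i) * emeasure (return borel (x i)) A)"
    using assms(1) unfolding Ppa_def borel_of_euclidean by auto
  interpret prob_space M by fact
  have "emeasure M {x k} = ennreal (a k)" for k
  proof -
    have "emeasure M {x k} = (\<Sum>i. ennreal (a i) * indicator {x k} (x i))"
      using M by simp
    also have "\<dots> = (\<Sum>i\<in>{k}. ennreal (a i) * indicator {x k} (x i))"
      using x(1) by (intro suminf_finite) (auto simp: inj_def indicator_def)
    finally show ?thesis by simp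
  qed
  then have "measure M {x k} = a k" for k using x(2) by (simp add: measure_def)
  then show thesis using that[of x a] x by blast
qed

section \<open>Measures carried by countably many curves\<close>

text \<open>The weights as a measure on the indices. Image measures of it avoid sums of Dirac measures.\<close>

definition index_measure :: "(nat \<Rightarrow> real) \<Rightarrow> nat measure" where
  "index_measure a = density (count_space UNIV) (\<lambda>i. ennreal (a i))"

lemma sets_index_measure [measurable_cong, simp]: "sets (index_measure a) = UNIV"
  and space_index_measure [simp]: "space (index_measure a) = UNIV"
  by (auto simp: index_measure_def)

lemma emeasure_distr_index_measure:
  assumes "y \<in> UNIV \<rightarrow> space N" "A \<in> sets N"
  shows "emeasure (distr (index_measure a) N y) A = (\<Sum>i. ennreal (a i) * indicator A (y i))"
proof -
  have y: "y \<in> index_measure a \<rightarrow>\<^sub>M N" using assms(1) by (auto simp: measurable_def)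
  have "emeasure (distr (index_measure a) N y) A = (\<integral>\<^sup>+i. ennreal (a i) * indicator (y -` A) i \<partial>count_space UNIV)"
    unfolding emeasure_distr[OF y assms(2)] by (simp add: index_measure_def emeasure_density)
  also have "\<dots> = (\<Sum>i. ennreal (a i) * indicator A (y i))"
    by (simp add: nn_integral_count_space_nat indicator_def vimage_def)
  finally show ?thesis .
qed

lemma prob_space_index_measure:
  assumes "\<And>i. 0 \<le> a i" "a sums 1"
  shows "prob_space (index_measure a)"
proof
  have "emeasure (index_measure a) UNIV = (\<Sum>i. ennreal (a i))"
    by (simp add: index_measure_def emeasure_density nn_integral_count_space_nat)
  then show "emeasure (index_measure a) (space (index_measure a)) = 1"
    using suminf_ennreal_eq[OF assms] by simp
qed

lemma distr_index_measure_in_Ppa: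
  assumes "inj y" "range y \<subseteq> topspace X" "\<And>i. 0 \<le> a i" "\<And>i. a i \<le> 1" "decseq a" "a sums 1"
  shows "distr (index_measure a) (borel_of X) y \<in> Ppa X"
  unfolding Ppa_def
proof (intro CollectI conjI exI[of _ a] exI[of _ y] ballI allI)
  fix A assume "A \<in> sets (distr (index_measure a) (borel_of X) y)"
  then have A: "A \<in> sets (borel_of X)" by simp
  show "emeasure (distr (index_measure a) (borel_of X) y) A
      = (\<Sum>i. ennreal (a i) * emeasure (return (borel_of X) (y i)) A)"
    using assms(2) A by (subst emeasure_distr_index_measure) auto
qed (use assms in auto)

lemma prob_measure_eqI_le:
  assumes M: "prob_space M" and N: "prob_space N" and sets: "sets M = sets N"
    and le: "\<And>A. A \<in> sets N \<Longrightarrow> emeasure M A \<le> emeasure N A"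
  shows "M = N"
proof (rule measure_eqI[OF sets])
  interpret M: prob_space M by fact
  interpret N: prob_space N by fact
  have space: "space M = space N" using sets by (rule sets_eq_imp_space_eq)
  fix A assume A: "A \<in> sets M"
  then have A': "A \<in> sets N" using sets by simp
  have "measure M A \<le> measure N A" "measure M (space N - A) \<le> measure N (space N - A)"
    using le[OF A'] le[of "space N - A"] A' by (auto simp: M.emeasure_eq_measure N.emeasure_eq_measure)
  moreover have "measure M (space N - A) = 1 - measure M A" "measure N (space N - A) = 1 - measure N A"
    using M.prob_compl[OF A] N.prob_compl[OF A'] space by auto
  ultimately show "emeasure M A = emeasure N A"
    by (simp add: M.emeasure_eq_measure N.emeasure_eq_measure)
qed

lemma topspace_curve_space:
  "topspace (curve_space T :: (real \<Rightarrow> 'a::metric_space) topology)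
    = {f. f \<in> extensional {0..T} \<and> continuous_on {0..T} f}"
proof -
  have "compactin (top_of_set {0..T}) (topspace (top_of_set {0..T}))"
    by (simp add: compactin_subtopology)
  from compactin_mspace_cfunspace[OF this, of "euclidean_metric :: 'a metric"] show ?thesis
    by (auto simp: curve_space_def)
qed

text \<open>Makes countable sets of curves measurable.\<close>

lemma closedin_curve_space_singleton:
  "\<gamma> \<in> topspace (curve_space T) \<Longrightarrow> closedin (curve_space T) {\<gamma>}"
  unfolding curve_space_def mtopology_of_def
  by (rule closedin_Hausdorff_singleton[OF Metric_space.Hausdorff_space_mtopology[OF Metric_space_mspace_mdist]])

lemma evaluation_measurable:
  assumes t: "t \<in> {0..T}"
  shows "(\<lambda>\<gamma>. \<gamma> t) \<in> borel_of (curve_space T) \<rightarrow>\<^sub>M (borel :: 'a::metric_space measure)"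
proof (rule borel_measurableI)
  fix S :: "'a set" assume S: "open S"
  let ?m = "cfunspace (top_of_set {0..T}) (euclidean_metric :: 'a metric)"
  have "Lipschitz_continuous_map ?m euclidean_metric (\<lambda>\<gamma>. \<gamma> t)"
    unfolding Lipschitz_continuous_map_def
  proof (intro conjI exI[of _ 1] ballI)
    show "mdist euclidean_metric (f t) (g t) \<le> 1 * mdist ?m f g" if "f \<in> mspace ?m" "g \<in> mspace ?m" for f g
      using mdist_cfunspace_imp_mdist_le[OF that order_refl, of t] t by simp
  qed auto
  from Lipschitz_continuous_imp_continuous_map[OF this]
  have "continuous_map (curve_space T) euclidean (\<lambda>\<gamma>. \<gamma> t :: 'a)" by (simp add: curve_space_def)
  then have "openin (curve_space T) {\<gamma> \<in> topspace (curve_space T). \<gamma> t \<in> S}"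
    using S by (intro openin_continuous_map_preimage[of _ euclidean]) auto
  then show "(\<lambda>\<gamma>. \<gamma> t) -` S \<inter> space (borel_of (curve_space T)) \<in> sets (borel_of (curve_space T))"
    by (intro openin_in_borel_of) (simp add: vimage_def Collect_conj_eq Int_commute)
qed

lemma AC_restrict:
  assumes "\<gamma> \<in> AC T"
  shows "restrict \<gamma> {0..T} \<in> AC T"
proof -
  have "(\<Sum>i<n. dist (restrict \<gamma> {0..T} (a i)) (restrict \<gamma> {0..T} (b i))) = (\<Sum>i<n. dist (\<gamma> (a i)) (\<gamma> (b i)))"
    if "\<forall>i<n. 0 \<le> a i \<and> a i \<le> b i \<and> b i \<le> T" for n :: nat and a b
  proof (rule sum.cong[OF refl])
    fix i assume "i \<in> {..<n}"
    then have "0 \<le> a i" "a i \<le> b i" "b i \<le> T" using that by auto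
    then show "dist (restrict \<gamma> {0..T} (a i)) (restrict \<gamma> {0..T} (b i)) = dist (\<gamma> (a i)) (\<gamma> (b i))" by simp
  qed
  then show ?thesis
    using assms unfolding AC_def mem_Collect_eq by (simp cong: imp_cong del: restrict_apply)
qed

text \<open>Pass to the limit along times in \<open>G\<close>: on the right by narrow continuity, on the left by
  dominated convergence over the indices.\<close>

lemma narrow_limit_of_curves:
  fixes \<mu> :: "real \<Rightarrow> 'a::euclidean_space measure" and c :: "nat \<Rightarrow> real \<Rightarrow> 'a"
  assumes \<mu>: "continuous_map (top_of_set {0..T}) narrow_topology \<mu>"
    and a: "\<And>i. 0 \<le> a i" "a sums 1" and c: "\<And>i. continuous_on {0..T} (c i)"
    and G: "G \<subseteq> {0..T}" "{0..T} \<subseteq> closure G" "\<And>t. t \<in> G \<Longrightarrow> distr (index_measure a) borel (\<lambda>i. c i t) = \<mu> t"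
    and t: "t \<in> {0..T}"
  shows "distr (index_measure a) borel (\<lambda>i. c i t) = \<mu> t"
proof (rule measure_eqI_bcontfun)
  interpret prob_space "index_measure a" by (rule prob_space_index_measure[OF a])
  have meas: "(\<lambda>i. c i s) \<in> index_measure a \<rightarrow>\<^sub>M borel" for s by (auto simp: measurable_def)
  show "distr (index_measure a) borel (\<lambda>i. c i t) \<in> space (prob_algebra borel)"
    using prob_space_distr[OF meas] by (simp add: space_prob_algebra)
  show "\<mu> t \<in> space (prob_algebra borel)" using \<mu> t by (simp add: continuous_map_narrow_topology_iff)
  fix \<phi> :: "'a \<Rightarrow>\<^sub>C real"
  have \<phi>: "continuous_on UNIV (apply_bcontfun \<phi>)" by (rule continuous_on_apply_bcontfun)
  have \<phi>m: "apply_bcontfun \<phi> \<in> borel_measurable borel" by (rule borel_measurable_continuous_onI[OF \<phi>])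
  have C: "continuous_on {0..T} (\<lambda>t. \<integral>x. apply_bcontfun \<phi> x \<partial>\<mu> t)"
    using \<mu> by (simp add: continuous_map_narrow_topology_iff)
  have int: "(\<integral>x. apply_bcontfun \<phi> x \<partial>distr (index_measure a) borel (\<lambda>i. c i s)) = (\<integral>i. apply_bcontfun \<phi> (c i s) \<partial>index_measure a)" for s
    by (rule integral_distr[OF meas \<phi>m])
  have "t \<in> closure G" using G t by auto
  then obtain u where u: "\<And>n. u n \<in> G" "u \<longlonglongrightarrow> t" unfolding closure_sequential by blast
  have uT: "u n \<in> {0..T}" for n using subsetD[OF G(1) u(1)] .
  have "(\<lambda>n. \<integral>i. apply_bcontfun \<phi> (c i (u n)) \<partial>index_measure a) \<longlonglongrightarrow> (\<integral>i. apply_bcontfun \<phi> (c i t) \<partial>index_measure a)"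
  proof (rule integral_dominated_convergence[where w="\<lambda>_. norm \<phi>"])
    show "AE i in index_measure a. (\<lambda>n. apply_bcontfun \<phi> (c i (u n))) \<longlonglongrightarrow> apply_bcontfun \<phi> (c i t)"
    proof (rule AE_I2)
      fix i
      have "(\<lambda>n. c i (u n)) \<longlonglongrightarrow> c i t"
        using uT by (intro continuous_on_tendsto_compose[OF c u(2) t]) auto
      then show "(\<lambda>n. apply_bcontfun \<phi> (c i (u n))) \<longlonglongrightarrow> apply_bcontfun \<phi> (c i t)"
        by (intro continuous_on_tendsto_compose[OF \<phi>]) auto
    qed
    show "AE i in index_measure a. norm (apply_bcontfun \<phi> (c i (u n))) \<le> norm \<phi>" for n
      by (intro AE_I2 norm_bounded)
  qed (auto simp: measurable_def)
  moreover have "(\<integral>i. apply_bcontfun \<phi> (c i (u n)) \<partial>index_measure a) = (\<integral>x. apply_bcontfun \<phi> x \<partial>\<mu> (u n))" for n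
    using int[of "u n"] G(3)[OF u(1)] by simp
  moreover have "(\<lambda>n. \<integral>x. apply_bcontfun \<phi> x \<partial>\<mu> (u n)) \<longlonglongrightarrow> (\<integral>x. apply_bcontfun \<phi> x \<partial>\<mu> t)"
    using uT by (intro continuous_on_tendsto_compose[OF C u(2) t]) auto
  ultimately show "(\<integral>x. apply_bcontfun \<phi> x \<partial>distr (index_measure a) borel (\<lambda>i. c i t)) = (\<integral>x. apply_bcontfun \<phi> x \<partial>\<mu> t)"
    unfolding int by (metis (lifting) LIMSEQ_unique ext)
qed

text \<open>Distinct atoms with total mass \<open>1\<close> leave no mass for anything else.\<close>

lemma atoms_exhaust:
  fixes M :: "'a::euclidean_space measure"
  assumes M: "prob_space M" "sets M = sets borel" and a: "\<And>i. 0 \<le> a i" "a sums 1"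
    and y: "\<And>i. 0 < a i \<Longrightarrow> measure M {y i} = a i" "inj_on y {i. 0 < a i}"
  shows "distr (index_measure a) borel y = M"
proof (rule prob_measure_eqI_le)
  interpret M: prob_space M by fact
  show "prob_space (distr (index_measure a) borel y)"
    by (rule prob_space.prob_space_distr[OF prob_space_index_measure[OF a]]) (auto simp: measurable_def)
  show "prob_space M" by fact
  show "sets (distr (index_measure a) borel y) = sets M" using M(2) by simp
  fix A assume A: "A \<in> sets M"
  have "(\<Sum>i. ennreal (a i) * indicator A (y i)) \<le> emeasure M A"
  proof (rule suminf_le_const)
    fix n
    define J where "J = {i. i < n \<and> 0 < a i \<and> y i \<in> A}"
    have J: "finite J" by (auto simp: J_def)
    have "(\<Sum>i<n. ennreal (a i) * indicator A (y i)) = (\<Sum>i\<in>J. ennreal (a i))"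
      using a(1) by (intro sum.mono_neutral_cong_right) (auto simp: J_def indicator_def less_le)
    also have "\<dots> = (\<Sum>i\<in>J. ennreal (measure M {y i}))"
      using y(1) by (intro sum.cong) (auto simp: J_def)
    also have "\<dots> = (\<Sum>z\<in>y ` J. ennreal (measure M {z}))"
      using y(2) by (subst sum.reindex) (auto simp: J_def inj_on_def)
    also have "\<dots> = ennreal (\<Sum>z\<in>y ` J. measure M {z})" by (rule sum_ennreal) simp
    also have "\<dots> = ennreal (measure M (y ` J))"
      using J M(2) by (subst M.finite_measure_eq_sum_singleton) auto
    also have "\<dots> \<le> emeasure M A"
      unfolding M.emeasure_eq_measure using A by (intro ennreal_leI M.finite_measure_mono) (auto simp: J_def)
    finally show "(\<Sum>i<n. ennreal (a i) * indicator A (y i)) \<le> emeasure M A" .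
  qed simp
  then show "emeasure (distr (index_measure a) borel y) A \<le> emeasure M A"
    using A M(2) by (subst emeasure_distr_index_measure) auto
qed

theorem lemma4p6:
  fixes T :: real
    and \<mu> :: "real \<Rightarrow> (real ^ 'd) measure"
    and v :: "real \<Rightarrow> real ^ 'd \<Rightarrow> real ^ 'd"
    and I :: "real set"
  assumes "0 < T"
    and "continuous_map (top_of_set {0..T}) narrow_topology \<mu>"
    and "(\<lambda>(t, x). v t x) \<in> borel_measurable (restrict_space borel ({0..T} \<times> UNIV))"
    and "(\<integral>\<^sup>+ t\<in>{0..T}. (\<integral>\<^sup>+ x. ennreal (norm (v t x)) \<partial>\<mu> t) \<partial>lborel) < \<infinity>"
    and "CE_classic T \<mu> v"
    and "CE_GC T \<mu> v"
    and "I \<subseteq> {0..T}"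
    and "{0..T} - I \<in> null_sets lebesgue"
    and "\<forall>t\<in>I. \<mu> t \<in> Ppa euclidean"
  shows "(\<exists>\<Lambda> \<in> Ppa (curve_space T).
            (\<forall>t\<in>{0..T}. distr \<Lambda> borel (\<lambda>\<gamma>. \<gamma> t) = \<mu> t) \<and>
            (AE \<gamma> in \<Lambda>. \<gamma> \<in> AC T \<and>
               (AE t in lborel. t \<in> {0..T} \<longrightarrow>
                  (\<gamma> has_vector_derivative v t (\<gamma> t)) (at t within {0..T})))) \<and>
         (\<forall>t\<in>{0..T}. \<mu> t \<in> Ppa euclidean)"
proof -
  interpret GC_solution T \<mu> v using assms by unfold_locales
  obtain D :: "(real ^ 'd) set" where D: "countable D" "\<And>X. open X \<Longrightarrow> X \<noteq> {} \<Longrightarrow> \<exists>d\<in>D. d \<in> X"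
    using countable_dense_exists by blast
  have D2: "\<exists>d\<in>D. dist d x < e" if "0 < e" for x e
    using D(2)[of "ball x e"] that by (auto simp: dist_commute)
  have "AE t in lebesgue. t \<notin> {0..T} - I" using assms(8) by (rule AE_not_in)
  then have "AE t in lborel. t \<notin> {0..T} - I" by (simp add: AE_completion_iff)
  then have Q: "AE t in lborel. t \<in> {0<..<T} \<longrightarrow> t \<in> I" by eventually_elim auto
  obtain G where G: "good D G" "\<And>t. t \<in> G \<Longrightarrow> t \<in> I" "AE t in lborel. t \<in> {0<..<T} \<longrightarrow> t \<in> G"
    using good_exists[OF D(1) Q] by blast
  have GT: "G \<subseteq> {0..T}" using G(1) by (auto simp: good_def)
  have dense: "{0..T} \<subseteq> closure G" by (rule dense_if_conull[OF T G(3)])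
  then obtain t0 where t0: "t0 \<in> G" using T by (cases "G = {}") auto
  then have t0T: "t0 \<in> {0..T}" using GT by auto
  obtain a :: "nat \<Rightarrow> real" and x where x: "inj x" and a: "\<And>i. 0 \<le> a i" "\<And>i. a i \<le> 1" "decseq a" "a sums 1"
    and ax: "\<And>i. measure (\<mu> t0) {x i} = a i"
    using Ppa_euclideanE[OF _ \<mu>_prob(1)[OF t0T]] assms(9) G(2)[OF t0] by metis
  obtain c where c_all: "(\<forall>i. continuous_on {0..T} (c i) \<and> c i t0 = x i) \<and>
    (\<forall>i. 0 < a i \<longrightarrow> c i \<in> AC T \<and>
      (AE t in lborel. t \<in> {0<..<T} \<longrightarrow> (c i has_vector_derivative v t (c i t)) (at t)) \<and>
      (\<forall>t\<in>G. measure (\<mu> t) {c i t} = a i)) \<and>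
    (\<forall>t\<in>G. inj_on (\<lambda>i. c i t) {i. 0 < a i})"
    using exE[OF atom_curves[OF G(1,3) D(1) D2 t0 x, unfolded ax]] .
  then have c: "\<And>i. continuous_on {0..T} (c i)" "\<And>i. c i t0 = x i"
    and cAC: "\<And>i. 0 < a i \<Longrightarrow> c i \<in> AC T"
    and cv: "\<And>i. 0 < a i \<Longrightarrow> AE t in lborel. t \<in> {0<..<T} \<longrightarrow> (c i has_vector_derivative v t (c i t)) (at t)"
    and cm: "\<And>i t. 0 < a i \<Longrightarrow> t \<in> G \<Longrightarrow> measure (\<mu> t) {c i t} = a i"
    and cinj: "\<And>t. t \<in> G \<Longrightarrow> inj_on (\<lambda>i. c i t) {i. 0 < a i}"
    by simp_all
  have marg: "distr (index_measure a) borel (\<lambda>i. c i t) = \<mu> t" if "t \<in> {0..T}" for t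
  proof (rule narrow_limit_of_curves[OF assms(2) a(1,4) c(1) GT dense _ that])
    fix t assume "t \<in> G"
    then show "distr (index_measure a) borel (\<lambda>i. c i t) = \<mu> t"
      using GT by (intro atoms_exhaust \<mu>_prob a cm cinj) auto
  qed
  define C where "C i = restrict (c i) {0..T}" for i
  have C_top: "range C \<subseteq> topspace (curve_space T)"
  proof (rule image_subsetI)
    fix i
    have "continuous_on {0..T} (C i)"
      using c(1)[of i] by (rule continuous_on_eq) (simp add: C_def)
    then show "C i \<in> topspace (curve_space T)" by (simp add: topspace_curve_space C_def)
  qed
  have "inj C"
  proof (rule injI)
    fix i j assume "C i = C j"
    then have "C i t0 = C j t0" by simp
    then show "i = j" using t0T c(2) x by (simp add: C_def inj_def)
  qed
  define \<Lambda> where "\<Lambda> = distr (index_measure a) (borel_of (curve_space T)) C"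
  have C_meas: "C \<in> index_measure a \<rightarrow>\<^sub>M borel_of (curve_space T)"
    using C_top by (auto simp: measurable_def)
  have \<Lambda>: "\<Lambda> \<in> Ppa (curve_space T)"
    unfolding \<Lambda>_def by (intro distr_index_measure_in_Ppa \<open>inj C\<close> C_top a)
  have ev: "distr \<Lambda> borel (\<lambda>\<gamma>. \<gamma> t) = \<mu> t" if "t \<in> {0..T}" for t
  proof -
    have "distr \<Lambda> borel (\<lambda>\<gamma>. \<gamma> t) = distr (index_measure a) borel ((\<lambda>\<gamma>. \<gamma> t) \<circ> C)"
      unfolding \<Lambda>_def by (rule distr_distr[OF evaluation_measurable[OF that] C_meas])
    also have "(\<lambda>\<gamma>. \<gamma> t) \<circ> C = (\<lambda>i. c i t)" using that by (auto simp: C_def)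
    finally show ?thesis using marg[OF that] by simp
  qed
  \<comment> \<open>the curves of weight \<open>0\<close> are only padding and need not solve the equation\<close>
  define B where "B = C ` {i. 0 < a i}"
  have B: "B \<in> sets (borel_of (curve_space T))"
  proof (rule sets.countable)
    show "{\<gamma>} \<in> sets (borel_of (curve_space T))" if "\<gamma> \<in> B" for \<gamma>
      using that C_top by (intro closedin_in_borel_of closedin_curve_space_singleton) (auto simp: B_def)
  qed (simp add: B_def)
  have "emeasure \<Lambda> (topspace (curve_space T) - B) = (\<Sum>i. ennreal (a i) * indicator (topspace (curve_space T) - B) (C i))"
    unfolding \<Lambda>_def using C_top sets.compl_sets[OF B]
    by (intro emeasure_distr_index_measure) auto
  also have "\<dots> = (\<Sum>i. 0)"
  proof (rule suminf_cong)
    show "ennreal (a i) * indicator (topspace (curve_space T) - B) (C i) = 0" for i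
      using a(1)[of i] by (cases "0 < a i") (auto simp: B_def)
  qed
  finally have "topspace (curve_space T) - B \<in> null_sets \<Lambda>"
    using sets.compl_sets[OF B] by (auto simp: null_sets_def \<Lambda>_def)
  from AE_not_in[OF this] AE_space[of \<Lambda>] have "AE \<gamma> in \<Lambda>. \<gamma> \<in> B"
    by eventually_elim (auto simp: \<Lambda>_def)
  moreover have "\<gamma> \<in> AC T \<and> (AE t in lborel. t \<in> {0..T} \<longrightarrow>
      (\<gamma> has_vector_derivative v t (\<gamma> t)) (at t within {0..T}))" if \<gamma>: "\<gamma> \<in> B" for \<gamma>
  proof -
    obtain i where i: "0 < a i" "\<gamma> = C i" using \<gamma> by (auto simp: B_def)
    have "\<gamma> \<in> AC T" using AC_restrict[OF cAC[OF i(1)]] by (simp add: i(2) C_def)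
    moreover have "AE t in lborel. t \<in> {0..T} \<longrightarrow> (\<gamma> has_vector_derivative v t (\<gamma> t)) (at t within {0..T})"
      using cv[OF i(1)] AE_lborel_singleton[of 0] AE_lborel_singleton[of T]
    proof eventually_elim
      case (elim t)
      show ?case
      proof
        assume t: "t \<in> {0..T}"
        then have "(c i has_vector_derivative v t (c i t)) (at t within {0..T})"
          using elim by (auto intro: has_vector_derivative_at_within)
        then show "(\<gamma> has_vector_derivative v t (\<gamma> t)) (at t within {0..T})"
          using t by (auto simp: i(2) C_def intro!: has_vector_derivative_transform[of t "{0..T}" _ "c i"])
      qed
    qed
    ultimately show ?thesis by blast
  qed
  ultimately have AE: "AE \<gamma> in \<Lambda>. \<gamma> \<in> AC T \<and> (AE t in lborel. t \<in> {0..T} \<longrightarrow>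
      (\<gamma> has_vector_derivative v t (\<gamma> t)) (at t within {0..T}))"
    by (auto elim: AE_mp)
  have "\<mu> t \<in> Ppa euclidean" if t: "t \<in> {0..T}" for t
  proof (rule countably_supported_in_Ppa[OF \<mu>_prob[OF t], of "range (\<lambda>i. c i t)"])
    have "range (\<lambda>i. c i t) \<in> sets borel" by (rule sets.countable) auto
    then have "- range (\<lambda>i. c i t) \<in> sets borel" by (rule borel_comp)
    from emeasure_distr_index_measure[OF _ this, of "\<lambda>i. c i t" a]
    show "emeasure (\<mu> t) (- range (\<lambda>i. c i t)) = 0" by (simp add: marg[OF t])
  qed simp
  with \<Lambda> ev AE show ?thesis by blast
qed

end
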